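(* Let $d \ge 1$ be an integer and let $\mathbf X^{(1)}, \mathbf X^{(2)}, \dots$ be i.i.d. random vectors in $\mathbb R^d$, each with independent Exponential$(1)$ coordinates. For $n\ge 1$ let $K_n = -1$ if $\mathbf X^{(n)}$ does not set a record, and otherwise let $K_n$ denote the number of remaining records killed by $\mathbf X^{(n)}$. Then, as $n \to \infty$, the conditional distribution of $K_n$ given $K_n \ge 0$ converges weakly to the law of a random variable $\mathcal K \equiv \mathcal K(d)$, where $\mathcal L(\mathcal K)$ is the mixture $\mathbb E\,\mathcal L(\mathcal K_G)$, i.e. $\mathbb P(\mathcal K = k) = \int_{-\infty}^\infty \mathbb P(\mathcal K_g = k)\, e^{-g}\exp(-e^{-g})\,dg$ for $k = 0,1,2,\dots$. Here $G$ has the standard Gumbel distribution and, for $g \in \mathbb R$, $\mathcal K_g$ is the number of maxima dominated by $\mathbf x \equiv \mathbf x(g) := (g/d, \dots, g/d)$ in a nonhomogeneous Poisson point process in $\mathbb R^d$ with intensity function $\mathbf z \mapsto \mathbf 1(\mathbf z \not\succ \mathbf x)\, e^{-z_+}$, $\mathbf z \in \mathbb R^d$.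
   Context: For $\mathbf x, \mathbf y \in \mathbb R^d$, $\mathbf x \prec \mathbf y$ (equivalently $\mathbf y \succ \mathbf x$; "$\mathbf x$ is dominated by $\mathbf y$") means $x_j < y_j$ for every $j = 1,\dots,d$; $z_+ := \sum_{j=1}^d z_j$. $\mathbf 1(E)$ is $1$ if $E$ is true and $0$ otherwise. $\mathcal L(Y)$ denotes the law of $Y$. Records: $\mathbf X^{(n)}$ sets a record if $\mathbf X^{(n)} \not\prec \mathbf X^{(i)}$ for all $1 \le i < n$. For $1 \le j \le n$, $\mathbf X^{(j)}$ is a remaining (current) record at time $n$ if $\mathbf X^{(j)} \not\prec \mathbf X^{(i)}$ for all $1 \le i \le n$. If $\mathbf X^{(n)}$ sets a record, the number of remaining records it kills (breaks) is the number of $j$ with $1 \le j < n$ such that $\mathbf X^{(j)}$ is a remaining record at time $n-1$ but not at time $n$. Maxima: a point $\mathbf y$ of a point process (or set) $S\subseteq\mathbb R^d$ is a maximum of $S$ if $\mathbf y \not\prec \mathbf z$ for all $\mathbf z \in S$. The standard Gumbel distribution has density $g \mapsto e^{-g}\exp(-e^{-g})$ on $\mathbb R$. *)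

theory Defs
  imports "HOL-Probability.Probability"
begin

definition dominated :: "real ^ 'd \<Rightarrow> real ^ 'd \<Rightarrow> bool"
  where "dominated x y \<longleftrightarrow> (\<forall>j. x $ j < y $ j)"

subsection \<open>Records\<close>

text \<open>Sequences of vectors are indexed from 1; the value at index 0 is never used.\<close>

definition sets_record :: "(nat \<Rightarrow> real ^ 'd) \<Rightarrow> nat \<Rightarrow> bool"
  where "sets_record x n \<longleftrightarrow> (\<forall>i. 1 \<le> i \<and> i < n \<longrightarrow> \<not> dominated (x n) (x i))"

definition remaining_record :: "(nat \<Rightarrow> real ^ 'd) \<Rightarrow> nat \<Rightarrow> nat \<Rightarrow> bool"
  where "remaining_record x n j \<longleftrightarrow>
    1 \<le> j \<and> j \<le> n \<and> (\<forall>i. 1 \<le> i \<and> i \<le> n \<longrightarrow> \<not> dominated (x j) (x i))"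

definition records_killed :: "(nat \<Rightarrow> real ^ 'd) \<Rightarrow> nat \<Rightarrow> int"
  where "records_killed x n =
    (if sets_record x n
     then int (card {j. 1 \<le> j \<and> j < n \<and>
                        remaining_record x (n - 1) j \<and> \<not> remaining_record x n j})
     else - 1)"

subsection \<open>Poisson point processes and their maxima\<close>

text \<open>Unlike \<^const>\<open>card\<close>, the following gives infinite sets the value \<open>\<infinity>\<close>.\<close>

definition num_points :: "'a set \<Rightarrow> enat"
  where "num_points A = (if finite A then enat (card A) else \<infinity>)"

text \<open>
  A Poisson point process on \<open>\<real>\<^sup>d\<close> with locally integrable intensity function \<open>f\<close>, realised as a
  random locally finite set of points. As the intensity measure has no atoms, the process has no
  multiple points, so that sets suffice. Counts in sets of infinite intensity measure are
  almost surely infinite; this follows from the other clauses.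
\<close>

definition poisson_point_process ::
  "'w measure \<Rightarrow> (real ^ 'd \<Rightarrow> real) \<Rightarrow> ('w \<Rightarrow> (real ^ 'd) set) \<Rightarrow> bool"
  where "poisson_point_process N f S \<longleftrightarrow>
    prob_space N \<and>
    (\<forall>\<omega>\<in>space N. \<forall>B. bounded B \<longrightarrow> finite (S \<omega> \<inter> B)) \<and>
    (\<forall>B\<in>sets borel. (\<lambda>\<omega>. num_points (S \<omega> \<inter> B)) \<in> measurable N (count_space UNIV)) \<and>
    (\<forall>B\<in>sets borel. emeasure (density lborel (\<lambda>z. ennreal (f z))) B < \<infinity> \<longrightarrow>
       (let \<mu> = measure (density lborel (\<lambda>z. ennreal (f z))) B in
        \<forall>k. measure N {\<omega>\<in>space N. num_points (S \<omega> \<inter> B) = enat k}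
              = \<mu> ^ k / fact k * exp (- \<mu>))) \<and>
    (\<forall>m (B :: nat \<Rightarrow> (real ^ 'd) set).
       (\<forall>i<m. B i \<in> sets borel) \<and> disjoint_family_on B {..<m} \<longrightarrow>
       prob_space.indep_vars N (\<lambda>_. count_space UNIV)
         (\<lambda>i \<omega>. num_points (S \<omega> \<inter> B i)) {..<m})"

definition maxima :: "(real ^ 'd) set \<Rightarrow> (real ^ 'd) set"
  where "maxima S = {y \<in> S. \<forall>z\<in>S. \<not> dominated y z}"

definition diag_point :: "real \<Rightarrow> real ^ 'd::finite"
  where "diag_point g = (\<chi> j. g / real CARD('d))"

definition limit_intensity :: "real \<Rightarrow> real ^ 'd::finite \<Rightarrow> real"
  where "limit_intensity g z =
    of_bool (\<not> dominated (diag_point g) z) * exp (- (\<Sum>j\<in>UNIV. z $ j))"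

definition dominated_maxima :: "real \<Rightarrow> (real ^ 'd::finite) set \<Rightarrow> enat"
  where "dominated_maxima g S = num_points {y \<in> maxima S. dominated y (diag_point g)}"

definition gumbel_density :: "real \<Rightarrow> real"
  where "gumbel_density g = exp (- g) * exp (- exp (- g))"

end

theory Submission
  imports Defs
begin

text \<open>
  Write \<open>N = n - 1\<close> and let \<open>c\<^sub>m\<close> be the probability that exactly \<open>m\<close> of the first \<open>N\<close> points dominate
  the \<open>n\<close>-th one. The \<open>n\<close>-th point sets a record with probability \<open>c\<^sub>0\<close>, and the mean number of
  records that it kills is \<open>c\<^sub>1\<close>. Recursion over the dimension shows that \<open>c\<^sub>m \<le> c\<^sub>0\<close> and
  \<open>c\<^sub>m / c\<^sub>0 \<longlonglongrightarrow> 1\<close>.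

  Fix \<open>T > 0\<close> and count only killed records that differ from the new record \<open>y\<close> by less than \<open>T\<close> in
  each coordinate. By the memoryless property this restricted count depends only on the points that
  dominate \<open>y - (T,\<dots>,T)\<close>, and relative to that corner they are again i.i.d. exponential vectors.
  Let \<open>a\<^sub>m\<close> be the probability that none of \<open>m\<close> exponential vectors dominates \<open>(T,\<dots>,T)\<close> while exactly
  \<open>k\<close> of their maxima are dominated by it. The restricted count is \<open>k\<close>, given a record, with
  asymptotic probability \<open>exp (- d T) * (\<Sum>m. a\<^sub>m)\<close>. The discarded records have conditional mean at most
  \<open>P (\<not> E \<prec> (T,\<dots>,T))\<close>, where \<open>E\<close> is an exponential vector, uniformly in \<open>n\<close>.

  For the Poisson process the restricted count is \<open>k\<close> with probability
  \<open>\<Sum>m. exp (- \<mu>) * \<lambda>\<^sup>m / m! * a\<^sub>m\<close>, where \<open>\<lambda> = exp (d T - g)\<close> and \<open>\<mu> = \<lambda> - exp (- g)\<close>. Only the lower bound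
  is needed, because both sides sum to 1 over \<open>k\<close>; it comes from a grid fine enough to
  separate the points in every coordinate. Integrating against the Gumbel density gives
  \<open>exp (- d T) * (\<Sum>m. a\<^sub>m)\<close> again, and \<open>T \<longlonglongrightarrow> \<infinity>\<close> finishes the proof.
\<close>

section \<open>Mixed binomial probabilities\<close>

text \<open>The mean number of kills is \<open>c\<^sub>1\<close> by exchangeability: swapping the
  roles of \<open>j\<close> and \<open>n\<close> turns "\<open>X\<^sub>j\<close> is dominated by
  \<open>X\<^sub>n\<close> and by no other point" into "\<open>X\<^sub>j\<close> alone dominates
  \<open>X\<^sub>n\<close>". The memoryless property makes the difference of a new record and a
  killed one exponential again, hence the uniform bound on discarded records. That property needs a
  corner in the positive orthant, so the new record must itself dominate \<open>(T,...,T)\<close>;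
  given a record, the probability of this tends to 1. The obstacle on the Poisson side is an
  infinite total intensity and a process known only through its counts. Above a corner there are
  finitely many points, but their joint law has to be recovered from counts in cells. The Gumbel law
  gives every \<open>m\<close> the same weight: as \<lambda> - \<mu> = exp(-g), its factor
  exp(-exp(-g)) turns exp(-\<mu>) into exp(-\<lambda>), and exp(-g) dg becomes exp(-d T) d\<lambda>.
  What remains is the Gamma integral of \<lambda>^m / m! exp(-\<lambda>), which is 1 for each
  \<open>m\<close>. This mirrors the convergence of the ratios of \<open>c\<^sub>m\<close> and
  \<open>c\<^sub>0\<close>.\<close>

definition binom_prob :: "nat \<Rightarrow> nat \<Rightarrow> real \<Rightarrow> real" where
  "binom_prob N m u = real (N choose m) * u ^ m * (1 - u) ^ (N - m)"

lemma binom_prob_nonneg: "0 \<le> u \<Longrightarrow> u \<le> 1 \<Longrightarrow> 0 \<le> binom_prob N m u"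
  by (simp add: binom_prob_def)

lemma sum_binom_prob: "(\<Sum>m\<le>N. binom_prob N m u) = 1"
  using binomial_ring[of u "1 - u" N] by (simp add: binom_prob_def)

lemma binom_prob_le_1:
  assumes "0 \<le> u" "u \<le> 1"
  shows "binom_prob N m u \<le> 1"
proof (cases "m \<le> N")
  case True
  then have "binom_prob N m u \<le> (\<Sum>m\<le>N. binom_prob N m u)"
    using assms by (intro member_le_sum binom_prob_nonneg) auto
  then show ?thesis by (simp add: sum_binom_prob)
qed (simp add: binom_prob_def binomial_eq_0)

lemma binom_prob_eq_0: "N < m \<Longrightarrow> binom_prob N m u = 0"
  by (simp add: binom_prob_def)

lemma borel_measurable_binom_prob [measurable]: "binom_prob N m \<in> borel_measurable borel"
  unfolding binom_prob_def by measurable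

text \<open>In dimension \<open>d = k + 1\<close>, where the sum of the coordinates is Erlang distributed, this is \<open>c\<^sub>m\<close>.\<close>

definition mixed_binom :: "nat \<Rightarrow> nat \<Rightarrow> nat \<Rightarrow> real" where
  "mixed_binom k N m = (\<integral>s. erlang_density k 1 s * binom_prob N m (exp (- s)) \<partial>lborel)"

lemma integrable_erlang_density: "integrable lborel (erlang_density k 1)"
proof (rule integrableI_nonneg)
  show "(\<integral>\<^sup>+ x. ennreal (erlang_density k 1 x) \<partial>lborel) < \<infinity>"
    using nn_integral_erlang_ith_moment[of 1 k 0] by simp
qed auto

lemma integrable_mixed_binom:
  "integrable lborel (\<lambda>s. erlang_density k 1 s * binom_prob N m (exp (- s)))"
proof (rule Bochner_Integration.integrable_bound[OF integrable_erlang_density[of k]])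
  show "AE s in lborel. norm (erlang_density k 1 s * binom_prob N m (exp (- s)))
    \<le> norm (erlang_density k 1 s)"
    by (intro AE_I2) (auto simp: erlang_density_def abs_mult binom_prob_nonneg binom_prob_le_1
      intro!: mult_left_le divide_right_mono)
qed measurable

lemma mixed_binom_nonneg: "0 \<le> mixed_binom k N m"
  unfolding mixed_binom_def
  by (intro integral_nonneg_AE AE_I2)
     (auto simp: erlang_density_def binom_prob_nonneg)

lemma mixed_binom_eq_0: "N < m \<Longrightarrow> mixed_binom k N m = 0"
  by (simp add: mixed_binom_def binom_prob_eq_0)

text \<open>Only the right limit of \<open>F\<close> at 0 enters: the Erlang integrands vanish for
  negative \<open>s\<close> and may jump at 0 when \<open>k = 0\<close>.\<close>

lemma integral_derivative_Ioi:
  fixes F f :: "real \<Rightarrow> real"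
  assumes int: "integrable lborel f"
    and zero: "\<And>s. s < 0 \<Longrightarrow> f s = 0"
    and deriv: "\<And>s. 0 < s \<Longrightarrow> (F has_real_derivative f s) (at s)"
    and cont: "\<And>s. 0 < s \<Longrightarrow> isCont f s"
    and lim0: "(F \<longlongrightarrow> a) (at_right 0)" and lim: "(F \<longlongrightarrow> b) at_top"
  shows "(\<integral>s. f s \<partial>lborel) = b - a"
proof -
  have "(LBINT s=ereal 0..\<infinity>. f s) = b - a"
  proof (rule interval_integral_FTC_integrable[where F = F])
    show "set_integrable lborel (einterval (ereal 0) \<infinity>) f"
      unfolding set_integrable_def using int
      by (intro integrable_mult_indicator) auto
    show "((F \<circ> real_of_ereal) \<longlongrightarrow> a) (at_right (ereal 0))"
      using lim0 by (simp add: ereal_tendsto_simps1)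
    show "((F \<circ> real_of_ereal) \<longlongrightarrow> b) (at_left \<infinity>)"
      using lim by (simp add: ereal_tendsto_simps1)
  qed (use deriv cont in \<open>auto simp: has_real_derivative_iff_has_vector_derivative\<close>)
  also have "(LBINT s=ereal 0..\<infinity>. f s) = (LBINT s:{0<..}. f s)"
    by (simp add: interval_integral_to_infinity_eq)
  also have "\<dots> = (\<integral>s. f s \<partial>lborel)"
    unfolding set_lebesgue_integral_def
  proof (rule integral_cong_AE)
    show "AE s in lborel. indicator {0<..} s *\<^sub>R f s = f s"
      using AE_lborel_singleton[of "0::real"]
      by eventually_elim (auto simp: zero split: split_indicator intro: zero)
  qed (use int in auto)
  finally show ?thesis by simp
qed

text \<open>This is the Bernstein polynomial \<open>binom_prob (Suc N) (Suc m)\<close> at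
  \<open>exp (- s)\<close>, written so that its decay like \<open>exp (- s)\<close> is visible. The
  derivative of a Bernstein polynomial is a multiple of a difference of two of degree one less,
  which makes neighbouring values of \<open>m\<close> comparable.\<close>

definition binom_prim :: "nat \<Rightarrow> nat \<Rightarrow> real \<Rightarrow> real" where
  "binom_prim N m s = exp (- s) * binom_prob N m (exp (- s)) * (real (Suc N) / real (Suc m))"

lemma binom_prim_altdef:
  "binom_prim N m s = real (Suc N choose Suc m) * exp (- s) ^ Suc m * (1 - exp (- s)) ^ (N - m)"
proof -
  have "real (Suc m) * real (Suc N choose Suc m) = real (Suc N) * real (N choose m)"
    using Suc_times_binomial[of m N] by (metis of_nat_mult)
  then show ?thesis
    by (simp add: binom_prim_def binom_prob_def divide_simps del: binomial_Suc_Suc)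
      (simp add: algebra_simps del: binomial_Suc_Suc)
qed

lemma has_real_derivative_binom_prim:
  "(binom_prim N m has_real_derivative
     real (Suc N) * exp (- s) * (binom_prob N (Suc m) (exp (- s)) - binom_prob N m (exp (- s)))) (at s)"
proof -
  let ?u = "exp (- s)"
  \<comment> \<open>Absorption identities: \<open>c1\<close> and \<open>c2\<close> move the factors
    produced by the product rule into binomial coefficients of degree \<open>N\<close>.\<close>
  have c1: "real (Suc m) * real (Suc N choose Suc m) = real (Suc N) * real (N choose m)"
    using Suc_times_binomial[of m N] by (metis of_nat_mult)
  have c2: "real (Suc N choose Suc m) * real (N - m) = real (Suc N) * real (N choose Suc m)"
  proof -
    have "real (N choose m) * real (N - m) = real (Suc m) * real (N choose Suc m)"
      by (metis binomial_absorb_comp binomial_absorption mult.commute of_nat_mult)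
    then have "real (Suc m) * (real (Suc N choose Suc m) * real (N - m))
      = real (Suc m) * (real (Suc N) * real (N choose Suc m))"
      using c1 by (metis mult.assoc mult.left_commute)
    then show ?thesis by simp
  qed
  have "(binom_prim N m has_real_derivative
      real (Suc N choose Suc m) * (- (real (Suc m) * ?u ^ Suc m) * (1 - ?u) ^ (N - m)
        + ?u ^ Suc m * (real (N - m) * (1 - ?u) ^ (N - m - 1) * ?u))) (at s)"
    unfolding binom_prim_altdef[abs_def] mult.assoc
    by (rule derivative_eq_intros refl | simp add: algebra_simps del: binomial_Suc_Suc of_nat_Suc)+
  moreover have "real (Suc N choose Suc m) * (- (real (Suc m) * ?u ^ Suc m) * (1 - ?u) ^ (N - m)
        + ?u ^ Suc m * (real (N - m) * (1 - ?u) ^ (N - m - 1) * ?u))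
     = - (real (Suc m) * real (Suc N choose Suc m)) * ?u ^ Suc m * (1 - ?u) ^ (N - m)
       + (real (Suc N choose Suc m) * real (N - m)) * ?u ^ Suc m * (1 - ?u) ^ (N - m - 1) * ?u"
    by (simp add: algebra_simps del: binomial_Suc_Suc of_nat_Suc)
  moreover have "\<dots> = real (Suc N) * ?u * (binom_prob N (Suc m) ?u - binom_prob N m ?u)"
    unfolding c1 c2 binom_prob_def by (simp add: algebra_simps)
  ultimately show ?thesis by simp
qed

lemma binom_prim_le: "0 \<le> s \<Longrightarrow> norm (binom_prim N m s) \<le> exp (- s) * (real (Suc N) / real (Suc m))"
  unfolding binom_prim_def
  by (auto simp: abs_mult binom_prob_nonneg binom_prob_le_1
      intro!: mult_right_mono divide_right_mono)

lemma tendsto_power_binom_prim: "((\<lambda>s. s ^ k / fact k * binom_prim N m s) \<longlongrightarrow> 0) at_top"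
proof (rule Lim_null_comparison)
  show "eventually (\<lambda>s. norm (s ^ k / fact k * binom_prim N m s)
      \<le> (s ^ k / exp s) * (real (Suc N) / real (Suc m) / fact k)) at_top"
    using eventually_ge_at_top[of "0::real"]
  proof eventually_elim
    case (elim s)
    have "norm (s ^ k / fact k * binom_prim N m s) = s ^ k / fact k * norm (binom_prim N m s)"
      using elim by (simp add: abs_mult)
    also have "\<dots> \<le> s ^ k / fact k * (exp (- s) * (real (Suc N) / real (Suc m)))"
      using elim by (intro mult_left_mono binom_prim_le) auto
    finally show ?case by (simp add: exp_minus field_simps)
  qed
  show "((\<lambda>s. (s ^ k / exp s) * (real (Suc N) / real (Suc m) / fact k)) \<longlongrightarrow> 0) at_top"
    using tendsto_mult_left_zero[OF tendsto_power_div_exp_0] by blast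
qed

lemma isCont_binom_prob: "isCont (\<lambda>s. binom_prob N m (exp (- s))) s"
  unfolding binom_prob_def by (intro continuous_intros)

lemma isCont_erlang_density: "0 < s \<Longrightarrow> isCont (erlang_density k 1) s"
proof -
  assume s: "0 < s"
  have "isCont (\<lambda>s::real. s ^ k * exp (- s) / fact k) s" by (intro continuous_intros) auto
  moreover have "eventually (\<lambda>s. erlang_density k 1 s = s ^ k * exp (- s) / fact k) (nhds s)"
    by (rule eventually_mono[OF eventually_nhds_in_open[of "{0<..}"]])
      (use s in \<open>auto simp: erlang_density_def\<close>)
  ultimately show ?thesis by (subst isCont_cong)
qed

text \<open>Integration by parts against \<^const>\<open>binom_prim\<close>; the boundary terms vanish.\<close>

lemma mixed_binom_Suc:
  "mixed_binom (Suc k) N m - mixed_binom (Suc k) N (Suc m) = mixed_binom k N m / real (Suc m)"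
proof -
  let ?b = "\<lambda>m s. binom_prob N m (exp (- s))"
  let ?f = "\<lambda>s. real (Suc N) * (erlang_density k 1 s * ?b m s / real (Suc m)
     + erlang_density (Suc k) 1 s * ?b (Suc m) s - erlang_density (Suc k) 1 s * ?b m s)"
  have "(\<integral>s. ?f s \<partial>lborel) = 0 - 0"
  proof (rule integral_derivative_Ioi[where F = "\<lambda>s. s ^ Suc k / fact (Suc k) * binom_prim N m s"])
    show "integrable lborel ?f"
      by (intro integrable_mult_right Bochner_Integration.integrable_add
          Bochner_Integration.integrable_diff integrable_divide integrable_mixed_binom)
    show "((\<lambda>s. s ^ Suc k / fact (Suc k) * binom_prim N m s) \<longlongrightarrow> 0) (at_right 0)"
    proof -
      have "isCont (\<lambda>s. s ^ Suc k / fact (Suc k) * binom_prim N m s) 0"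
        unfolding binom_prim_def by (intro continuous_intros isCont_binom_prob) auto
      then have "((\<lambda>s. s ^ Suc k / fact (Suc k) * binom_prim N m s) \<longlongrightarrow>
          0 ^ Suc k / fact (Suc k) * binom_prim N m 0) (at_right 0)"
        unfolding isCont_def by (rule tendsto_within_subset) simp
      then show ?thesis by simp
    qed
    fix s :: real assume s: "0 < s"
    have d: "((\<lambda>s. s ^ Suc k / fact (Suc k)) has_real_derivative s ^ k / fact k) (at s)"
      by (rule derivative_eq_intros refl | simp add: divide_simps)+
    show "((\<lambda>s. s ^ Suc k / fact (Suc k) * binom_prim N m s) has_real_derivative ?f s) (at s)"
    proof (rule DERIV_cong[OF DERIV_mult[OF d has_real_derivative_binom_prim]])
      have "erlang_density k 1 s = s ^ k / fact k * exp (- s)"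
        "erlang_density (Suc k) 1 s = s ^ Suc k / fact (Suc k) * exp (- s)"
        using s by (auto simp: erlang_density_def)
      then show "s ^ k / fact k * binom_prim N m s + real (Suc N) * exp (- s) *
          (?b (Suc m) s - ?b m s) * (s ^ Suc k / fact (Suc k)) = ?f s"
        by (simp only: binom_prim_def divide_inverse) (simp only: algebra_simps)
    qed
    show "isCont ?f s"
      by (intro continuous_intros isCont_binom_prob isCont_erlang_density s) auto
  qed (simp_all only: tendsto_power_binom_prim, simp add: erlang_density_def)
  also have "(\<integral>s. ?f s \<partial>lborel) = real (Suc N) * (mixed_binom k N m / real (Suc m)
      + mixed_binom (Suc k) N (Suc m) - mixed_binom (Suc k) N m)"
    unfolding mixed_binom_def
    using integrable_mixed_binom[of k N m] integrable_mixed_binom[of "Suc k" N m]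
      integrable_mixed_binom[of "Suc k" N "Suc m"]
    by simp
  finally show ?thesis by simp
qed

text \<open>In dimension one the number of larger points among \<open>N\<close> others is a rank and
  hence uniform on \<open>N + 1\<close> values. The primitive of the recursion is used without a
  power of \<open>s\<close>, so its boundary term at 0 survives when \<open>m = N\<close>; the
  common value then propagates downwards from there.\<close>

lemma mixed_binom_0:
  assumes "m \<le> N"
  shows "mixed_binom 0 N m = 1 / real (Suc N)"
proof -
  let ?b = "\<lambda>m s. binom_prob N m (exp (- s))"
  have step: "mixed_binom 0 N m - mixed_binom 0 N (Suc m) = (if m = N then 1 / real (Suc N) else 0)"
    if "m \<le> N" for m
  proof -
    let ?f = "\<lambda>s. real (Suc N) * (erlang_density 0 1 s * ?b (Suc m) s - erlang_density 0 1 s * ?b m s)"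
    have "(\<integral>s. ?f s \<partial>lborel) = 0 - (if m = N then 1 else 0)"
    proof (rule integral_derivative_Ioi[where F = "binom_prim N m"])
      show "integrable lborel ?f"
        by (intro integrable_mult_right Bochner_Integration.integrable_diff integrable_mixed_binom)
      have "isCont (binom_prim N m) 0"
        unfolding binom_prim_def[abs_def] by (intro continuous_intros isCont_binom_prob) auto
      then have "(binom_prim N m \<longlongrightarrow> binom_prim N m 0) (at_right 0)"
        unfolding isCont_def by (rule tendsto_within_subset) simp
      moreover have "binom_prim N m 0 = (if m = N then 1 else 0)"
        using that by (auto simp: binom_prim_def binom_prob_def)
      ultimately show "(binom_prim N m \<longlongrightarrow> (if m = N then 1 else 0)) (at_right 0)" by simp
      show "(binom_prim N m \<longlongrightarrow> 0) at_top"
        using tendsto_power_binom_prim[of 0 N m] by simp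
      fix s :: real assume s: "0 < s"
      show "(binom_prim N m has_real_derivative ?f s) (at s)"
        by (rule DERIV_cong[OF has_real_derivative_binom_prim])
          (use s in \<open>simp add: erlang_density_def algebra_simps\<close>)
      show "isCont ?f s"
        by (intro continuous_intros isCont_binom_prob isCont_erlang_density s)
    qed (auto simp: erlang_density_def)
    also have "(\<integral>s. ?f s \<partial>lborel) = real (Suc N) * (mixed_binom 0 N (Suc m) - mixed_binom 0 N m)"
      unfolding mixed_binom_def
      using integrable_mixed_binom[of 0 N m] integrable_mixed_binom[of 0 N "Suc m"] by simp
    finally have "real (Suc N) * (mixed_binom 0 N m - mixed_binom 0 N (Suc m)) = (if m = N then 1 else 0)"
      by (simp add: right_diff_distrib)
    then show ?thesis by (auto simp: divide_simps mult.commute simp del: of_nat_Suc)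
  qed
  from assms show ?thesis
  proof (induction m rule: inc_induct)
    case base
    then show ?case using step[of N] mixed_binom_eq_0[of N "Suc N" 0] by simp
  next
    case (step n)
    then show ?case using \<open>\<And>m. m \<le> N \<Longrightarrow> _\<close>[of n] by simp
  qed
qed

text \<open>For \<open>k > 0\<close> the recursion exhibits every consecutive difference as
  nonnegative; for \<open>k = 0\<close> the values are constant up to \<open>N\<close> and zero
  beyond.\<close>

lemma mixed_binom_antimono_0: "mixed_binom k N m \<le> mixed_binom k N 0"
proof (cases k)
  case 0
  then show ?thesis
    using mixed_binom_0[of 0 N] mixed_binom_0[of m N] mixed_binom_eq_0[of N m 0] by (cases "m \<le> N") auto
next
  case (Suc k')
  have "antimono (mixed_binom k N)"
  proof (rule antimonoI, erule lift_Suc_antimono_le[rotated])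
    show "mixed_binom k N (Suc n) \<le> mixed_binom k N n" for n
      using mixed_binom_Suc[of k' N n] mixed_binom_nonneg[of k' N n] Suc
      by (smt (verit) divide_nonneg_nonneg of_nat_0_le_iff)
  qed
  then show ?thesis by (simp add: antimono_def)
qed

lemma mixed_binom_0_minus:
  "mixed_binom (Suc k) N 0 - mixed_binom (Suc k) N m = (\<Sum>j<m. mixed_binom k N j / real (Suc j))"
  using sum_lessThan_telescope'[of "mixed_binom (Suc k) N" m] by (simp only: mixed_binom_Suc)

lemma sum_mixed_binom: "(\<Sum>m\<le>N. mixed_binom k N m) = 1"
proof -
  have "(\<Sum>m\<le>N. mixed_binom k N m) = (\<integral>s. erlang_density k 1 s * (\<Sum>m\<le>N. binom_prob N m (exp (- s))) \<partial>lborel)"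
    unfolding mixed_binom_def sum_distrib_left
    by (subst Bochner_Integration.integral_sum) (auto intro: integrable_mixed_binom)
  also have "\<dots> = (\<integral>s. erlang_density k 1 s \<partial>lborel)" by (simp add: sum_binom_prob)
  also have "\<dots> = 1"
    using nn_integral_erlang_ith_moment[of 1 k 0]
    by (simp add: integral_eq_nn_integral)
  finally show ?thesis .
qed

text \<open>The \<open>N + 1\<close> probabilities sum to one and none exceeds the one at 0.
  Conditioning on a record is thereby legitimate for every sample size.\<close>

lemma mixed_binom_0_pos: "0 < mixed_binom k N 0"
proof -
  have "1 \<le> (\<Sum>m\<le>N. mixed_binom k N 0)"
    unfolding sum_mixed_binom[of k N, symmetric] by (intro sum_mono mixed_binom_antimono_0)
  then have "mixed_binom k N 0 \<noteq> 0" by auto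
  then show ?thesis using mixed_binom_nonneg[of k N 0] by simp
qed

text \<open>By telescoping, the values at 0 and \<open>m\<close> for \<open>Suc k\<close> differ by
  at most \<open>m\<close> times \<open>mixed_binom k N 0\<close>. This is negligible because
  \<open>mixed_binom (Suc k) N 0\<close> outgrows \<open>mixed_binom k N 0\<close>: their quotient
  is bounded below by partial sums that tend to harmonic numbers by the induction hypothesis, and
  the harmonic series diverges.\<close>

lemma tendsto_mixed_binom_ratio:
  "(\<lambda>N. mixed_binom k N m / mixed_binom k N 0) \<longlonglongrightarrow> 1"
proof (induction k arbitrary: m)
  case 0
  have "eventually (\<lambda>N. mixed_binom 0 N m / mixed_binom 0 N 0 = 1) sequentially"
    using eventually_ge_at_top[of m] by eventually_elim (simp add: mixed_binom_0)
  then show ?case by (rule tendsto_eventually)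
next
  case (Suc k)
  have "filterlim (\<lambda>N. mixed_binom (Suc k) N 0 / mixed_binom k N 0) at_top sequentially"
    unfolding filterlim_at_top
  proof
    fix Z :: real
    \<comment> \<open>\<open>J\<close> is fixed before \<open>N\<close> grows, since the induction
      hypothesis controls only finitely many ratios at a time.\<close>
    obtain J where J: "harm J \<ge> Z + 1"
      using harm_at_top unfolding filterlim_at_top eventually_sequentially by (metis order_refl)
    have "(\<lambda>N. \<Sum>j<J. (mixed_binom k N j / mixed_binom k N 0) / real (Suc j)) \<longlonglongrightarrow> (\<Sum>j<J. 1 / real (Suc j))"
      by (intro tendsto_sum tendsto_divide Suc.IH tendsto_const) auto
    also have "(\<Sum>j<J. 1 / real (Suc j)) = harm J"
      by (simp add: harm_altdef inverse_eq_divide)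
    finally have "eventually (\<lambda>N. (\<Sum>j<J. (mixed_binom k N j / mixed_binom k N 0) / real (Suc j)) > Z) sequentially"
      by (rule order_tendstoD) (use J in simp)
    then show "eventually (\<lambda>N. Z \<le> mixed_binom (Suc k) N 0 / mixed_binom k N 0) sequentially"
    proof eventually_elim
      case (elim N)
      have "(\<Sum>j<J. (mixed_binom k N j / mixed_binom k N 0) / real (Suc j))
        = (mixed_binom (Suc k) N 0 - mixed_binom (Suc k) N J) / mixed_binom k N 0"
        unfolding mixed_binom_0_minus by (simp add: sum_divide_distrib mult.commute)
      also have "\<dots> \<le> mixed_binom (Suc k) N 0 / mixed_binom k N 0"
        using mixed_binom_nonneg by (intro divide_right_mono) auto
      finally show ?case using elim by simp
    qed
  qed
  then have "(\<lambda>N. inverse (mixed_binom (Suc k) N 0 / mixed_binom k N 0)) \<longlonglongrightarrow> 0"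
    by (rule tendsto_inverse_0_at_top)
  then have inv: "(\<lambda>N. mixed_binom k N 0 / mixed_binom (Suc k) N 0) \<longlonglongrightarrow> 0"
    by simp
  have "(\<lambda>N. (mixed_binom (Suc k) N 0 - mixed_binom (Suc k) N m) / mixed_binom (Suc k) N 0) \<longlonglongrightarrow> 0"
  proof (rule Lim_null_comparison)
    show "(\<lambda>N. real m * (mixed_binom k N 0 / mixed_binom (Suc k) N 0)) \<longlonglongrightarrow> 0"
      using tendsto_mult_right_zero[OF inv] .
    show "eventually (\<lambda>N. norm ((mixed_binom (Suc k) N 0 - mixed_binom (Suc k) N m) / mixed_binom (Suc k) N 0)
      \<le> real m * (mixed_binom k N 0 / mixed_binom (Suc k) N 0)) sequentially"
    proof (rule always_eventually, rule allI)
      fix N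
      have "mixed_binom (Suc k) N 0 - mixed_binom (Suc k) N m \<le> (\<Sum>j<m. mixed_binom k N 0)"
        unfolding mixed_binom_0_minus
      proof (rule sum_mono)
        fix j
        have "mixed_binom k N j / real (Suc j) \<le> mixed_binom k N j"
          using mixed_binom_nonneg[of k N j] by (simp add: divide_le_eq mult_le_cancel_left1)
        then show "mixed_binom k N j / real (Suc j) \<le> mixed_binom k N 0"
          using mixed_binom_antimono_0[of k N j] by simp
      qed
      then show "norm ((mixed_binom (Suc k) N 0 - mixed_binom (Suc k) N m) / mixed_binom (Suc k) N 0)
      \<le> real m * (mixed_binom k N 0 / mixed_binom (Suc k) N 0)"
        using mixed_binom_antimono_0[of "Suc k" N m] mixed_binom_0_pos[of "Suc k" N]
        by (simp add: divide_right_mono)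
    qed
  qed
  then have "(\<lambda>N. 1 - (mixed_binom (Suc k) N 0 - mixed_binom (Suc k) N m) / mixed_binom (Suc k) N 0) \<longlonglongrightarrow> 1 - 0"
    by (intro tendsto_diff tendsto_const)
  moreover have "1 - (mixed_binom (Suc k) N 0 - mixed_binom (Suc k) N m) / mixed_binom (Suc k) N 0
     = mixed_binom (Suc k) N m / mixed_binom (Suc k) N 0" for N
    using mixed_binom_0_pos[of "Suc k" N] by (simp add: field_simps)
  ultimately show ?case by simp
qed

section \<open>Exponential random vectors\<close>

lemma borel_measurable_nth [measurable (raw)]:
  assumes "f \<in> borel_measurable M"
  shows "(\<lambda>x. (f x :: real ^ 'd) $ j) \<in> borel_measurable M"
  by (rule measurable_compose[OF assms borel_measurable_continuous_onI]) (intro continuous_intros)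

lemma sets_Collect_borel: "Measurable.pred borel P \<Longrightarrow> {x. P x} \<in> sets borel"
  by (simp add: pred_def)

lemma measurable_dominated [measurable (raw)]:
  fixes f g :: "'a \<Rightarrow> real ^ 'd::finite"
  assumes [measurable]: "f \<in> borel_measurable M" "g \<in> borel_measurable M"
  shows "Measurable.pred M (\<lambda>x. dominated (f x) (g x))"
  unfolding dominated_def by measurable

lemma nn_integral_of_bool:
  assumes [measurable]: "Measurable.pred M P"
  shows "(\<integral>\<^sup>+x. of_bool (P x) \<partial>M) = emeasure M {x \<in> space M. P x}"
proof -
  have "(\<integral>\<^sup>+x. of_bool (P x) \<partial>M) = (\<integral>\<^sup>+x. indicator {x \<in> space M. P x} x \<partial>M)"
    by (intro nn_integral_cong) (auto split: split_indicator)
  then show ?thesis by simp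
qed

definition sum_coords :: "real ^ 'd::finite \<Rightarrow> real" where
  "sum_coords z = (\<Sum>j\<in>UNIV. z $ j)"

lemma borel_measurable_sum_coords [measurable]: "sum_coords \<in> borel_measurable borel"
  unfolding sum_coords_def[abs_def] by measurable

lemma sum_coords_add: "sum_coords (x + y) = sum_coords x + sum_coords y"
  by (simp add: sum_coords_def sum.distrib)

text \<open>The law of a single vector, given by a Lebesgue density rather than as a product of
  coordinate laws: the memoryless property then comes from translation invariance of
  \<open>lborel\<close>.\<close>

definition expv :: "(real ^ 'd::finite) measure" where
  "expv = density lborel (\<lambda>z. ennreal (of_bool (dominated 0 z) * exp (- sum_coords z)))"

lemma sets_expv [simp, measurable_cong]: "sets expv = sets borel"
  and space_expv [simp]: "space expv = UNIV"
  by (simp_all add: expv_def)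

lemma nn_integral_expv:
  "f \<in> borel_measurable borel \<Longrightarrow>
    (\<integral>\<^sup>+z. f z \<partial>expv) = (\<integral>\<^sup>+z. ennreal (of_bool (dominated 0 z) * exp (- sum_coords z)) * f z \<partial>lborel)"
  unfolding expv_def by (subst nn_integral_density) auto

lemma nn_integral_lborel_vec_prod:
  fixes f :: "'d::finite \<Rightarrow> real \<Rightarrow> ennreal"
  assumes [measurable]: "\<And>i. f i \<in> borel_measurable borel"
  shows "(\<integral>\<^sup>+z. (\<Prod>i\<in>UNIV. f i (z $ i)) \<partial>lborel) = (\<Prod>i\<in>UNIV. \<integral>\<^sup>+t. f i t \<partial>lborel)"
proof -
  have B: "(Basis :: (real ^ 'd) set) = range (\<lambda>i. axis i 1)"
    by (auto simp: Basis_vec_def)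
  have inj: "inj (\<lambda>i :: 'd. axis i (1::real))"
    by (auto simp: inj_def axis_eq_axis)
  have re: "(\<Prod>b\<in>(Basis :: (real ^ 'd) set). h b) = (\<Prod>i\<in>UNIV. h (axis i 1))" for h :: "real ^ 'd \<Rightarrow> ennreal"
    unfolding B by (simp add: prod.reindex[OF inj])
  have "(\<integral>\<^sup>+z. (\<Prod>b\<in>(Basis :: (real ^ 'd) set). f (axis_index b) (z \<bullet> b)) \<partial>lborel)
      = (\<Prod>b\<in>(Basis :: (real ^ 'd) set). \<integral>\<^sup>+t. f (axis_index b) t \<partial>lborel)"
    by (rule nn_integral_lborel_prod) auto
  then show ?thesis by (simp add: re inner_axis)
qed

lemma borel_vec_box [measurable]:
  assumes "\<And>i. A i \<in> sets borel"
  shows "{z :: real ^ 'd::finite. \<forall>i. z $ i \<in> A i} \<in> sets borel"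
proof -
  note [measurable] = assms
  have "Measurable.pred borel (\<lambda>z :: real ^ 'd. \<forall>i. z $ i \<in> A i)" by measurable
  then show ?thesis by (simp add: pred_def)
qed

lemma emeasure_expv_box:
  fixes A :: "'d::finite \<Rightarrow> real set"
  assumes [measurable]: "\<And>i. A i \<in> sets borel"
  shows "emeasure expv {z. \<forall>i. z $ i \<in> A i}
    = (\<Prod>i\<in>UNIV. emeasure (density lborel (exponential_density 1)) (A i))"
proof -
  have [measurable]: "{z :: real ^ 'd. \<forall>i. z $ i \<in> A i} \<in> sets borel"
    by (rule borel_vec_box) fact
  have "emeasure expv {z. \<forall>i. z $ i \<in> A i}
    = (\<integral>\<^sup>+z. (\<Prod>i\<in>UNIV. ennreal (of_bool (0 < z $ i) * exp (- (z $ i))) * indicator (A i) (z $ i)) \<partial>lborel)"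
    unfolding expv_def
  proof (subst emeasure_density; (intro nn_integral_cong)?)
    fix z :: "real ^ 'd"
    have "(\<Prod>i\<in>UNIV. ennreal (of_bool (0 < z $ i) * exp (- (z $ i))) * indicator (A i) (z $ i))
      = (\<Prod>i\<in>UNIV. ennreal (of_bool (0 < z $ i \<and> z $ i \<in> A i) * exp (- (z $ i))))"
      by (intro prod.cong) (auto split: split_indicator)
    also have "\<dots> = ennreal (\<Prod>i\<in>UNIV. of_bool (0 < z $ i \<and> z $ i \<in> A i) * exp (- (z $ i)))"
      by (subst prod_ennreal) auto
    also have "(\<Prod>i\<in>UNIV. of_bool (0 < z $ i \<and> z $ i \<in> A i) * exp (- (z $ i)))
      = of_bool (\<forall>i. 0 < z $ i \<and> z $ i \<in> A i) * exp (- sum_coords z)"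
      unfolding prod.distrib sum_coords_def sum_negf[symmetric] exp_sum[OF finite]
      by (auto intro!: prod.neutral)
    also have "ennreal \<dots> = ennreal (of_bool (dominated 0 z) * exp (- sum_coords z)) *
        indicator {z. \<forall>i. z $ i \<in> A i} z"
      by (auto simp: dominated_def split: split_indicator)
    finally show "ennreal (of_bool (dominated 0 z) * exp (- sum_coords z)) * indicator {z. \<forall>i. z $ i \<in> A i} z
       = (\<Prod>i\<in>UNIV. ennreal (of_bool (0 < z $ i) * exp (- (z $ i))) * indicator (A i) (z $ i))"
      by simp
  qed auto
  also have "\<dots> = (\<Prod>i\<in>UNIV. \<integral>\<^sup>+t. ennreal (of_bool (0 < t) * exp (- t)) * indicator (A i) t \<partial>lborel)"
    by (rule nn_integral_lborel_vec_prod) measurable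
  also have "\<dots> = (\<Prod>i\<in>UNIV. emeasure (density lborel (exponential_density 1)) (A i))"
  proof (rule prod.cong[OF refl])
    fix i :: 'd
    \<comment> \<open>The strict inequality in \<open>dominated 0 z\<close> excludes the boundary
      point 0, where \<open>exponential_density\<close> is positive; the two densities differ on a
      null set.\<close>
    show "(\<integral>\<^sup>+t. ennreal (of_bool (0 < t) * exp (- t)) * indicator (A i) t \<partial>lborel)
      = emeasure (density lborel (exponential_density 1)) (A i)"
      by (subst emeasure_density; (intro nn_integral_cong_AE)?)
        (use AE_lborel_singleton[of "0::real"] in
          \<open>auto simp: exponential_density_def split: split_indicator elim!: eventually_mono\<close>)
  qed
  finally show ?thesis .
qed

interpretation expv: prob_space "expv :: (real ^ 'd::finite) measure"
proof
  interpret e: prob_space "density lborel (exponential_density 1)"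
    by (rule prob_space_exponential_density) simp
  show "emeasure expv (space (expv :: (real ^ 'd) measure)) = 1"
    using emeasure_expv_box[of "\<lambda>_::'d. UNIV"] e.emeasure_space_1 by simp
qed

text \<open>Lower orthants are stable under intersection and generate the Borel sets; on them
  independence reduces the claim to single coordinates.\<close>

lemma distr_eq_expv:
  fixes Y :: "'a \<Rightarrow> real ^ 'd::finite"
  assumes "prob_space M"
    and indep: "prob_space.indep_vars M (\<lambda>_. borel) (\<lambda>j \<omega>. Y \<omega> $ j) UNIV"
    and dist: "\<And>j. distributed M lborel (\<lambda>\<omega>. Y \<omega> $ j) (exponential_density 1)"
    and [measurable]: "Y \<in> borel_measurable M"
  shows "distr M borel Y = expv"
proof -
  interpret prob_space M by fact
  let ?E = "range (\<lambda>b :: real ^ 'd. {..b})"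
  show ?thesis
  proof (rule measure_eqI_generator_eq[where E = ?E and \<Omega> = UNIV and A = "\<lambda>n. {.. \<chi> i. real n}"])
    show "Int_stable ?E"
    proof (rule Int_stableI)
      fix A B assume "A \<in> ?E" "B \<in> ?E"
      then obtain a b where "A = {..a}" "B = {..b}" by auto
      then have "A \<inter> B = {..inf a b}" by auto
      then show "A \<inter> B \<in> ?E" by blast
    qed
    show "sets (distr M borel Y) = sigma_sets UNIV ?E" "sets (expv :: (real ^ 'd) measure) = sigma_sets UNIV ?E"
      by (simp_all add: borel_eq_atMost)
    show "(\<Union>n. {.. \<chi> i. real n}) = (UNIV :: (real ^ 'd) set)"
    proof (intro equalityI subsetI UNIV_I)
      fix z :: "real ^ 'd"
      have "\<forall>i. z $ i \<le> Max (range (($) z))" by auto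
      moreover obtain n where "Max (range (($) z)) \<le> real n" using real_arch_simple by blast
      ultimately show "z \<in> (\<Union>n. {.. \<chi> i. real n})"
        by (auto simp: less_eq_vec_def intro!: exI[of _ n] elim: order_trans)
    qed
    fix A assume "A \<in> ?E"
    then obtain b where A: "A = {..b}" by auto
    then have A': "A = {z. \<forall>i. z $ i \<in> {..b $ i}}" by (auto simp: less_eq_vec_def)
    have "emeasure (distr M borel Y) A = emeasure M (Y -` A \<inter> space M)"
      unfolding A by (rule emeasure_distr) auto
    also have "Y -` A \<inter> space M = (\<Inter>j\<in>UNIV. (\<lambda>\<omega>. Y \<omega> $ j) -` {..b $ j} \<inter> space M)"
      unfolding A' by auto
    also have "emeasure M \<dots> = ennreal (\<Prod>j\<in>UNIV. prob ((\<lambda>\<omega>. Y \<omega> $ j) -` {..b $ j} \<inter> space M))"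
      unfolding emeasure_eq_measure by (subst indep_varsD[OF indep, of UNIV]) auto
    also have "\<dots> = (\<Prod>j\<in>UNIV. emeasure M ((\<lambda>\<omega>. Y \<omega> $ j) -` {..b $ j} \<inter> space M))"
      by (subst prod_ennreal[symmetric]) (auto simp: emeasure_eq_measure)
    also have "\<dots> = (\<Prod>j\<in>UNIV. emeasure (density lborel (exponential_density 1)) {..b $ j})"
    proof (rule prod.cong[OF refl])
      fix j
      show "emeasure M ((\<lambda>\<omega>. Y \<omega> $ j) -` {..b $ j} \<inter> space M) =
          emeasure (density lborel (exponential_density 1)) {..b $ j}"
        unfolding distributed_distr_eq_density[OF dist[of j], symmetric]
        by (subst emeasure_distr) auto
    qed
    also have "\<dots> = emeasure expv A"
      unfolding A' by (rule emeasure_expv_box[symmetric]) auto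
    finally show "emeasure (distr M borel Y) A = emeasure expv A" .
  next
    show "emeasure (distr M borel Y) {..\<chi> i. real n} \<noteq> \<infinity>" for n
      by (subst emeasure_distr) (auto simp: emeasure_eq_measure)
  qed auto
qed

text \<open>Substitute \<open>z = b + w\<close>: the density is multiplicative under the shift, and
  nonnegative \<open>b\<close> keeps \<open>b + w\<close> in the support.\<close>

lemma nn_integral_expv_memoryless:
  fixes b :: "real ^ 'd::finite"
  assumes b: "\<And>i. 0 \<le> b $ i" and [measurable]: "f \<in> borel_measurable borel"
  shows "(\<integral>\<^sup>+z. of_bool (dominated b z) * f (z - b) \<partial>expv)
    = ennreal (exp (- sum_coords b)) * (\<integral>\<^sup>+z. f z \<partial>expv)"
proof -
  have pos: "dominated 0 (b + z)" if "dominated 0 z" for z :: "real ^ 'd"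
    using that b by (auto simp: dominated_def intro: add_nonneg_pos)
  have "(\<integral>\<^sup>+z. of_bool (dominated b z) * f (z - b) \<partial>expv)
    = (\<integral>\<^sup>+z. ennreal (of_bool (dominated 0 z) * exp (- sum_coords z)) *
        (of_bool (dominated b z) * f (z - b)) \<partial>distr lborel borel ((+) b))"
    unfolding lborel_distr_plus by (rule nn_integral_expv) measurable
  also have "\<dots> = (\<integral>\<^sup>+z. ennreal (exp (- sum_coords b)) *
      (ennreal (of_bool (dominated 0 z) * exp (- sum_coords z)) * f z) \<partial>lborel)"
  proof (subst nn_integral_distr; (intro nn_integral_cong)?)
    fix z :: "real ^ 'd"
    have "dominated b (b + z) \<longleftrightarrow> dominated 0 z" by (simp add: dominated_def)
    then show "ennreal (of_bool (dominated 0 (b + z)) * exp (- sum_coords (b + z))) *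
           (of_bool (dominated b (b + z)) * f (b + z - b))
       = ennreal (exp (- sum_coords b)) * (ennreal (of_bool (dominated 0 z) * exp (- sum_coords z)) * f z)"
      using pos[of z]
      by (cases "dominated 0 z") (simp_all add: sum_coords_add exp_diff exp_minus mult.assoc[symmetric]
          divide_inverse ennreal_mult'[symmetric])
  qed measurable
  also have "\<dots> = ennreal (exp (- sum_coords b)) * (\<integral>\<^sup>+z. f z \<partial>expv)"
    by (simp add: nn_integral_cmult nn_integral_expv)
  finally show ?thesis .
qed

lemma emeasure_expv_upper:
  fixes b :: "real ^ 'd::finite"
  assumes b: "\<And>i. 0 \<le> b $ i"
  shows "emeasure expv {z. dominated b z} = ennreal (exp (- sum_coords b))"
proof -
  have "emeasure expv {z. dominated b z} = (\<integral>\<^sup>+z. of_bool (dominated b z) * 1 \<partial>expv)"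
    using nn_integral_of_bool[where M = expv and P = "dominated b"] by simp
  also have "\<dots> = ennreal (exp (- sum_coords b))"
    by (subst nn_integral_expv_memoryless[where f = "\<lambda>_. 1"])
      (use b in \<open>auto simp: expv.emeasure_space_1[simplified]\<close>)
  finally show ?thesis .
qed

lemma AE_expv_pos: "AE z in (expv :: (real ^ 'd::finite) measure). dominated 0 z"
proof -
  have "expv.prob {z :: real ^ 'd. dominated 0 z} = 1"
    using emeasure_expv_upper[of "0 :: real ^ 'd"]
    by (simp add: measure_def sum_coords_def)
  moreover have "{z :: real ^ 'd. dominated 0 z} \<in> sets expv"
    unfolding sets_expv by (rule sets_Collect_borel) measurable
  ultimately have "AE z in (expv :: (real ^ 'd) measure). z \<in> {z. dominated 0 z}"
    using expv.AE_in_set_eq_1 by blast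
  then show ?thesis by simp
qed

lemma nn_integral_expv_sum_coords:
  assumes [measurable]: "f \<in> borel_measurable borel"
  shows "(\<integral>\<^sup>+z. f (sum_coords z) \<partial>(expv :: (real ^ 'd::finite) measure))
    = (\<integral>\<^sup>+s. ennreal (erlang_density (CARD('d) - 1) 1 s) * f s \<partial>lborel)"
proof -
  let ?e = "expv :: (real ^ 'd) measure"
  let ?D = "density lborel (exponential_density 1)"
  interpret e: prob_space ?D by (rule prob_space_exponential_density) simp
  have comp: "distr ?e borel (\<lambda>z. z $ j) = ?D" for j
  proof (rule measure_eqI)
    fix A assume "A \<in> sets (distr ?e borel (\<lambda>z. z $ j))"
    then have [measurable]: "A \<in> sets borel" by simp
    have "emeasure (distr ?e borel (\<lambda>z. z $ j)) A = emeasure ?e {z. \<forall>i. z $ i \<in> (if i = j then A else UNIV)}"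
      by (subst emeasure_distr) (auto intro!: arg_cong2[where f = emeasure])
    also have "\<dots> = (\<Prod>i\<in>UNIV. emeasure ?D (if i = j then A else UNIV))"
      by (rule emeasure_expv_box) auto
    also have "\<dots> = (\<Prod>i\<in>UNIV. if i = j then emeasure ?D A else 1)"
      by (intro prod.cong) (use e.emeasure_space_1 in auto)
    finally show "emeasure (distr ?e borel (\<lambda>z. z $ j)) A = emeasure ?D A"
      by simp
  qed simp
  have "distributed ?e lborel (\<lambda>z. \<Sum>j\<in>UNIV. z $ j) (erlang_density (card (UNIV :: 'd set) - 1) 1)"
  proof (rule expv.exponential_distributed_sum)
    show "distributed ?e lborel (\<lambda>z. z $ j) (exponential_density 1)" for j
      using comp[of j] distr_cong[of ?e ?e lborel borel "\<lambda>z. z $ j"] by (auto simp: distributed_def)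
    interpret product_prob_space "\<lambda>_ :: 'd. ?D" UNIV ..
    have "distr ?e (PiM UNIV (\<lambda>_::'d. borel)) (\<lambda>z. \<lambda>i\<in>UNIV. z $ i) = PiM UNIV (\<lambda>_::'d. ?D)"
    proof (rule PiM_eqI)
      show "sets (distr ?e (PiM UNIV (\<lambda>_::'d. borel)) (\<lambda>z. \<lambda>i\<in>UNIV. z $ i)) = sets (PiM UNIV (\<lambda>_::'d. ?D))"
        by (simp cong: sets_PiM_cong)
      fix A :: "'d \<Rightarrow> real set" assume "\<And>i. i \<in> UNIV \<Longrightarrow> A i \<in> sets ?D"
      then have [measurable]: "\<And>i. A i \<in> sets borel" by simp
      show "emeasure (distr ?e (PiM UNIV (\<lambda>_::'d. borel)) (\<lambda>z. \<lambda>i\<in>UNIV. z $ i)) (Pi\<^sub>E UNIV A)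
          = (\<Prod>i\<in>UNIV. emeasure ?D (A i))"
        by (subst emeasure_distr)
          (auto simp: emeasure_expv_box[symmetric] intro!: arg_cong2[where f = emeasure] sets_PiM_I_finite)
    qed simp
    then show "expv.indep_vars (\<lambda>_. borel) (\<lambda>j z. z $ j) (UNIV :: 'd set)"
      by (subst expv.indep_vars_iff_distr_eq_PiM') (auto simp: comp)
  qed auto
  from distributed_nn_integral[OF this, of f] show ?thesis
    by (simp add: sum_coords_def)
qed

text \<open>This identifies \<open>mixed_binom\<close> with \<open>c\<^sub>m\<close>: a new point at
  \<open>z\<close> is dominated by each other point independently with probability
  \<open>exp (- sum_coords z)\<close>, which depends on \<open>z\<close> only through an Erlang
  distributed sum.\<close>

lemma nn_integral_expv_binom_prob:
  "(\<integral>\<^sup>+z. ennreal (binom_prob N m (exp (- sum_coords z))) \<partial>(expv :: (real ^ 'd::finite) measure))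
    = ennreal (mixed_binom (CARD('d) - 1) N m)"
proof -
  have "(\<integral>\<^sup>+z. ennreal (binom_prob N m (exp (- sum_coords z))) \<partial>(expv :: (real ^ 'd) measure))
    = (\<integral>\<^sup>+s. ennreal (erlang_density (CARD('d) - 1) 1 s * binom_prob N m (exp (- s))) \<partial>lborel)"
    by (subst nn_integral_expv_sum_coords) (auto simp: ennreal_mult')
  also have "\<dots> = ennreal (mixed_binom (CARD('d) - 1) N m)"
    unfolding mixed_binom_def
    by (intro nn_integral_eq_integral integrable_mixed_binom AE_I2)
      (auto simp: erlang_density_def binom_prob_nonneg)
  finally show ?thesis .
qed

section \<open>Thinning\<close>

type_synonym 'd vecs = "nat \<Rightarrow> (real, 'd) vec"

interpretation expv_PiM: product_prob_space "\<lambda>_ :: nat. expv :: (real ^ 'd::finite) measure" I for I ..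

abbreviation expv_seq :: "nat set \<Rightarrow> 'd::finite vecs measure" where
  "expv_seq I \<equiv> PiM I (\<lambda>_. expv)"

lemma measurable_expv_component:
  "i \<in> I \<Longrightarrow> (\<lambda>x. x i) \<in> borel_measurable (expv_seq I :: 'd::finite vecs measure)"
  using measurable_component_singleton[of i I "\<lambda>_. expv :: (real ^ 'd) measure"]
  by (simp cong: measurable_cong_sets)

text \<open>The product space on which \<open>F\<close> is evaluated depends on \<open>x\<close>.
  Summing over the finitely many possible index sets fixes it within each summand.\<close>

lemma measurable_upper_part:
  fixes F :: "nat set \<Rightarrow> 'd::finite vecs \<Rightarrow> ennreal"
  assumes I: "finite I" and F: "\<And>J. J \<subseteq> I \<Longrightarrow> F J \<in> borel_measurable (expv_seq J)"
  shows "(\<lambda>x. F {i \<in> I. dominated b (x i)} (\<lambda>i\<in>{i \<in> I. dominated b (x i)}. x i - b))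
    \<in> borel_measurable (expv_seq I)"
proof -
  let ?J = "\<lambda>x. {i \<in> I. dominated b (x i)}"
  have eq: "F (?J x) (\<lambda>i\<in>?J x. x i - b) = (\<Sum>J\<in>Pow I. of_bool (?J x = J) * F J (\<lambda>i\<in>J. x i - b))" for x
  proof -
    have "(\<Sum>J\<in>Pow I. of_bool (?J x = J) * F J (\<lambda>i\<in>J. x i - b))
      = (\<Sum>J\<in>Pow I. if ?J x = J then F J (\<lambda>i\<in>J. x i - b) else 0)"
      by (intro sum.cong) auto
    then show ?thesis using I by (simp add: sum.delta)
  qed
  have "(\<lambda>x. of_bool (?J x = J) * F J (\<lambda>i\<in>J. x i - b)) \<in> borel_measurable (expv_seq I)"
    if J: "J \<in> Pow I" for J
  proof (intro borel_measurable_times_ennreal)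
    have [measurable]: "i \<in> I \<Longrightarrow> (\<lambda>x. x i) \<in> borel_measurable (expv_seq I :: 'd vecs measure)" for i
      by (rule measurable_expv_component)
    have "?J x = J \<longleftrightarrow> (\<forall>i\<in>I. dominated b (x i) \<longleftrightarrow> i \<in> J)" for x
      using J by auto
    moreover have "Measurable.pred (expv_seq I) (\<lambda>x. \<forall>i\<in>I. dominated b (x i) \<longleftrightarrow> i \<in> J)"
      using I by measurable
    ultimately have [measurable]: "Measurable.pred (expv_seq I) (\<lambda>x. ?J x = J)" by simp
    show "(\<lambda>x. of_bool (?J x = J)) \<in> borel_measurable (expv_seq I)" by measurable
    have "(\<lambda>x. \<lambda>i\<in>J. x i - b) \<in> measurable (expv_seq I) (expv_seq J)"
    proof (rule measurable_restrict)
      fix i assume "i \<in> J"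
      with J have [measurable]: "(\<lambda>x. x i) \<in> borel_measurable (expv_seq I :: 'd vecs measure)"
        by (intro measurable_expv_component) auto
      show "(\<lambda>x. x i - b) \<in> measurable (expv_seq I) expv" by measurable
    qed
    then show "(\<lambda>x. F J (\<lambda>i\<in>J. x i - b)) \<in> borel_measurable (expv_seq I)"
      by (rule measurable_compose) (use F J in auto)
  qed
  then show ?thesis unfolding eq by (rule borel_measurable_sum)
qed

text \<open>Independent thinning: each point dominates \<open>b\<close> independently of the others,
  and by the memoryless property those that do, recentred at \<open>b\<close>, are again independent
  exponential vectors. The index set is an argument of \<open>F\<close> because retained
  configurations of different index sets live in different product spaces.\<close>

lemma nn_integral_thinning:
  fixes F :: "nat set \<Rightarrow> 'd::finite vecs \<Rightarrow> ennreal"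
  assumes b: "\<And>i. 0 \<le> b $ i" and "finite I"
    and "\<And>J. J \<subseteq> I \<Longrightarrow> F J \<in> borel_measurable (expv_seq J)"
  shows "(\<integral>\<^sup>+x. F {i \<in> I. dominated b (x i)} (\<lambda>i\<in>{i \<in> I. dominated b (x i)}. x i - b) \<partial>expv_seq I)
    = (\<Sum>J\<in>Pow I. ennreal (exp (- sum_coords b) ^ card J * (1 - exp (- sum_coords b)) ^ (card I - card J))
         * (\<integral>\<^sup>+z. F J z \<partial>expv_seq J))"
  using assms(2,3)
proof (induction I arbitrary: F rule: finite_induct)
  case empty
  then show ?case by (simp add: PiM_empty nn_integral_count_space_finite restrict_def)
next
  case (insert j I)
  define q where "q = exp (- sum_coords b)"
  have "0 \<le> sum_coords b" using b by (auto simp: sum_coords_def intro: sum_nonneg)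
  then have q: "0 \<le> q" "q \<le> 1" by (auto simp: q_def)
  let ?c = "\<lambda>I J. ennreal (q ^ card J * (1 - q) ^ (card I - card J))"
  let ?J = "\<lambda>I x. {i \<in> I. dominated b (x i)}"
  let ?G = "\<lambda>F I x. F (?J I x) (\<lambda>i\<in>?J I x. x i - b)"
  \<comment> \<open>When \<open>j\<close> is retained, its recentred vector again has law
    \<open>expv\<close>; averaging over it yields a second functional to which the induction
    hypothesis applies.\<close>
  define F2 where "F2 = (\<lambda>J z. \<integral>\<^sup>+y. F (insert j J) (z(j := y)) \<partial>expv)"
  have Fm: "F J \<in> borel_measurable (expv_seq J)" if "J \<subseteq> insert j I" for J
    using insert.prems that by blast
  have ins: "F (insert j J) \<in> borel_measurable (expv_seq (insert j J))" if "J \<subseteq> I" for J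
    using that by (intro Fm) auto
  have F2m: "F2 J \<in> borel_measurable (expv_seq J)" if "J \<subseteq> I" for J
  proof -
    note [measurable] = ins[OF that]
    have "(\<lambda>(z, y). F (insert j J) (z(j := y))) \<in> borel_measurable (expv_seq J \<Otimes>\<^sub>M expv)"
      unfolding case_prod_beta by measurable
    then show ?thesis
      unfolding F2_def by (intro expv.borel_measurable_nn_integral) (simp add: case_prod_beta)
  qed
  have up: "emeasure expv {y. dominated b y} = ennreal q"
    unfolding q_def by (rule emeasure_expv_upper[OF b])
  have low: "(\<integral>\<^sup>+y. of_bool (\<not> dominated b y) \<partial>expv) = ennreal (1 - q)"
  proof -
    have m: "{y. dominated b y} \<in> sets expv"
      unfolding sets_expv by (rule sets_Collect_borel) measurable
    have "expv.prob (space expv - {y. dominated b y}) = 1 - q"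
      using expv.prob_compl[OF m] up q by (simp add: measure_def)
    moreover have "(\<integral>\<^sup>+y. of_bool (\<not> dominated b y) \<partial>expv) = emeasure expv (space expv - {y. dominated b y})"
      by (subst nn_integral_of_bool) (auto intro!: arg_cong2[where f = emeasure])
    ultimately show ?thesis by (simp add: expv.emeasure_eq_measure)
  qed
  have inner: "(\<integral>\<^sup>+y. ?G F (insert j I) (x(j := y)) \<partial>expv)
      = ennreal (1 - q) * ?G F I x + ennreal q * ?G F2 I x"
    if x: "x \<in> space (expv_seq I)" for x
  proof -
    let ?z = "\<lambda>i\<in>?J I x. x i - b"
    have z: "?z \<in> space (expv_seq (?J I x))" by (simp add: space_PiM)
    have "?J I x \<subseteq> I" by auto
    note [measurable] = ins[OF this]
    have "(\<lambda>y. ?z(j := y)) \<in> measurable expv (expv_seq (insert j (?J I x)))"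
      by (rule measurable_fun_upd[where J = "?J I x"]) (use z in auto)
    then have meas: "(\<lambda>y. F (insert j (?J I x)) (?z(j := y))) \<in> borel_measurable expv"
      by (rule measurable_compose) measurable
    then have meas': "(\<lambda>y. F (insert j (?J I x)) (?z(j := y))) \<in> borel_measurable borel"
      by (simp cong: measurable_cong_sets)
    note [measurable] = meas meas'
    have "?G F (insert j I) (x(j := y)) = of_bool (\<not> dominated b y) * ?G F I x
        + of_bool (dominated b y) * F (insert j (?J I x)) (?z(j := y - b))" for y
    proof (cases "dominated b y")
      case True
      then have "?J (insert j I) (x(j := y)) = insert j (?J I x)" using insert.hyps by auto
      moreover have "(\<lambda>i\<in>insert j (?J I x). (x(j := y)) i - b) = ?z(j := y - b)"
        using insert.hyps by (auto simp: fun_eq_iff restrict_def)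
      ultimately show ?thesis using True by simp
    next
      case False
      then have "?J (insert j I) (x(j := y)) = ?J I x" using insert.hyps by auto
      moreover have "(\<lambda>i\<in>?J I x. (x(j := y)) i - b) = ?z"
        using insert.hyps by (auto simp: fun_eq_iff restrict_def)
      ultimately show ?thesis using False by simp
    qed
    then have "(\<integral>\<^sup>+y. ?G F (insert j I) (x(j := y)) \<partial>expv)
      = (\<integral>\<^sup>+y. of_bool (\<not> dominated b y) * ?G F I x
        + of_bool (dominated b y) * F (insert j (?J I x)) (?z(j := y - b)) \<partial>expv)"
      by simp
    also have "\<dots> = (\<integral>\<^sup>+y. of_bool (\<not> dominated b y) * ?G F I x \<partial>expv)
        + (\<integral>\<^sup>+y. of_bool (dominated b y) * F (insert j (?J I x)) (?z(j := y - b)) \<partial>expv)"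
      by (intro nn_integral_add) measurable
    also have "(\<integral>\<^sup>+y. of_bool (\<not> dominated b y) * ?G F I x \<partial>expv) = ennreal (1 - q) * ?G F I x"
      by (subst nn_integral_multc) (auto simp: low)
    also have "(\<integral>\<^sup>+y. of_bool (dominated b y) * F (insert j (?J I x)) (?z(j := y - b)) \<partial>expv)
      = ennreal q * ?G F2 I x"
      unfolding q_def F2_def by (rule nn_integral_expv_memoryless[OF b meas'])
    finally show ?thesis .
  qed
  have "(\<integral>\<^sup>+x. ?G F (insert j I) x \<partial>expv_seq (insert j I))
    = (\<integral>\<^sup>+x. \<integral>\<^sup>+y. ?G F (insert j I) (x(j := y)) \<partial>expv \<partial>expv_seq I)"
  proof (rule expv_PiM.product_nn_integral_insert)
    show "?G F (insert j I) \<in> borel_measurable (expv_seq (insert j I))"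
      using insert.hyps by (intro measurable_upper_part[where F = F] Fm) simp
  qed (use insert.hyps in auto)
  also have "\<dots> = (\<integral>\<^sup>+x. ennreal (1 - q) * ?G F I x + ennreal q * ?G F2 I x \<partial>expv_seq I)"
    by (intro nn_integral_cong inner)
  also have "\<dots> = ennreal (1 - q) * (\<integral>\<^sup>+x. ?G F I x \<partial>expv_seq I)
      + ennreal q * (\<integral>\<^sup>+x. ?G F2 I x \<partial>expv_seq I)"
  proof -
    have m: "?G F I \<in> borel_measurable (expv_seq I)"
      by (rule measurable_upper_part[where F = F, OF insert.hyps(1)]) (blast intro: Fm)
    have m2: "?G F2 I \<in> borel_measurable (expv_seq I)"
      by (rule measurable_upper_part[where F = F2, OF insert.hyps(1) F2m])
    show ?thesis
      by (simp only: nn_integral_add[OF borel_measurable_times_ennreal[OF measurable_const m]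
            borel_measurable_times_ennreal[OF measurable_const m2]] nn_integral_cmult[OF m] nn_integral_cmult[OF m2] UNIV_I space_borel)
  qed
  also have "(\<integral>\<^sup>+x. ?G F I x \<partial>expv_seq I) = (\<Sum>J\<in>Pow I. ?c I J
         * (\<integral>\<^sup>+z. F J z \<partial>expv_seq J))"
    unfolding q_def by (rule insert.IH) (auto intro: Fm)
  also have "(\<integral>\<^sup>+x. ?G F2 I x \<partial>expv_seq I) = (\<Sum>J\<in>Pow I. ?c I J
         * (\<integral>\<^sup>+z. F2 J z \<partial>expv_seq J))"
    unfolding q_def by (rule insert.IH) (rule F2m)
  also have "ennreal (1 - q) * (\<Sum>J\<in>Pow I. ?c I J
         * (\<integral>\<^sup>+z. F J z \<partial>expv_seq J))
     = (\<Sum>J\<in>Pow I. ?c (insert j I) J * (\<integral>\<^sup>+z. F J z \<partial>expv_seq J))"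
    unfolding sum_distrib_left
  proof (rule sum.cong[OF refl])
    fix J assume "J \<in> Pow I"
    then have "card J \<le> card I" using insert.hyps by (auto intro: card_mono)
    then have "card (insert j I) - card J = Suc (card I - card J)" using insert.hyps by simp
    then show "ennreal (1 - q) * (?c I J * (\<integral>\<^sup>+z. F J z \<partial>expv_seq J))
      = ?c (insert j I) J * (\<integral>\<^sup>+z. F J z \<partial>expv_seq J)"
      using q by (simp add: mult.assoc[symmetric] ennreal_mult'[symmetric]) (simp add: mult.commute mult.left_commute)
  qed
  also have "ennreal q * (\<Sum>J\<in>Pow I. ?c I J
         * (\<integral>\<^sup>+z. F2 J z \<partial>expv_seq J))
     = (\<Sum>J\<in>insert j ` Pow I. ?c (insert j I) J * (\<integral>\<^sup>+z. F J z \<partial>expv_seq J))"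
  proof -
    have inj: "inj_on (insert j) (Pow I)"
      using insert.hyps by (auto simp: inj_on_def)
    show ?thesis
      unfolding sum_distrib_left sum.reindex[OF inj] comp_def
    proof (rule sum.cong[OF refl])
      fix J assume J: "J \<in> Pow I"
      then have fin: "finite J" "j \<notin> J" using insert.hyps by (auto intro: finite_subset)
      have "(\<integral>\<^sup>+z. F (insert j J) z \<partial>expv_seq (insert j J)) = (\<integral>\<^sup>+z. F2 J z \<partial>expv_seq J)"
        unfolding F2_def using J by (intro expv_PiM.product_nn_integral_insert fin ins) auto
      then show "ennreal q * (?c I J * (\<integral>\<^sup>+z. F2 J z \<partial>expv_seq J))
        = ennreal (q ^ card (insert j J) * (1 - q) ^ (card (insert j I) - card (insert j J)))
           * (\<integral>\<^sup>+z. F (insert j J) z \<partial>expv_seq (insert j J))"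
        using q fin insert.hyps by (simp add: mult.assoc[symmetric] ennreal_mult'[symmetric])
    qed
  qed
  \<comment> \<open>Subsets without \<open>j\<close> come from \<open>F\<close>, those containing
    \<open>j\<close> from \<open>F2\<close>.\<close>
  also have "(\<Sum>J\<in>Pow I. ?c (insert j I) J * (\<integral>\<^sup>+z. F J z \<partial>expv_seq J))
     + (\<Sum>J\<in>insert j ` Pow I. ?c (insert j I) J * (\<integral>\<^sup>+z. F J z \<partial>expv_seq J))
     = (\<Sum>J\<in>Pow (insert j I). ?c (insert j I) J * (\<integral>\<^sup>+z. F J z \<partial>expv_seq J))"
    unfolding Pow_insert using insert.hyps by (subst sum.union_disjoint) auto
  finally show ?case unfolding q_def .
qed

text \<open>With the origin moved to the corner \<open>x n - vec T\<close>, the new point sits at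
  \<open>vec T\<close>, so this is the record event; \<open>num_low\<close> then counts the killed
  records above the corner.\<close>

definition below :: "real \<Rightarrow> nat set \<Rightarrow> 'd::finite vecs \<Rightarrow> bool" where
  "below T J z \<longleftrightarrow> (\<forall>i\<in>J. \<not> dominated (vec T) (z i))"

definition num_low :: "real \<Rightarrow> nat set \<Rightarrow> 'd::finite vecs \<Rightarrow> nat" where
  "num_low T J z = card {i \<in> J. dominated (z i) (vec T) \<and> (\<forall>j\<in>J. \<not> dominated (z i) (z j))}"

lemma measurable_card_Collect:
  assumes "finite J" "\<And>i. i \<in> J \<Longrightarrow> Measurable.pred M (P i)"
  shows "(\<lambda>x. card {i \<in> J. P i x}) \<in> measurable M (count_space UNIV)"
proof -
  have "card {i \<in> J. P i x} = (\<Sum>i\<in>J. if P i x then 1 else 0)" for x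
    using assms(1) by (subst sum.inter_filter[symmetric]) auto
  moreover have "(\<lambda>x. \<Sum>i\<in>J. if P i x then 1 else 0 :: nat) \<in> measurable M (count_space UNIV)"
    by (intro measurable_sum_nat measurable_If measurable_const) (use assms(2) in auto)
  ultimately show ?thesis by simp
qed

lemma measurable_below:
  assumes "finite J"
  shows "Measurable.pred (expv_seq J :: 'd::finite vecs measure) (below T J)"
proof -
  have [measurable]: "i \<in> J \<Longrightarrow> (\<lambda>x. x i) \<in> borel_measurable (expv_seq J :: 'd vecs measure)" for i
    by (rule measurable_expv_component)
  show ?thesis unfolding below_def[abs_def] using assms by measurable
qed

lemma measurable_num_low:
  assumes "finite J"
  shows "num_low T J \<in> measurable (expv_seq J :: 'd::finite vecs measure) (count_space UNIV)"
  unfolding num_low_def[abs_def]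
proof (rule measurable_card_Collect[OF assms])
  fix i assume [simp]: "i \<in> J"
  have [measurable]: "i \<in> J \<Longrightarrow> (\<lambda>x. x i) \<in> borel_measurable (expv_seq J :: 'd vecs measure)" for i
    by (rule measurable_expv_component)
  show "Measurable.pred (expv_seq J :: 'd vecs measure)
      (\<lambda>x. dominated (x i) (vec T) \<and> (\<forall>j\<in>J. \<not> dominated (x i) (x j)))"
    using assms by measurable
qed

lemma measurable_below_num_low:
  assumes "finite J"
  shows "(\<lambda>z. of_bool (below T J z) * (h (num_low T J z) :: ennreal)) \<in> borel_measurable (expv_seq J)"
proof -
  note [measurable] = measurable_below[OF assms] measurable_num_low[OF assms]
  show ?thesis by measurable
qed

text \<open>If \<open>h\<close> is the indicator of \<open>k\<close> then this is \<open>a\<^sub>m\<close>.\<close>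

definition low_integral :: "'d::finite itself \<Rightarrow> real \<Rightarrow> (nat \<Rightarrow> ennreal) \<Rightarrow> nat \<Rightarrow> ennreal" where
  "low_integral _ T h m =
     (\<integral>\<^sup>+z. of_bool (below T {..<m} z) * h (num_low T {..<m} z) \<partial>(expv_seq {..<m} :: 'd vecs measure))"

abbreviation low_prob :: "'d::finite itself \<Rightarrow> real \<Rightarrow> nat \<Rightarrow> nat \<Rightarrow> ennreal" where
  "low_prob d T k \<equiv> low_integral d T (\<lambda>j. of_bool (j = k))"

text \<open>The vectors are identically distributed and independent, and both functionals are
  invariant under relabelling, so only the number of indices matters.\<close>

lemma low_integral_reindex:
  assumes "finite J"
  shows "(\<integral>\<^sup>+z. of_bool (below T J z) * h (num_low T J z) \<partial>(expv_seq J :: 'd::finite vecs measure))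
    = low_integral TYPE('d) T h (card J)"
proof -
  define m where "m = card J"
  obtain f where f: "bij_betw f {..<m} J"
    using ex_bij_betw_nat_finite[OF assms] by (auto simp: atLeast0LessThan m_def)
  then have inj: "inj_on f {..<m}" and im: "f ` {..<m} = J"
    by (auto simp: bij_betw_def)
  let ?r = "\<lambda>\<omega>. \<lambda>n\<in>{..<m}. \<omega> (f n)"
  have b: "below T {..<m} (?r z) = below T J z" for z :: "'d vecs"
    unfolding below_def im[symmetric] by simp
  have n: "num_low T {..<m} (?r z) = num_low T J z" for z :: "'d vecs"
  proof -
    let ?A = "{i \<in> {..<m}. dominated (?r z i) (vec T) \<and> (\<forall>j\<in>{..<m}. \<not> dominated (?r z i) (?r z j))}"
    have "f ` ?A = {i \<in> f ` {..<m}. dominated (z i) (vec T) \<and> (\<forall>j\<in>f ` {..<m}. \<not> dominated (z i) (z j))}"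
      by auto
    moreover have "inj_on f ?A" by (rule inj_on_subset[OF inj]) auto
    ultimately show ?thesis unfolding num_low_def im using card_image[of f ?A] by simp
  qed
  have d: "distr (expv_seq J) (expv_seq {..<m}) ?r = (expv_seq {..<m} :: 'd vecs measure)"
    by (rule distr_PiM_reindex) (use inj im expv.prob_space_axioms in auto)
  have "low_integral TYPE('d) T h (m) = (\<integral>\<^sup>+z. of_bool (below T {..<m} z) * h (num_low T {..<m} z)
     \<partial>(distr (expv_seq J) (expv_seq {..<m}) ?r :: 'd vecs measure))"
    unfolding low_integral_def d ..
  also have "\<dots> = (\<integral>\<^sup>+z. of_bool (below T J z) * h (num_low T J z) \<partial>(expv_seq J :: 'd vecs measure))"
  proof (subst nn_integral_distr)
    show "?r \<in> measurable (expv_seq J) (expv_seq {..<m} :: 'd vecs measure)"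
      using f by (intro measurable_restrict measurable_component_singleton) (auto simp: bij_betw_def)
  qed (simp_all add: b n measurable_below_num_low)
  finally show ?thesis unfolding m_def ..
qed

lemma sum_Pow_card:
  fixes g :: "nat \<Rightarrow> 'a::comm_semiring_1"
  assumes "finite I"
  shows "(\<Sum>J\<in>Pow I. g (card J)) = (\<Sum>m\<le>card I. of_nat (card I choose m) * g m)"
proof -
  have "(\<Sum>J\<in>Pow I. g (card J)) = (\<Sum>m\<le>card I. \<Sum>J\<in>{J \<in> Pow I. card J = m}. g (card J))"
    by (rule sum.group[symmetric]) (use assms in \<open>auto intro: card_mono\<close>)
  also have "\<dots> = (\<Sum>m\<le>card I. of_nat (card I choose m) * g m)"
    by (intro sum.cong) (auto simp: n_subsets[OF assms, symmetric])
  finally show ?thesis .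
qed

text \<open>Grouping the subsets by size after thinning: the number of retained points is binomial,
  and only its success probability depends on the corner \<open>b\<close>.\<close>

lemma nn_integral_upper_low:
  fixes b :: "real ^ 'd::finite"
  assumes b: "\<And>i. 0 \<le> b $ i" and I: "finite I"
  shows "(\<integral>\<^sup>+x. of_bool (below T {i \<in> I. dominated b (x i)} (\<lambda>i\<in>{i \<in> I. dominated b (x i)}. x i - b)) *
      h (num_low T {i \<in> I. dominated b (x i)} (\<lambda>i\<in>{i \<in> I. dominated b (x i)}. x i - b)) \<partial>expv_seq I)
    = (\<Sum>m\<le>card I. ennreal (binom_prob (card I) m (exp (- sum_coords b))) * low_integral TYPE('d) T h m)"
proof -
  define q where "q = exp (- sum_coords b)"
  have "0 \<le> sum_coords b" using b by (auto simp: sum_coords_def intro: sum_nonneg)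
  then have q: "0 \<le> q" "q \<le> 1" by (auto simp: q_def)
  have "(\<integral>\<^sup>+x. of_bool (below T {i \<in> I. dominated b (x i)} (\<lambda>i\<in>{i \<in> I. dominated b (x i)}. x i - b)) *
      h (num_low T {i \<in> I. dominated b (x i)} (\<lambda>i\<in>{i \<in> I. dominated b (x i)}. x i - b)) \<partial>expv_seq I)
    = (\<Sum>J\<in>Pow I. ennreal (q ^ card J * (1 - q) ^ (card I - card J))
         * (\<integral>\<^sup>+z. of_bool (below T J z) * h (num_low T J z) \<partial>(expv_seq J :: 'd vecs measure)))"
    unfolding q_def
    by (rule nn_integral_thinning[where F = "\<lambda>J z. of_bool (below T J z) * h (num_low T J z)"])
      (use I b in \<open>auto intro!: measurable_below_num_low intro: finite_subset\<close>)
  also have "\<dots> = (\<Sum>J\<in>Pow I. ennreal (q ^ card J * (1 - q) ^ (card I - card J))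
         * low_integral TYPE('d) T h (card J))"
    by (intro sum.cong refl arg_cong2[where f = "(*)"] low_integral_reindex)
      (use I in \<open>auto intro: finite_subset\<close>)
  also have "\<dots> = (\<Sum>m\<le>card I. ennreal (binom_prob (card I) m q) * low_integral TYPE('d) T h m)"
    by (subst sum_Pow_card[OF I]) (use q in \<open>auto intro!: sum.cong simp: binom_prob_def ennreal_mult'
        mult.assoc ennreal_of_nat_eq_real_of_nat\<close>)
  finally show ?thesis unfolding q_def .
qed

section \<open>Killed records\<close>

lemma nn_integral_none_above:
  fixes y :: "real ^ 'd::finite"
  assumes y: "\<And>i. 0 \<le> y $ i" and I: "finite I"
  shows "(\<integral>\<^sup>+x. of_bool (\<forall>i\<in>I. \<not> dominated y (x i)) \<partial>expv_seq I)
    = ennreal ((1 - exp (- sum_coords y)) ^ card I)"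
proof -
  have "0 \<le> sum_coords y" using y by (auto simp: sum_coords_def intro: sum_nonneg)
  then have q: "exp (- sum_coords y) \<le> 1" by auto
  have m: "{z. dominated y z} \<in> sets expv"
    unfolding sets_expv by (rule sets_Collect_borel) measurable
  have "expv.prob (space expv - {z. dominated y z}) = 1 - exp (- sum_coords y)"
    using expv.prob_compl[OF m] emeasure_expv_upper[OF y] by (simp add: measure_def)
  moreover have "(\<integral>\<^sup>+z. of_bool (\<not> dominated y z) \<partial>expv) = emeasure expv (space expv - {z. dominated y z})"
    by (subst nn_integral_of_bool) (auto intro!: arg_cong2[where f = emeasure])
  ultimately have one: "(\<integral>\<^sup>+z. of_bool (\<not> dominated y z) \<partial>expv) = ennreal (1 - exp (- sum_coords y))"
    by (simp add: expv.emeasure_eq_measure)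
  have "(\<integral>\<^sup>+x. of_bool (\<forall>i\<in>I. \<not> dominated y (x i)) \<partial>expv_seq I)
    = (\<integral>\<^sup>+x. (\<Prod>i\<in>I. of_bool (\<not> dominated y (x i))) \<partial>expv_seq I)"
    using I by (intro nn_integral_cong) (auto intro!: prod.neutral simp: prod_zero_iff)
  also have "\<dots> = (\<Prod>i\<in>I. \<integral>\<^sup>+z. of_bool (\<not> dominated y z) \<partial>expv)"
    by (rule expv_PiM.product_nn_integral_prod[OF I]) measurable
  also have "\<dots> = ennreal ((1 - exp (- sum_coords y)) ^ card I)"
    using q by (simp add: one ennreal_power)
  finally show ?thesis .
qed

lemma low_integral_const:
  assumes "0 \<le> T"
  shows "low_integral TYPE('d::finite) T (\<lambda>_. 1) m = ennreal ((1 - exp (- (real CARD('d) * T))) ^ m)"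
proof -
  have "sum_coords (vec T :: real ^ 'd) = real CARD('d) * T"
    by (simp add: sum_coords_def)
  moreover have "(\<integral>\<^sup>+x. of_bool (\<forall>i\<in>{..<m}. \<not> dominated (vec T :: real ^ 'd) (x i)) \<partial>expv_seq {..<m})
    = ennreal ((1 - exp (- sum_coords (vec T :: real ^ 'd))) ^ card {..<m})"
    by (rule nn_integral_none_above) (use assms in auto)
  ultimately show ?thesis
    by (simp only: low_integral_def below_def mult_1_right card_lessThan)
qed

section \<open>Killed records as sets of indices\<close>

lemma sets_record_iff: "sets_record x n \<longleftrightarrow> (\<forall>i\<in>{1..<n}. \<not> dominated (x n) (x i))"
  by (auto simp: sets_record_def)

lemma not_dominated_self: "\<not> dominated x (x :: real ^ 'd::finite)"
  by (simp add: dominated_def)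

text \<open>A nonempty set already forces a record at \<open>n\<close>, because a point dominating
  \<open>x n\<close> would by transitivity dominate \<open>x j\<close> as well. Membership of a
  single \<open>j\<close> can therefore be integrated over the whole sample space.\<close>

definition killed :: "'d::finite vecs \<Rightarrow> nat \<Rightarrow> nat set" where
  "killed x n = {j \<in> {1..<n}. dominated (x j) (x n) \<and> (\<forall>i\<in>{1..<n}. \<not> dominated (x j) (x i))}"

lemma records_killed_eq:
  assumes "1 \<le> n"
  shows "records_killed x n = (if sets_record x n then int (card (killed x n)) else - 1)"
proof -
  obtain m where n: "n = Suc m" using assms by (cases n) auto
  have m: "remaining_record x m j \<longleftrightarrow> 1 \<le> j \<and> j \<le> m \<and> (\<forall>i. 1 \<le> i \<and> i \<le> m \<longrightarrow> \<not> dominated (x j) (x i))" for j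
    by (rule remaining_record_def)
  have Suc: "remaining_record x (Suc m) j \<longleftrightarrow> 1 \<le> j \<and> j \<le> Suc m \<and>
      (\<forall>i. 1 \<le> i \<and> i \<le> m \<longrightarrow> \<not> dominated (x j) (x i)) \<and> \<not> dominated (x j) (x (Suc m))" for j
  proof -
    have "1 \<le> i \<and> i \<le> Suc m \<longleftrightarrow> 1 \<le> i \<and> i \<le> m \<or> i = Suc m" for i by linarith
    then show ?thesis unfolding remaining_record_def by (simp only:) blast
  qed
  have "j \<in> {j. 1 \<le> j \<and> j < n \<and> remaining_record x (n - 1) j \<and> \<not> remaining_record x n j} \<longleftrightarrow> j \<in> killed x n" for j
  proof -
    have "j < Suc m \<longleftrightarrow> j \<le> m" "j \<le> m \<Longrightarrow> j \<le> Suc m" for j by linarith+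
    then show ?thesis
      unfolding n diff_Suc_1 killed_def m Suc atLeastLessThan_iff Ball_def mem_Collect_eq by meson
  qed
  then have "{j. 1 \<le> j \<and> j < n \<and> remaining_record x (n - 1) j \<and> \<not> remaining_record x n j} = killed x n"
    by blast
  then show ?thesis unfolding records_killed_def by (simp only:)
qed

definition near_killed :: "real \<Rightarrow> 'd::finite vecs \<Rightarrow> nat \<Rightarrow> nat set" where
  "near_killed T x n = {j \<in> killed x n. dominated (x n - vec T) (x j)}"

section \<open>Integrals over a sample of fixed size\<close>

context
  fixes n :: nat
  assumes n: "1 \<le> n"
begin

lemma insert_interval: "{1..n} = insert n {1..<n}"
  using n by auto

lemma component_n:
  "(\<lambda>x. x n) \<in> borel_measurable (expv_seq {1..n} :: 'd::finite vecs measure)"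
  by (rule measurable_expv_component) (use n in auto)

lemma component_less:
  "i \<in> {1..<n} \<Longrightarrow> (\<lambda>x. x i) \<in> borel_measurable (expv_seq {1..n} :: 'd::finite vecs measure)"
  by (rule measurable_expv_component) (use n in auto)

lemma measurable_sets_record [measurable]:
  "Measurable.pred (expv_seq {1..n} :: 'd::finite vecs measure) (\<lambda>x. sets_record x n)"
proof -
  note [measurable] = component_n component_less
  show ?thesis unfolding sets_record_iff by measurable
qed

lemma measurable_mem_killed:
  assumes [measurable]: "j \<in> {1..<n}"
  shows "Measurable.pred (expv_seq {1..n} :: 'd::finite vecs measure) (\<lambda>x. j \<in> killed x n)"
proof -
  note [measurable] = component_n component_less
  show ?thesis unfolding killed_def by measurable
qed

lemma measurable_card_near_killed [measurable]:
  "(\<lambda>x. card (near_killed T x n)) \<in> measurable (expv_seq {1..n} :: 'd::finite vecs measure) (count_space UNIV)"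
proof -
  have "near_killed T x n = {j \<in> {1..<n}. j \<in> killed x n \<and> dominated (x n - vec T) (x j)}" for x :: "'d vecs"
    by (auto simp: near_killed_def killed_def)
  moreover have "(\<lambda>x. card {j \<in> {1..<n}. j \<in> killed x n \<and> dominated (x n - vec T) (x j)})
      \<in> measurable (expv_seq {1..n} :: 'd vecs measure) (count_space UNIV)"
  proof (rule measurable_card_Collect)
    fix j assume j [measurable]: "j \<in> {1..<n}"
    note [measurable] = measurable_mem_killed[OF j] component_n component_less[OF j]
    show "Measurable.pred (expv_seq {1..n} :: 'd vecs measure) (\<lambda>x. j \<in> killed x n \<and> dominated (x n - vec T) (x j))"
      by measurable
  qed simp
  ultimately show ?thesis by (simp only:)
qed

lemma measurable_card_killed [measurable]:
  "(\<lambda>x. card (killed x n)) \<in> measurable (expv_seq {1..n} :: 'd::finite vecs measure) (count_space UNIV)"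
proof -
  have "{j \<in> {1..<n}. j \<in> killed x n} = killed x n" for x :: "'d vecs"
    by (auto simp: killed_def)
  moreover have "(\<lambda>x. card {j \<in> {1..<n}. j \<in> killed x n})
      \<in> measurable (expv_seq {1..n} :: 'd vecs measure) (count_space UNIV)"
    by (intro measurable_card_Collect measurable_mem_killed) simp
  ultimately show ?thesis by (simp only:)
qed

lemma nn_integral_sets_record:
  "(\<integral>\<^sup>+x. of_bool (sets_record x n) \<partial>(expv_seq {1..n} :: 'd::finite vecs measure))
    = ennreal (mixed_binom (CARD('d) - 1) (n - 1) 0)"
proof -
  have m: "(\<lambda>x. of_bool (sets_record x n) :: ennreal) \<in> borel_measurable (expv_seq {1..n} :: 'd vecs measure)"
    by measurable
  have "(\<integral>\<^sup>+x. of_bool (sets_record x n) \<partial>(expv_seq {1..n} :: 'd vecs measure))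
    = (\<integral>\<^sup>+y. \<integral>\<^sup>+x. of_bool (sets_record (x(n := y)) n) \<partial>(expv_seq {1..<n} :: 'd vecs measure) \<partial>expv)"
    unfolding insert_interval
    by (rule expv_PiM.product_nn_integral_insert_rev[OF _ _ m[unfolded insert_interval]]) auto
  also have "\<dots> = (\<integral>\<^sup>+y. ennreal (binom_prob (n - 1) 0 (exp (- sum_coords y))) \<partial>(expv :: (real ^ 'd) measure))"
  proof (rule nn_integral_cong_AE, rule eventually_mono[OF AE_expv_pos])
    fix y :: "real ^ 'd" assume "dominated 0 y"
    then have y: "0 \<le> y $ i" for i by (simp add: dominated_def less_imp_le)
    have "sets_record (x(n := y)) n \<longleftrightarrow> (\<forall>i\<in>{1..<n}. \<not> dominated y (x i))" for x :: "'d vecs"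
      by (simp add: sets_record_iff)
    then show "(\<integral>\<^sup>+x. of_bool (sets_record (x(n := y)) n) \<partial>(expv_seq {1..<n} :: 'd vecs measure))
      = ennreal (binom_prob (n - 1) 0 (exp (- sum_coords y)))"
      using nn_integral_none_above[OF y, of "{1..<n}"] by (simp add: binom_prob_def)
  qed
  finally show ?thesis by (simp add: nn_integral_expv_binom_prob)
qed

text \<open>The roles of \<open>j\<close> and \<open>n\<close> are exchanged by integrating over
  \<open>z = x j\<close> outermost: the other \<open>n - 2\<close> points must not dominate
  \<open>z\<close>, while \<open>x n\<close> must. By the memoryless property \<open>x n - z\<close>
  is then an exponential vector independent of \<open>z\<close>, so distances to killed records have
  a law free of \<open>n\<close>.\<close>

lemma nn_integral_mem_killed:
  fixes f :: "real ^ 'd::finite \<Rightarrow> ennreal"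
  assumes j: "j \<in> {1..<n}" and f [measurable]: "f \<in> borel_measurable borel"
  shows "(\<integral>\<^sup>+x. of_bool (j \<in> killed x n) * f (x n - x j) \<partial>expv_seq {1..n})
    = ennreal (mixed_binom (CARD('d) - 1) (n - 1) 1 / real (n - 1)) * (\<integral>\<^sup>+z. f z \<partial>expv)"
proof -
  let ?I = "{1..<n} - {j}"
  have ins: "{1..n} = insert j (insert n ?I)" using j by auto
  have n1: "0 < n - 1" using j by auto
  let ?g = "\<lambda>x. of_bool (j \<in> killed x n) * f (x n - x j)"
  have g: "?g \<in> borel_measurable (expv_seq {1..n})"
  proof -
    note [measurable] = measurable_mem_killed[OF j] component_n component_less[OF j]
    show ?thesis by measurable
  qed
  have geq: "?g ((x(n := y))(j := z)) = of_bool (\<forall>i\<in>?I. \<not> dominated z (x i)) * (of_bool (dominated z y) * f (y - z))"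
    for x y z
  proof -
    have "(\<forall>i\<in>{1..<n}. \<not> dominated z (((x(n := y))(j := z)) i)) \<longleftrightarrow> (\<forall>i\<in>?I. \<not> dominated z (x i))"
      using not_dominated_self[of z] by auto
    then show ?thesis using j by (auto simp: killed_def)
  qed
  have "(\<integral>\<^sup>+x. ?g x \<partial>expv_seq {1..n})
    = (\<integral>\<^sup>+z. \<integral>\<^sup>+x. ?g (x(j := z)) \<partial>expv_seq (insert n ?I) \<partial>expv)"
    using g unfolding ins by (intro expv_PiM.product_nn_integral_insert_rev) (use j in auto)
  also have "\<dots> = (\<integral>\<^sup>+z. ennreal (binom_prob (n - 1) 1 (exp (- sum_coords z)) / real (n - 1)) * (\<integral>\<^sup>+z. f z \<partial>expv) \<partial>(expv :: (real ^ 'd) measure))"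
  proof (rule nn_integral_cong_AE, rule eventually_mono[OF AE_expv_pos])
    fix z :: "real ^ 'd" assume "dominated 0 z"
    then have z: "0 \<le> z $ i" for i by (simp add: dominated_def less_imp_le)
    then have "0 \<le> sum_coords z" by (auto simp: sum_coords_def intro: sum_nonneg)
    then have q: "exp (- sum_coords z) \<le> 1" by auto
    have gz: "(\<lambda>x. ?g (x(j := z))) \<in> borel_measurable (expv_seq (insert n ?I))"
      by (rule measurable_compose[OF measurable_fun_upd[where J = "insert n ?I"] g[unfolded ins]]) auto
    have fz [measurable]: "(\<lambda>y. of_bool (dominated z y) * f (y - z)) \<in> borel_measurable expv"
    proof -
      have "(\<lambda>y. of_bool (dominated z y) * f (y - z)) \<in> borel_measurable borel"
        by (intro borel_measurable_times_ennreal measurable_compose[OF _ f]) measurable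
      then show ?thesis by (simp cong: measurable_cong_sets)
    qed
    have [measurable]: "(\<lambda>x. of_bool (\<forall>i\<in>?I. \<not> dominated z (x i)) :: ennreal) \<in> borel_measurable (expv_seq ?I)"
    proof -
      have [measurable]: "i \<in> ?I \<Longrightarrow> (\<lambda>x. x i) \<in> borel_measurable (expv_seq ?I :: 'd vecs measure)" for i
        by (rule measurable_expv_component)
      show ?thesis by measurable
    qed
    have "(\<integral>\<^sup>+x. ?g (x(j := z)) \<partial>expv_seq (insert n ?I))
      = (\<integral>\<^sup>+y. \<integral>\<^sup>+x. ?g ((x(n := y))(j := z)) \<partial>expv_seq ?I \<partial>expv)"
      by (rule expv_PiM.product_nn_integral_insert_rev) (use gz in auto)
    also have "\<dots> = (\<integral>\<^sup>+y. (\<integral>\<^sup>+x. of_bool (\<forall>i\<in>?I. \<not> dominated z (x i)) \<partial>expv_seq ?I)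
        * (of_bool (dominated z y) * f (y - z)) \<partial>expv)"
      unfolding geq by (intro nn_integral_cong nn_integral_multc) measurable
    also have "\<dots> = (\<integral>\<^sup>+x. of_bool (\<forall>i\<in>?I. \<not> dominated z (x i)) \<partial>expv_seq ?I)
        * (\<integral>\<^sup>+y. of_bool (dominated z y) * f (y - z) \<partial>expv)"
      by (rule nn_integral_cmult[OF fz])
    also have "\<dots> = ennreal ((1 - exp (- sum_coords z)) ^ (n - 2) * exp (- sum_coords z)) * (\<integral>\<^sup>+z. f z \<partial>expv)"
    proof -
      have "card ?I = n - 2" using j by simp
      then show ?thesis
        using nn_integral_none_above[OF z, of ?I] nn_integral_expv_memoryless[OF z f] q
        by (simp add: ennreal_mult' mult.assoc)
    qed
    \<comment> \<open>One success among \<open>n - 1\<close> trials, with the position of the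
      success prescribed; hence the division by the number of positions.\<close>
    also have "(1 - exp (- sum_coords z)) ^ (n - 2) * exp (- sum_coords z)
        = binom_prob (n - 1) 1 (exp (- sum_coords z)) / real (n - 1)"
      using n1 by (simp add: binom_prob_def numeral_2_eq_2)
    finally show "(\<integral>\<^sup>+x. ?g (x(j := z)) \<partial>expv_seq (insert n ?I))
       = ennreal (binom_prob (n - 1) 1 (exp (- sum_coords z)) / real (n - 1)) * (\<integral>\<^sup>+z. f z \<partial>expv)" .
  qed
  also have "\<dots> = (\<integral>\<^sup>+z. ennreal (binom_prob (n - 1) 1 (exp (- sum_coords z)) / real (n - 1)) \<partial>(expv :: (real ^ 'd) measure)) * (\<integral>\<^sup>+z. f z \<partial>expv)"
    by (rule nn_integral_multc) measurable
  also have "(\<integral>\<^sup>+z. ennreal (binom_prob (n - 1) 1 (exp (- sum_coords z)) / real (n - 1)) \<partial>(expv :: (real ^ 'd) measure))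
      = ennreal (mixed_binom (CARD('d) - 1) (n - 1) 1 / real (n - 1))"
  proof -
    have "ennreal (binom_prob (n - 1) 1 (exp (- sum_coords z)) / real (n - 1))
       = ennreal (1 / real (n - 1)) * ennreal (binom_prob (n - 1) 1 (exp (- sum_coords z)))" for z :: "real ^ 'd"
      by (simp add: ennreal_mult'[symmetric])
    moreover have measurable_const_binom:
      "(\<lambda>z. ennreal (binom_prob (n - 1) 1 (exp (- sum_coords z)))) \<in> borel_measurable (expv :: (real ^ 'd) measure)"
      by measurable
    ultimately show ?thesis
      by (simp only: nn_integral_cmult[OF measurable_const_binom] nn_integral_expv_binom_prob)
        (simp add: ennreal_mult'[symmetric])
  qed
  finally show ?thesis .
qed

text \<open>The memoryless property is used twice with the corner \<open>b = x n - vec T\<close>,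
  which lies in the positive orthant because \<open>x n\<close> dominates \<open>vec T\<close>. For
  the other points it yields thinned configurations whose size is binomial given \<open>b\<close>;
  for \<open>x n\<close> it makes \<open>b\<close> itself an exponential vector at the price of
  \<open>exp (- d T)\<close>, so that the binomial probabilities average to
  \<open>mixed_binom\<close>.\<close>

lemma nn_integral_near_killed:
  fixes T :: real
  assumes T: "0 \<le> T"
  shows "(\<integral>\<^sup>+x. of_bool (sets_record x n \<and> dominated (vec T) (x n)) * h (card (near_killed T x n))
      \<partial>(expv_seq {1..n} :: 'd::finite vecs measure))
    = ennreal (exp (- (real CARD('d) * T))) *
       (\<Sum>m\<le>n - 1. ennreal (mixed_binom (CARD('d) - 1) (n - 1) m) * low_integral TYPE('d) T h m)"
proof -
  let ?I = "{1..<n}"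
  let ?g = "\<lambda>x :: 'd vecs. of_bool (sets_record x n \<and> dominated (vec T) (x n)) * h (card (near_killed T x n))"
  let ?G = "\<lambda>b :: real ^ 'd. \<Sum>m\<le>n - 1. ennreal (binom_prob (n - 1) m (exp (- sum_coords b))) * low_integral TYPE('d) T h m"
  have m: "?g \<in> borel_measurable (expv_seq {1..n})"
  proof -
    note [measurable] = component_n
    show ?thesis by measurable
  qed
  have "(\<integral>\<^sup>+x. ?g x \<partial>expv_seq {1..n}) = (\<integral>\<^sup>+y. \<integral>\<^sup>+x. ?g (x(n := y)) \<partial>expv_seq ?I \<partial>expv)"
    unfolding insert_interval
    by (rule expv_PiM.product_nn_integral_insert_rev[OF _ _ m[unfolded insert_interval]]) auto
  also have "\<dots> = (\<integral>\<^sup>+y. of_bool (dominated (vec T) y) * ?G (y - vec T) \<partial>expv)"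
  proof (rule nn_integral_cong)
    fix y :: "real ^ 'd"
    show "(\<integral>\<^sup>+x. ?g (x(n := y)) \<partial>expv_seq ?I) = of_bool (dominated (vec T) y) * ?G (y - vec T)"
    proof (cases "dominated (vec T) y")
      case True
      define b where "b = y - vec T"
      have b: "0 \<le> b $ i" for i using True by (simp add: b_def dominated_def less_imp_le)
      have tr: "dominated u w" if "dominated u v" "dominated v w" for u v w :: "real ^ 'd"
        using that by (auto simp: dominated_def intro: less_trans)
      have dby: "dominated b y \<or> T = 0"
        using T by (auto simp: b_def dominated_def)
      have "?g (x(n := y)) = of_bool (below T {i \<in> ?I. dominated b (x i)} (\<lambda>i\<in>{i \<in> ?I. dominated b (x i)}. x i - b)) *
         h (num_low T {i \<in> ?I. dominated b (x i)} (\<lambda>i\<in>{i \<in> ?I. dominated b (x i)}. x i - b))" for x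
      proof -
        let ?J = "{i \<in> ?I. dominated b (x i)}"
        have 1: "dominated (vec T) (x i - b) \<longleftrightarrow> dominated y (x i)" for i
          by (auto simp: b_def dominated_def algebra_simps)
        have 2: "dominated (x i - b) (vec T) \<longleftrightarrow> dominated (x i) y" for i
          by (auto simp: b_def dominated_def algebra_simps)
        have 3: "dominated (x i - b) (x j - b) \<longleftrightarrow> dominated (x i) (x j)" for i j
          by (auto simp: dominated_def)
        \<comment> \<open>The retained points alone decide whether \<open>y\<close> is a record,
          since every point above \<open>y\<close> is above the corner.\<close>
        have 4: "dominated y (x i) \<Longrightarrow> dominated b (x i)" for i
          using T by (auto simp: b_def dominated_def intro: le_less_trans[rotated])
        have "sets_record (x(n := y)) n \<longleftrightarrow> below T ?J (\<lambda>i\<in>?J. x i - b)"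
          using 4 by (auto simp: sets_record_iff below_def 1)
        moreover have "near_killed T (x(n := y)) n =
          {i \<in> ?J. dominated (x i - b) (vec T) \<and> (\<forall>j\<in>?J. \<not> dominated (x i - b) (x j - b))}"
        proof -
          \<comment> \<open>A point dominating a retained one is retained as well, so maximality
            among the retained points agrees with maximality among all earlier points.\<close>
          have "dominated b (x j)" if "dominated b (x i)" "dominated (x i) (x j)" for i j
            using that by (rule tr)
          note tr' = this
          show ?thesis unfolding 2 3 near_killed_def killed_def
            by (auto simp: b_def[symmetric]) (use tr' in blast)
        qed
        moreover have "\<dots> = {i \<in> ?J. dominated ((\<lambda>i\<in>?J. x i - b) i) (vec T) \<and>
             (\<forall>j\<in>?J. \<not> dominated ((\<lambda>i\<in>?J. x i - b) i) ((\<lambda>i\<in>?J. x i - b) j))}"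
          by (rule Collect_cong) (simp cong: conj_cong)
        ultimately show ?thesis using True by (simp add: num_low_def)
      qed
      then show ?thesis
        using nn_integral_upper_low[OF b, of ?I T h] True by (simp add: b_def[symmetric])
    qed simp
  qed
  also have "\<dots> = ennreal (exp (- sum_coords (vec T :: real ^ 'd))) * (\<integral>\<^sup>+z. ?G z \<partial>expv)"
    by (rule nn_integral_expv_memoryless) (use T in auto)
  also have "(\<integral>\<^sup>+z. ?G z \<partial>expv) = (\<Sum>m\<le>n - 1. ennreal (mixed_binom (CARD('d) - 1) (n - 1) m) * low_integral TYPE('d) T h m)"
    by (subst nn_integral_sum) (auto simp: nn_integral_multc nn_integral_expv_binom_prob)
  finally show ?thesis by (simp add: sum_coords_def)
qed

end

section \<open>Measurability of the number of maxima\<close>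

definition grid :: "nat \<Rightarrow> real ^ 'd::finite \<Rightarrow> 'd \<Rightarrow> int" where
  "grid n z = (\<lambda>i. \<lfloor>real n * z $ i\<rfloor>)"

lemma measurable_grid: "Measurable.pred borel (\<lambda>z. grid n z = a)"
  unfolding grid_def fun_eq_iff by measurable

lemma bounded_grid_cell:
  assumes "0 < n"
  shows "bounded {z :: real ^ 'd::finite. grid n z = a}"
proof (rule bounded_subset[OF bounded_cbox])
  show "{z. grid n z = a} \<subseteq> cbox (\<chi> i. a i / real n) (\<chi> i. (a i + 1) / real n)"
  proof
    fix z assume "z \<in> {z. grid n z = a}"
    then have "a = grid n z" by simp
    then have "real_of_int (a i) \<le> real n * z $ i \<and> real n * z $ i \<le> real_of_int (a i) + 1" for i
      unfolding \<open>a = grid n z\<close> by (simp add: grid_def)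
    then show "z \<in> cbox (\<chi> i. a i / real n) (\<chi> i. (a i + 1) / real n)"
      using assms by (simp add: mem_box_cart divide_simps mult.commute)
  qed
qed

lemma eventually_floor_less:
  fixes u v :: real
  assumes "u < v"
  shows "\<forall>\<^sub>F n in sequentially. real_of_int \<lfloor>real n * u\<rfloor> + 1 \<le> real n * v"
proof -
  obtain N where N: "1 / (v - u) \<le> real N" using real_arch_simple by blast
  show ?thesis
    using eventually_ge_at_top[of N]
  proof eventually_elim
    case (elim n)
    then have "1 / (v - u) \<le> real n" using N by linarith
    then have "1 \<le> real n * (v - u)" using assms by (simp add: divide_le_eq)
    then have "1 \<le> real n * v - real n * u" by (simp only: right_diff_distrib)
    then show ?case by linarith
  qed
qed

lemma eventually_floor_neq:
  fixes u v :: real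
  assumes "u \<noteq> v"
  shows "\<forall>\<^sub>F n in sequentially. \<lfloor>real n * u\<rfloor> \<noteq> \<lfloor>real n * v\<rfloor>"
  using assms
proof (induction u v rule: linorder_wlog)
  case (le a b)
  then have "a < b" by simp
  from eventually_floor_less[OF this] show ?case
    by eventually_elim linarith
next
  case (sym a b)
  then show ?case by (simp add: eq_commute)
qed

lemma floor_less_iff_of_neq:
  fixes u v :: real
  assumes "\<lfloor>real n * u\<rfloor> \<noteq> \<lfloor>real n * v\<rfloor>"
  shows "\<lfloor>real n * u\<rfloor> < \<lfloor>real n * v\<rfloor> \<longleftrightarrow> u < v"
proof -
  have "u \<le> v \<Longrightarrow> \<lfloor>real n * u\<rfloor> \<le> \<lfloor>real n * v\<rfloor>" "v \<le> u \<Longrightarrow> \<lfloor>real n * v\<rfloor> \<le> \<lfloor>real n * u\<rfloor>"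
    by (auto intro!: floor_mono mult_left_mono)
  then show ?thesis using assms by linarith
qed

lemma eventually_inj_on_grid:
  fixes D :: "(real ^ 'd::finite) set"
  assumes "finite D"
  shows "\<forall>\<^sub>F n in sequentially. inj_on (grid n) D"
proof -
  have "\<forall>\<^sub>F n in sequentially. y \<noteq> z \<longrightarrow> grid n y \<noteq> grid n z" for y z :: "real ^ 'd"
  proof (cases "y = z")
    case False
    then obtain i where "y $ i \<noteq> z $ i" by (auto simp: vec_eq_iff)
    from eventually_floor_neq[OF this] show ?thesis
      by eventually_elim (auto simp: grid_def fun_eq_iff)
  qed simp
  then have "\<forall>\<^sub>F n in sequentially. \<forall>y\<in>D. \<forall>z\<in>D. y \<noteq> z \<longrightarrow> grid n y \<noteq> grid n z"
    using assms by (intro eventually_ball_finite ballI) auto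
  then show ?thesis by eventually_elim (auto simp: inj_on_def)
qed

lemma num_points_eq_0: "num_points A = 0 \<longleftrightarrow> A = {}"
  by (auto simp: num_points_def zero_enat_def)

lemma num_points_ge: "enat k \<le> num_points A \<longleftrightarrow> (\<exists>D\<subseteq>A. finite D \<and> card D = k)"
proof (cases "finite A")
  case True
  then show ?thesis
    by (auto simp: num_points_def intro: card_mono dest: obtain_subset_with_card_n)
next
  case False
  then show ?thesis by (auto simp: num_points_def dest: infinite_arbitrarily_large)
qed

lemma num_points_eq: "num_points A = enat k \<longleftrightarrow> enat k \<le> num_points A \<and> \<not> enat (Suc k) \<le> num_points A"
  by (cases "num_points A") auto

section \<open>Events about the maxima, expressed through counts\<close>

locale point_process = prob_space N for N :: "'w measure" and f :: "real ^ 'd::finite \<Rightarrow> real"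
    and S :: "'w \<Rightarrow> (real ^ 'd) set" +
  assumes ppp: "poisson_point_process N f S"
begin

lemma finite_bounded: "\<omega> \<in> space N \<Longrightarrow> bounded B \<Longrightarrow> finite (S \<omega> \<inter> B)"
  using ppp by (auto simp: poisson_point_process_def)

lemma measurable_num_points:
  "B \<in> sets borel \<Longrightarrow> (\<lambda>\<omega>. num_points (S \<omega> \<inter> B)) \<in> measurable N (count_space UNIV)"
  using ppp by (auto simp: poisson_point_process_def)

lemma measurable_empty:
  assumes "Measurable.pred borel P"
  shows "Measurable.pred N (\<lambda>\<omega>. \<forall>z\<in>S \<omega>. \<not> P z)"
proof -
  have "Measurable.pred N (\<lambda>\<omega>. num_points (S \<omega> \<inter> {z. P z}) = 0)"
    using measurable_num_points[OF sets_Collect_borel[OF assms]] by measurable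
  moreover have "num_points (S \<omega> \<inter> {z. P z}) = 0 \<longleftrightarrow> (\<forall>z\<in>S \<omega>. \<not> P z)" for \<omega>
    by (auto simp: num_points_eq_0)
  ultimately show ?thesis by simp
qed

text \<open>Only events that a Borel set contains no point are available. For each mesh
  \<open>1 / n\<close> one asks for a cell that contains a point with \<open>P\<close> while no
  point lies beyond its upper corner. A maximum provides its own cell. Conversely, if every point
  with \<open>P\<close> is dominated, a fine mesh puts the dominating points beyond the cells;
  boundedness leaves finitely many such points, so one mesh serves all of them.\<close>

lemma measurable_hit:
  assumes P: "Measurable.pred borel P" and bdd: "bounded {z. P z}"
  shows "Measurable.pred N (\<lambda>\<omega>. \<exists>y\<in>maxima (S \<omega>). P y)"
proof -
  let ?R = "\<lambda>n (a :: 'd \<Rightarrow> int) \<omega>. \<not> (\<forall>y\<in>S \<omega>. \<not> (P y \<and> grid n y = a)) \<and>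
      (\<forall>z\<in>S \<omega>. \<not> (\<forall>i. real_of_int (a i) + 1 \<le> real n * z $ i))"
  have m: "Measurable.pred N (?R n a)" for n a
    by (intro pred_intros_logic measurable_empty P measurable_grid) measurable
  have iff: "(\<exists>y\<in>maxima (S \<omega>). P y) \<longleftrightarrow> (\<forall>n. \<exists>a. ?R n a \<omega>)" if \<omega>: "\<omega> \<in> space N" for \<omega>
  proof safe
    fix y n assume y: "y \<in> maxima (S \<omega>)" "P y"
    have "dominated y z" if "\<forall>i. real_of_int (grid n y i) + 1 \<le> real n * z $ i" for z
      unfolding dominated_def
    proof
      fix i
      have "real n * y $ i < real n * z $ i"
        using that[rule_format, of i] unfolding grid_def by linarith
      then show "y $ i < z $ i" by (simp add: mult_less_cancel_left)
    qed
    with y have "?R n (grid n y) \<omega>" by (auto simp: maxima_def)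
    then show "\<exists>a. ?R n a \<omega>" by blast
  next
    assume R: "\<forall>n. \<exists>a. ?R n a \<omega>"
    have fin: "finite (S \<omega> \<inter> {z. P z})" using finite_bounded[OF \<omega> bdd] .
    show "\<exists>y\<in>maxima (S \<omega>). P y"
    proof (rule ccontr)
      assume contra: "\<not> ?thesis"
      have "\<forall>\<^sub>F n in sequentially. \<exists>z\<in>S \<omega>. \<forall>i. real_of_int (grid n y i) + 1 \<le> real n * z $ i"
        if y: "y \<in> S \<omega> \<inter> {z. P z}" for y
      proof -
        from y contra obtain z where z: "z \<in> S \<omega>" "dominated y z"
          by (auto simp: maxima_def)
        have "\<forall>\<^sub>F n in sequentially. \<forall>i\<in>UNIV. real_of_int (grid n y i) + 1 \<le> real n * z $ i"
          unfolding grid_def using z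
          by (intro eventually_ball_finite ballI eventually_floor_less) (auto simp: dominated_def)
        then show ?thesis by eventually_elim (use z in auto)
      qed
      then have "\<forall>\<^sub>F n in sequentially. \<forall>y\<in>S \<omega> \<inter> {z. P z}. \<exists>z\<in>S \<omega>. \<forall>i. real_of_int (grid n y i) + 1 \<le> real n * z $ i"
        by (intro eventually_ball_finite fin) auto
      then obtain n where n: "\<forall>y\<in>S \<omega> \<inter> {z. P z}. \<exists>z\<in>S \<omega>. \<forall>i. real_of_int (grid n y i) + 1 \<le> real n * z $ i"
        by (auto simp: eventually_sequentially)
      obtain a where "?R n a \<omega>" using R by blast
      then show False using n by blast
    qed
  qed
  have "Measurable.pred N (\<lambda>\<omega>. \<forall>n. \<exists>a. ?R n a \<omega>)"
    by (intro pred_intros_countable m)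
  then show ?thesis
    by (subst measurable_cong[OF iff]) auto
qed

text \<open>Finitely many distinct points are separated by a fine grid, so having \<open>k\<close>
  maxima means that \<open>k\<close> different cells of some grid contain one. There are countably
  many finite sets of cells.\<close>

lemma measurable_maxima_ge:
  assumes P: "Measurable.pred borel P"
  shows "Measurable.pred N (\<lambda>\<omega>. enat k \<le> num_points {y \<in> maxima (S \<omega>). P y})"
proof -
  let ?F = "{A :: ('d \<Rightarrow> int) set. finite A \<and> card A = k}"
  \<comment> \<open>\<open>Suc n\<close> avoids the mesh index 0, whose only nonempty cell is the
    whole space and hence unbounded.\<close>
  let ?H = "\<lambda>n a \<omega>. \<exists>y\<in>maxima (S \<omega>). P y \<and> grid (Suc n) y = a"
  have iff: "enat k \<le> num_points {y \<in> maxima (S \<omega>). P y} \<longleftrightarrow> (\<exists>n. \<exists>A\<in>?F. \<forall>a\<in>A. ?H n a \<omega>)" for \<omega>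
  proof
    assume "enat k \<le> num_points {y \<in> maxima (S \<omega>). P y}"
    then obtain D where D: "D \<subseteq> {y \<in> maxima (S \<omega>). P y}" "finite D" "card D = k"
      by (auto simp: num_points_ge)
    have "\<forall>\<^sub>F n in sequentially. inj_on (grid (Suc n)) D"
      using eventually_inj_on_grid[OF D(2)] by (rule eventually_sequentially_Suc[THEN iffD2])
    then obtain n where n: "inj_on (grid (Suc n)) D"
      by (auto simp: eventually_sequentially)
    have "grid (Suc n) ` D \<in> ?F" using D n by (simp add: card_image)
    moreover have "\<forall>a\<in>grid (Suc n) ` D. ?H n a \<omega>" using D by blast
    ultimately show "\<exists>n. \<exists>A\<in>?F. \<forall>a\<in>A. ?H n a \<omega>" by blast
  next
    assume "\<exists>n. \<exists>A\<in>?F. \<forall>a\<in>A. ?H n a \<omega>"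
    then obtain n A where A: "finite A" "card A = k" "\<forall>a\<in>A. ?H n a \<omega>" by blast
    then obtain y where y: "\<And>a. a \<in> A \<Longrightarrow> y a \<in> maxima (S \<omega>) \<and> P (y a) \<and> grid (Suc n) (y a) = a"
      by metis
    then have "inj_on y A" by (metis inj_onI)
    then show "enat k \<le> num_points {y \<in> maxima (S \<omega>). P y}"
      unfolding num_points_ge using A y by (intro exI[of _ "y ` A"]) (auto simp: card_image)
  qed
  have c: "countable ?F"
    by (rule countable_subset[OF _ countable_Collect_finite]) auto
  have m: "Measurable.pred N (\<lambda>\<omega>. \<forall>a\<in>A. ?H n a \<omega>)" if "A \<in> ?F" for n A
  proof (rule pred_intros_finite)
    show "finite A" using that by simp
    fix a
    show "Measurable.pred N (?H n a)"
    proof (rule measurable_hit)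
      show "Measurable.pred borel (\<lambda>y. P y \<and> grid (Suc n) y = a)"
        by (intro pred_intros_logic P measurable_grid)
      show "bounded {z. P z \<and> grid (Suc n) z = a}"
        by (rule bounded_subset[OF bounded_grid_cell[of "Suc n" a]]) auto
    qed
  qed
  have "Measurable.pred N (\<lambda>\<omega>. \<exists>A\<in>?F. \<forall>a\<in>A. ?H n a \<omega>)" for n
    using m unfolding pred_def by (intro sets.sets_Collect_countable_Ex' c) auto
  then show ?thesis
    unfolding iff by (rule pred_intros_countable(2))
qed

lemma measurable_maxima_eq:
  assumes "Measurable.pred borel P"
  shows "Measurable.pred N (\<lambda>\<omega>. num_points {y \<in> maxima (S \<omega>). P y} = enat k)"
  unfolding num_points_eq by (intro pred_intros_logic measurable_maxima_ge assms)

text \<open>Having exactly \<open>k\<close> maxima is not monotone in \<open>t\<close>, but having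
  at least \<open>k\<close> is; the probability is a difference of two monotone limits. A finite
  witness set is already captured by a single \<open>t\<close>.\<close>

lemma tendsto_maxima_eq:
  assumes P: "\<And>t :: nat. Measurable.pred borel (P t)"
    and mono: "\<And>s t y. s \<le> t \<Longrightarrow> P s y \<Longrightarrow> P t y"
  shows "(\<lambda>t. prob {\<omega> \<in> space N. num_points {y \<in> maxima (S \<omega>). P t y} = enat k})
    \<longlonglongrightarrow> prob {\<omega> \<in> space N. num_points {y \<in> maxima (S \<omega>). \<exists>t. P t y} = enat k}"
proof -
  let ?G = "\<lambda>k t. {\<omega> \<in> space N. enat k \<le> num_points {y \<in> maxima (S \<omega>). P t y}}"
  let ?L = "\<lambda>k. {\<omega> \<in> space N. enat k \<le> num_points {y \<in> maxima (S \<omega>). \<exists>t. P t y}}"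
  have meas: "?G k t \<in> sets N" for k t
    using measurable_maxima_ge[OF P, of k t] by (simp add: pred_def)
  have Q: "Measurable.pred borel (\<lambda>y. \<exists>t. P t y)" using P by (intro pred_intros_countable)
  have measL: "?L k \<in> sets N" for k
    using measurable_maxima_ge[OF Q, of k] by (simp add: pred_def)
  have inc: "incseq (?G k)" for k
  proof (rule incseq_SucI, safe)
    fix t \<omega> assume "enat k \<le> num_points {y \<in> maxima (S \<omega>). P t y}"
    moreover have "{y \<in> maxima (S \<omega>). P t y} \<subseteq> {y \<in> maxima (S \<omega>). P (Suc t) y}"
      using mono[of t "Suc t"] by auto
    ultimately show "enat k \<le> num_points {y \<in> maxima (S \<omega>). P (Suc t) y}"
      unfolding num_points_ge by blast
  qed
  have un: "(\<Union>t. ?G k t) = ?L k" for k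
  proof safe
    fix \<omega> t assume "enat k \<le> num_points {y \<in> maxima (S \<omega>). P t y}"
    then show "enat k \<le> num_points {y \<in> maxima (S \<omega>). \<exists>t. P t y}"
      unfolding num_points_ge by blast
  next
    fix \<omega> assume \<omega>: "\<omega> \<in> space N" "enat k \<le> num_points {y \<in> maxima (S \<omega>). \<exists>t. P t y}"
    then obtain D where D: "D \<subseteq> {y \<in> maxima (S \<omega>). \<exists>t. P t y}" "finite D" "card D = k"
      by (auto simp: num_points_ge)
    then have "\<forall>y\<in>D. \<exists>t. P t y" by auto
    then obtain t where t: "\<forall>y\<in>D. P (t y) y" by metis
    obtain m where m: "\<forall>y\<in>D. t y \<le> m"
      using D(2) by (meson finite_imageI finite_nat_set_iff_bounded_le imageI)
    then have "\<forall>y\<in>D. P m y" using t mono by blast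
    then have "enat k \<le> num_points {y \<in> maxima (S \<omega>). P m y}"
      using D unfolding num_points_ge by (intro exI[of _ D]) auto
    then show "\<omega> \<in> (\<Union>t. ?G k t)" using \<omega> by blast
  qed
  have lim: "(\<lambda>t. prob (?G k t)) \<longlonglongrightarrow> prob (?L k)" for k
    unfolding un[symmetric] by (rule finite_Lim_measure_incseq) (use meas inc in auto)
  have G: "prob {\<omega> \<in> space N. num_points {y \<in> maxima (S \<omega>). P t y} = enat k} = prob (?G k t) - prob (?G (Suc k) t)" for t
  proof -
    have "{\<omega> \<in> space N. num_points {y \<in> maxima (S \<omega>). P t y} = enat k} = ?G k t - ?G (Suc k) t"
      by (subst num_points_eq) auto
    moreover have "?G (Suc k) t \<subseteq> ?G k t"
      by (auto elim: order_trans[rotated])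
    ultimately show ?thesis using finite_measure_Diff[OF meas meas] by simp
  qed
  have L: "prob {\<omega> \<in> space N. num_points {y \<in> maxima (S \<omega>). \<exists>t. P t y} = enat k} = prob (?L k) - prob (?L (Suc k))"
  proof -
    have "{\<omega> \<in> space N. num_points {y \<in> maxima (S \<omega>). \<exists>t. P t y} = enat k} = ?L k - ?L (Suc k)"
      by (subst num_points_eq) auto
    moreover have "?L (Suc k) \<subseteq> ?L k"
      by (auto elim: order_trans[rotated])
    ultimately show ?thesis using finite_measure_Diff[OF measL measL] by simp
  qed
  show ?thesis unfolding G L by (intro tendsto_diff lim)
qed

end

section \<open>Separated configurations of the Poisson process\<close>

text \<open>In the Poisson picture \<open>diag_point g\<close> takes the place of the new record,
  and this is the counterpart of \<open>x n - vec T\<close>.\<close>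

definition corner :: "real \<Rightarrow> real \<Rightarrow> real ^ 'd::finite" where
  "corner g T = diag_point g - vec T"

lemma sum_coords_corner: "sum_coords (corner g T :: real ^ 'd::finite) = g - real CARD('d) * T"
  by (simp add: corner_def sum_coords_def diag_point_def right_diff_distrib)

lemma dominated_diff: "dominated 0 (z - c) \<longleftrightarrow> dominated c (z :: real ^ 'd::finite)"
  by (simp add: dominated_def)

definition cell :: "real \<Rightarrow> nat \<Rightarrow> ('d::finite \<Rightarrow> int) \<Rightarrow> (real ^ 'd) set" where
  "cell T n a = {w. dominated 0 w \<and> \<not> dominated (vec T) w \<and> grid n w = a}"

lemma sets_cell [measurable]: "cell T n a \<in> sets borel"
  unfolding cell_def
  by (intro sets_Collect_borel pred_intros_logic measurable_grid) measurable

text \<open>The coordinates of the corner sum to \<open>g - d T\<close>, so moving the origin there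
  scales the exponential intensity by \<open>exp (d T - g)\<close>; the forbidden orthant above
  \<open>diag_point g\<close> becomes the one above \<open>vec T\<close>.\<close>

lemma emeasure_limit_intensity:
  fixes C :: "(real ^ 'd::finite) set"
  assumes [measurable]: "C \<in> sets borel" and C: "C \<subseteq> {w. dominated 0 w}"
  shows "emeasure (density lborel (\<lambda>z. ennreal (limit_intensity g z))) {z. z - corner g T \<in> C}
    = ennreal (exp (real CARD('d) * T - g)) * emeasure expv {w \<in> C. \<not> dominated (vec T) w}"
proof -
  let ?c = "corner g T :: real ^ 'd"
  let ?C' = "{w \<in> C. \<not> dominated (vec T) w}"
  have C' [measurable]: "?C' \<in> sets borel"
    using sets_Collect_borel[of "\<lambda>w. w \<in> C \<and> \<not> dominated (vec T) w"] by simp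
  have shift [measurable]: "{z. z - ?c \<in> C} \<in> sets borel"
    by (rule sets_Collect_borel) measurable
  have lm [measurable]: "(\<lambda>z. limit_intensity g z) \<in> borel_measurable (borel :: (real ^ 'd) measure)"
    unfolding limit_intensity_def by measurable
  have "emeasure (density lborel (\<lambda>z. ennreal (limit_intensity g z))) {z. z - ?c \<in> C}
    = (\<integral>\<^sup>+z. ennreal (limit_intensity g z) * indicator {z. z - ?c \<in> C} z \<partial>distr lborel borel ((+) ?c))"
    unfolding lborel_distr_plus by (rule emeasure_density) measurable
  also have "\<dots> = (\<integral>\<^sup>+w. ennreal (limit_intensity g (?c + w)) * indicator C w \<partial>lborel)"
    by (subst nn_integral_distr) (auto intro!: nn_integral_cong split: split_indicator)
  also have "\<dots> = (\<integral>\<^sup>+w. ennreal (exp (real CARD('d) * T - g)) *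
      (ennreal (of_bool (dominated 0 w) * exp (- sum_coords w)) * indicator ?C' w) \<partial>lborel)"
  proof (rule nn_integral_cong)
    fix w :: "real ^ 'd"
    have "dominated (diag_point g) (?c + w) \<longleftrightarrow> dominated (vec T) w"
      by (auto simp: dominated_def corner_def)
    moreover have "exp (- (\<Sum>j\<in>UNIV. (?c + w) $ j)) = exp (real CARD('d) * T - g) * exp (- sum_coords w)"
      unfolding sum_coords_def[symmetric] sum_coords_add sum_coords_corner by (simp add: exp_add[symmetric])
    ultimately have "limit_intensity g (?c + w) = exp (real CARD('d) * T - g) *
        (of_bool (\<not> dominated (vec T) w) * exp (- sum_coords w))"
      unfolding limit_intensity_def by simp
    then show "ennreal (limit_intensity g (?c + w)) * indicator C w = ennreal (exp (real CARD('d) * T - g)) *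
      (ennreal (of_bool (dominated 0 w) * exp (- sum_coords w)) * indicator ?C' w)"
      using C by (auto simp: ennreal_mult' split: split_indicator)
  qed
  also have "\<dots> = ennreal (exp (real CARD('d) * T - g)) * (\<integral>\<^sup>+w. indicator ?C' w \<partial>expv)"
    using nn_integral_expv[of "indicator ?C'", symmetric] by (simp add: nn_integral_cmult)
  finally show ?thesis by simp
qed

locale limit_process = point_process N "limit_intensity g :: real ^ 'd::finite \<Rightarrow> real" S
  for N :: "'w measure" and g S +
  fixes T :: real
  assumes T: "0 < T"
begin

abbreviation (input) shifted :: "(real ^ 'd) set \<Rightarrow> (real ^ 'd) set" where
  "shifted C \<equiv> {z. z - corner g T \<in> C}"

lemma sets_shifted:
  assumes [measurable]: "C \<in> sets borel"
  shows "shifted C \<in> sets borel"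
  by (rule sets_Collect_borel) measurable

lemma prob_count:
  assumes C: "C \<in> sets borel" "C \<subseteq> {w. dominated 0 w}"
    and p: "p = measure expv {w \<in> C. \<not> dominated (vec T) w}"
  shows "prob {\<omega> \<in> space N. num_points (S \<omega> \<inter> shifted C) = enat k} = (exp (real CARD('d) * T - g) * p) ^ k / fact k * exp (- (exp (real CARD('d) * T - g) * p))"
proof -
  let ?D = "density lborel (\<lambda>z :: real ^ 'd. ennreal (limit_intensity g z))"
  have 1: "emeasure ?D (shifted C) = ennreal (exp (real CARD('d) * T - g) * p)"
    unfolding p emeasure_limit_intensity[OF C] expv.emeasure_eq_measure by (simp add: ennreal_mult')
  then have 2: "measure ?D (shifted C) = exp (real CARD('d) * T - g) * p" unfolding measure_def by (simp add: p)
  have 3: "shifted C \<in> sets borel"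
    using C(1) by (rule sets_shifted)
  from ppp have "\<forall>B\<in>sets borel. emeasure ?D B < \<infinity> \<longrightarrow>
       (let \<mu> = measure ?D B in
        \<forall>k. prob {\<omega>\<in>space N. num_points (S \<omega> \<inter> B) = enat k} = \<mu> ^ k / fact k * exp (- \<mu>))"
    unfolding poisson_point_process_def by blast
  from this[rule_format, OF 3] show ?thesis by (simp add: 1 2 Let_def)
qed

text \<open>This includes the orthant above \<open>vec T\<close>, where the intensity vanishes. A
  \<open>cell_event\<close> therefore locates all points of the process above the corner.\<close>

definition rest :: "nat \<Rightarrow> nat \<Rightarrow> (nat \<Rightarrow> 'd \<Rightarrow> int) \<Rightarrow> (real ^ 'd) set" where
  "rest n m \<alpha> = {w. dominated 0 w} - (\<Union>p<m. cell T n (\<alpha> p))"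

definition cell_event :: "nat \<Rightarrow> nat \<Rightarrow> (nat \<Rightarrow> 'd \<Rightarrow> int) \<Rightarrow> 'w set" where
  "cell_event n m \<alpha> = {\<omega> \<in> space N. (\<forall>p<m. num_points (S \<omega> \<inter> shifted (cell T n (\<alpha> p))) = 1) \<and>
     num_points (S \<omega> \<inter> shifted (rest n m \<alpha>)) = 0}"

lemma sets_rest: "rest n m \<alpha> \<in> sets borel"
  unfolding rest_def by (intro sets.Diff sets.finite_UN sets_Collect_borel sets_cell) measurable

lemma sets_cell_event: "cell_event n m \<alpha> \<in> sets N"
proof -
  have [measurable]: "(\<lambda>\<omega>. num_points (S \<omega> \<inter> shifted (cell T n (\<alpha> p)))) \<in> measurable N (count_space UNIV)"
    "(\<lambda>\<omega>. num_points (S \<omega> \<inter> shifted (rest n m \<alpha>))) \<in> measurable N (count_space UNIV)" for p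
    by (intro measurable_num_points sets_shifted sets_cell sets_rest)+
  show ?thesis unfolding cell_event_def by measurable
qed

text \<open>By independence of the counts, the exponents of the \<open>m\<close> cells and of the
  remainder add up to the total mass above the corner, so the exponential factor does not depend on
  the cells.\<close>

lemma prob_cell_event:
  assumes inj: "inj_on \<alpha> {..<m}"
  shows "prob (cell_event n m \<alpha>) = exp (- (exp (real CARD('d) * T - g) * (1 - exp (- (real CARD('d) * T))))) * exp (real CARD('d) * T - g) ^ m *
    (\<Prod>p<m. measure expv (cell T n (\<alpha> p)))"
proof -
  let ?l = "exp (real CARD('d) * T - g)" and ?e = "exp (- (real CARD('d) * T))"
  let ?w = "\<lambda>i. measure expv (cell T n (\<alpha> i))"
  \<comment> \<open>The remainder is placed at index \<open>m\<close>, so that one independence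
    statement covers all \<open>m + 1\<close> counts.\<close>
  let ?B = "\<lambda>i. shifted (if i < m then cell T n (\<alpha> i) else rest n m \<alpha>)"
  let ?c = "\<lambda>i. if i < m then 1 else 0 :: enat"
  have disj: "disjoint_family_on ?B {..<Suc m}"
  proof (unfold disjoint_family_on_def, intro ballI impI)
    fix i j assume ij: "i \<in> {..<Suc m}" "j \<in> {..<Suc m}" "i \<noteq> j"
    then consider "i < m" "j < m" | "i < m" "j = m" | "i = m" "j < m" by force
    then show "?B i \<inter> ?B j = {}"
    proof cases
      case 1
      then have "\<alpha> i \<noteq> \<alpha> j" using inj ij by (auto simp: inj_on_def)
      then show ?thesis using 1 by (auto simp: cell_def)
    qed (auto simp: rest_def)
  qed
  have B: "\<forall>i<Suc m. ?B i \<in> sets borel"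
    by (auto intro: sets_shifted sets_cell sets_rest)
  have indep: "indep_vars (\<lambda>_. count_space UNIV) (\<lambda>i \<omega>. num_points (S \<omega> \<inter> ?B i)) {..<Suc m}"
    by (rule ppp[unfolded poisson_point_process_def, THEN conjunct2, THEN conjunct2, THEN conjunct2, THEN conjunct2,
          rule_format]) (use B disj in blast)
  have "cell_event n m \<alpha> = (\<Inter>i\<in>{..<Suc m}. (\<lambda>\<omega>. num_points (S \<omega> \<inter> ?B i)) -` {?c i} \<inter> space N)"
  proof -
    have "{..<Suc m} = insert m {..<m}" by auto
    then show ?thesis unfolding cell_event_def by auto
  qed
  also have "prob \<dots> = (\<Prod>i<Suc m. prob ((\<lambda>\<omega>. num_points (S \<omega> \<inter> ?B i)) -` {?c i} \<inter> space N))"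
    by (rule indep_varsD[OF indep]) auto
  also have "\<dots> = (\<Prod>i<m. prob {\<omega> \<in> space N. num_points (S \<omega> \<inter> shifted (cell T n (\<alpha> i))) = enat 1})
      * prob {\<omega> \<in> space N. num_points (S \<omega> \<inter> shifted (rest n m \<alpha>)) = enat 0}"
  proof -
    have "(\<lambda>\<omega>. num_points (S \<omega> \<inter> B)) -` {c} \<inter> space N = {\<omega> \<in> space N. num_points (S \<omega> \<inter> B) = c}" for B c
      by auto
    then show ?thesis by (simp add: one_enat_def zero_enat_def)
  qed
  also have "(\<Prod>i<m. prob {\<omega> \<in> space N. num_points (S \<omega> \<inter> shifted (cell T n (\<alpha> i))) = enat 1})
    = (\<Prod>i<m. ?l * ?w i * exp (- (?l * ?w i)))"
  proof (rule prod.cong[OF refl])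
    fix i
    have "{w \<in> cell T n (\<alpha> i). \<not> dominated (vec T) w} = cell T n (\<alpha> i)"
      by (auto simp: cell_def)
    then show "prob {\<omega> \<in> space N. num_points (S \<omega> \<inter> shifted (cell T n (\<alpha> i))) = enat 1}
      = ?l * ?w i * exp (- (?l * ?w i))"
      by (subst prob_count[OF sets_cell _ refl]) (auto simp: cell_def)
  qed
  also have "prob {\<omega> \<in> space N. num_points (S \<omega> \<inter> shifted (rest n m \<alpha>)) = enat 0}
    = exp (- (?l * (1 - ?e - (\<Sum>i<m. ?w i))))"
  proof -
    have m1: "{w :: real ^ 'd. dominated 0 w} \<in> sets expv" "{w :: real ^ 'd. dominated (vec T) w} \<in> sets expv"
      unfolding sets_expv by (intro sets_Collect_borel; measurable)+
    have u: "expv.prob {w :: real ^ 'd. dominated (vec T) w} = ?e"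
      using emeasure_expv_upper[of "vec T :: real ^ 'd"] T by (simp add: measure_def sum_coords_def)
    have 0: "expv.prob {w :: real ^ 'd. dominated 0 w} = 1"
      using emeasure_expv_upper[of "0 :: real ^ 'd"] by (simp add: measure_def sum_coords_def)
    have sub: "{w :: real ^ 'd. dominated (vec T) w} \<subseteq> {w. dominated 0 w}"
      using T by (auto simp: dominated_def intro: less_trans)
    have un: "(\<Sum>i<m. ?w i) = measure expv (\<Union>i<m. cell T n (\<alpha> i))"
    proof (rule expv.finite_measure_finite_Union[symmetric])
      show "disjoint_family_on (\<lambda>i. cell T n (\<alpha> i)) {..<m}"
        using inj by (auto simp: disjoint_family_on_def cell_def inj_on_def)
    qed auto
    have "{w \<in> rest n m \<alpha>. \<not> dominated (vec T) w}
      = ({w. dominated 0 w} - {w. dominated (vec T) w}) - (\<Union>i<m. cell T n (\<alpha> i))"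
      by (auto simp: rest_def)
    also have "expv.prob \<dots> = 1 - ?e - (\<Sum>i<m. ?w i)"
      unfolding un 0[symmetric] u[symmetric] expv.finite_measure_Diff[OF m1 sub, symmetric]
    proof (rule expv.finite_measure_Diff)
      show "(\<Union>i<m. cell T n (\<alpha> i)) \<subseteq> {w. dominated 0 w} - {w. dominated (vec T) w}"
        by (auto simp: cell_def)
    qed (use m1 in auto)
    finally show ?thesis
      by (subst prob_count[OF sets_rest _ refl]) (auto simp: rest_def)
  qed
  finally have "prob (cell_event n m \<alpha>) =
    (\<Prod>i<m. ?l * ?w i * exp (- (?l * ?w i))) *
    exp (- (?l * (1 - ?e - (\<Sum>i<m. ?w i))))" .
  also have "(\<Prod>i<m. ?l * ?w i * exp (- (?l * ?w i)))
    = ?l ^ m * (\<Prod>i<m. ?w i) * exp (- (?l * (\<Sum>i<m. ?w i)))"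
    by (simp add: prod.distrib exp_sum[symmetric] sum_negf sum_distrib_left)
  finally show ?thesis
    by (simp add: mult.assoc exp_add[symmetric] right_diff_distrib)
qed

text \<open>Points of \<open>m\<close> distinct cells that are separated in every coordinate are ordered like their cells.\<close>

definition good :: "nat \<Rightarrow> nat \<Rightarrow> nat \<Rightarrow> (nat \<Rightarrow> 'd \<Rightarrow> int) \<Rightarrow> bool" where
  "good n m k \<alpha> \<longleftrightarrow> (\<forall>p<m. \<forall>q<m. p \<noteq> q \<longrightarrow> (\<forall>i. \<alpha> p i \<noteq> \<alpha> q i)) \<and> (\<forall>p<m. \<forall>i. \<alpha> p i \<noteq> \<lfloor>real n * T\<rfloor>) \<and>
     card {p \<in> {..<m}. (\<forall>i. \<alpha> p i < \<lfloor>real n * T\<rfloor>) \<and> (\<forall>q\<in>{..<m}. \<not> (\<forall>i. \<alpha> p i < \<alpha> q i))} = k"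

lemma good_inj: "good n m k \<alpha> \<Longrightarrow> inj_on \<alpha> {..<m}"
  unfolding good_def inj_on_def by (metis lessThan_iff)

lemma good_pattern:
  fixes w :: "'d vecs"
  assumes "\<And>p. p < m \<Longrightarrow> grid n (w p) = \<alpha> p"
    and ne: "\<And>p q i. p < m \<Longrightarrow> q < m \<Longrightarrow> p \<noteq> q \<Longrightarrow> \<alpha> p i \<noteq> \<alpha> q i" "\<And>p i. p < m \<Longrightarrow> \<alpha> p i \<noteq> \<lfloor>real n * T\<rfloor>"
  shows "{p \<in> {..<m}. (\<forall>i. \<alpha> p i < \<lfloor>real n * T\<rfloor>) \<and> (\<forall>q\<in>{..<m}. \<not> (\<forall>i. \<alpha> p i < \<alpha> q i))}
    = {p \<in> {..<m}. dominated (w p) (vec T) \<and> (\<forall>q\<in>{..<m}. \<not> dominated (w p) (w q))}"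
proof -
  have a: "\<alpha> p = (\<lambda>i. \<lfloor>real n * w p $ i\<rfloor>)" if "p < m" for p
    using assms(1)[OF that] by (simp add: grid_def)
  have 1: "(\<forall>i. \<alpha> p i < \<lfloor>real n * T\<rfloor>) \<longleftrightarrow> dominated (w p) (vec T)" if "p < m" for p
    unfolding dominated_def vec_component using ne(2)[OF that] unfolding a[OF that]
    by (simp add: floor_less_iff_of_neq)
  have 2: "(\<forall>i. \<alpha> p i < \<alpha> q i) \<longleftrightarrow> dominated (w p) (w q)" if "p < m" "q < m" for p q
  proof (cases "p = q")
    case False
    then show ?thesis
      unfolding dominated_def using ne(1)[OF that False] unfolding a[OF that(1)] a[OF that(2)]
      by (simp add: floor_less_iff_of_neq)
  qed (simp add: not_dominated_self)
  show ?thesis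
    by (intro Collect_cong conj_cong ball_cong refl arg_cong[where f = Not]) (simp_all only: lessThan_iff 1 2)
qed

lemma cell_event_points:
  assumes "\<omega> \<in> cell_event n m \<alpha>"
  obtains s where "\<And>p. p < m \<Longrightarrow> s p \<in> S \<omega> \<and> s p - corner g T \<in> cell T n (\<alpha> p)"
    "S \<omega> \<inter> {z. dominated (corner g T) z} = s ` {..<m}"
proof -
  have "\<exists>s. S \<omega> \<inter> shifted (cell T n (\<alpha> p)) = {s}" if "p < m" for p
  proof -
    have "num_points (S \<omega> \<inter> shifted (cell T n (\<alpha> p))) = 1"
      using assms that by (simp add: cell_event_def)
    then have "card (S \<omega> \<inter> shifted (cell T n (\<alpha> p))) = 1"
      by (auto simp: num_points_def one_enat_def split: if_splits)
    then show ?thesis by (rule card_1_singletonE) blast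
  qed
  then obtain s where s: "\<And>p. p < m \<Longrightarrow> S \<omega> \<inter> shifted (cell T n (\<alpha> p)) = {s p}" by metis
  have r: "S \<omega> \<inter> shifted (rest n m \<alpha>) = {}"
    using assms by (simp add: cell_event_def num_points_eq_0)
  show thesis
  proof (rule that[of s])
    show sp: "s p \<in> S \<omega> \<and> s p - corner g T \<in> cell T n (\<alpha> p)" if "p < m" for p
      using s[OF that] by auto
    show "S \<omega> \<inter> {z. dominated (corner g T) z} = s ` {..<m}"
    proof (intro equalityI subsetI)
      fix z assume z: "z \<in> S \<omega> \<inter> {z. dominated (corner g T) z}"
      then have "z - corner g T \<notin> rest n m \<alpha>" using r by auto
      then obtain p where "p < m" "z - corner g T \<in> cell T n (\<alpha> p)"
        using z by (auto simp: rest_def dominated_diff)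
      then show "z \<in> s ` {..<m}" using s[of p] z by auto
    next
      fix z assume "z \<in> s ` {..<m}"
      then obtain p where p: "p < m" "z = s p" by auto
      then show "z \<in> S \<omega> \<inter> {z. dominated (corner g T) z}"
        using sp[OF p(1)] by (auto simp: cell_def dominated_diff)
    qed
  qed
qed

definition near_maxima :: "'w \<Rightarrow> (real ^ 'd) set" where
  "near_maxima \<omega> = {y \<in> maxima (S \<omega>). dominated (corner g T) y \<and> dominated y (diag_point g)}"

text \<open>Separated cells determine how the points above the corner compare with each other and
  with \<open>diag_point g\<close>. Any point dominating one of them is above the corner too, so no
  maximum is misjudged. The third claim recovers the set of cells from the outcome and serves to
  bound how many \<open>\<alpha>\<close> an outcome can satisfy.\<close>

lemma cell_event_count:
  assumes \<omega>: "\<omega> \<in> cell_event n m \<alpha>" and good: "good n m k \<alpha>"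
  shows "num_points (near_maxima \<omega>) = enat k"
    and "num_points (S \<omega> \<inter> {z. dominated (corner g T) z}) = enat m"
    and "\<alpha> ` {..<m} = (\<lambda>z. grid n (z - corner g T)) ` (S \<omega> \<inter> {z. dominated (corner g T) z})"
proof -
  let ?c = "corner g T :: real ^ 'd"
  obtain s where s: "\<And>p. p < m \<Longrightarrow> s p \<in> S \<omega> \<and> s p - ?c \<in> cell T n (\<alpha> p)"
    and im: "S \<omega> \<inter> {z. dominated ?c z} = s ` {..<m}"
    using cell_event_points[OF \<omega>] by blast
  have gr: "grid n (s p - ?c) = \<alpha> p" if "p < m" for p
    using s[OF that] by (simp add: cell_def)
  show "\<alpha> ` {..<m} = (\<lambda>z. grid n (z - ?c)) ` (S \<omega> \<inter> {z. dominated ?c z})"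
    unfolding im image_image by (intro image_cong) (auto simp: gr)
  have inj: "inj_on s {..<m}"
  proof (rule inj_onI)
    fix p q assume pq: "p \<in> {..<m}" "q \<in> {..<m}" "s p = s q"
    then have "\<alpha> p = \<alpha> q" using gr[of p] gr[of q] by simp
    then show "p = q" using good_inj[OF good] pq by (auto simp: inj_on_def)
  qed
  show "num_points (S \<omega> \<inter> {z. dominated ?c z}) = enat m"
    unfolding im num_points_def by (simp add: card_image inj)
  let ?P = "{p \<in> {..<m}. dominated (s p - ?c) (vec T) \<and> (\<forall>q\<in>{..<m}. \<not> dominated (s p - ?c) (s q - ?c))}"
  have card: "card ?P = k"
  proof -
    have "{p \<in> {..<m}. (\<forall>i. \<alpha> p i < \<lfloor>real n * T\<rfloor>) \<and> (\<forall>q\<in>{..<m}. \<not> (\<forall>i. \<alpha> p i < \<alpha> q i))} = ?P"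
      by (rule good_pattern) (use gr good in \<open>auto simp: good_def\<close>)
    then show ?thesis using good by (simp add: good_def)
  qed
  have "near_maxima \<omega> = s ` ?P"
  proof (intro equalityI subsetI)
    fix y assume y: "y \<in> near_maxima \<omega>"
    then have yS: "y \<in> S \<omega>" "\<forall>z\<in>S \<omega>. \<not> dominated y z" "dominated ?c y" "dominated y (diag_point g)"
      by (auto simp: near_maxima_def maxima_def)
    then obtain p where p: "p < m" "y = s p" using im by blast
    have "dominated (s p - ?c) (vec T)"
      using yS(4) p by (simp add: dominated_def corner_def)
    moreover have "\<not> dominated (s p - ?c) (s q - ?c)" if "q < m" for q
      using yS(2) s[OF that] p by (auto simp: dominated_def)
    ultimately show "y \<in> s ` ?P" using p by auto
  next
    fix y assume "y \<in> s ` ?P"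
    then obtain p where p: "p < m" "y = s p" "dominated (s p - ?c) (vec T)"
      "\<And>q. q < m \<Longrightarrow> \<not> dominated (s p - ?c) (s q - ?c)" by auto
    have c: "dominated ?c y" using s[OF p(1)] p(2) by (simp add: cell_def dominated_diff)
    have "\<not> dominated y z" if z: "z \<in> S \<omega>" for z
    proof
      assume yz: "dominated y z"
      then have "dominated ?c z" using c by (auto simp: dominated_def intro: less_trans)
      then obtain q where "q < m" "z = s q" using im z by blast
      then show False using p(4)[of q] yz p(2) by (auto simp: dominated_def)
    qed
    moreover have "dominated y (diag_point g)"
      using p(2,3) by (simp add: dominated_def corner_def)
    ultimately show "y \<in> near_maxima \<omega>" using s[OF p(1)] p(2) c by (auto simp: near_maxima_def maxima_def)
  qed
  moreover have "inj_on s ?P" by (rule inj_on_subset[OF inj]) auto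
  ultimately show "num_points (near_maxima \<omega>) = enat k"
    unfolding num_points_def using card by (simp add: card_image)
qed

text \<open>With mesh \<open>1 / n\<close>, indices below \<open>n\<^sup>2\<close> cover the
  coordinates from 0 to \<open>n\<close>: finitely many cells for each \<open>n\<close>, which
  exhaust the positive orthant as \<open>n\<close> grows. Extensionality makes distinct
  \<open>\<alpha>\<close> differ on \<open>{..<m}\<close>.\<close>

definition goods :: "nat \<Rightarrow> nat \<Rightarrow> nat \<Rightarrow> (nat \<Rightarrow> 'd \<Rightarrow> int) set" where
  "goods n m k = {\<alpha> \<in> {..<m} \<rightarrow>\<^sub>E {a. \<forall>i. a i \<in> {0..<int (n\<^sup>2)}}. good n m k \<alpha>}"

lemma finite_goods: "finite (goods n m k)"
proof -
  have "{a :: 'd \<Rightarrow> int. \<forall>i. a i \<in> {0..<int (n\<^sup>2)}} = (\<Pi>\<^sub>E i\<in>UNIV. {0..<int (n\<^sup>2)})"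
    by auto
  then have "finite {a :: 'd \<Rightarrow> int. \<forall>i. a i \<in> {0..<int (n\<^sup>2)}}"
    by (simp add: finite_PiE)
  then have "finite ({..<m} \<rightarrow>\<^sub>E {a :: 'd \<Rightarrow> int. \<forall>i. a i \<in> {0..<int (n\<^sup>2)}})"
    by (intro finite_PiE) simp_all
  then show ?thesis by (rule finite_subset[rotated]) (unfold goods_def, blast)
qed

text \<open>All \<open>\<alpha>\<close> compatible with one outcome enumerate the same set of
  \<open>m\<close> cells, hence differ by a permutation. This is the source of the \<open>m!\<close>
  in the Poisson weight.\<close>

lemma card_goods_cell_event: "card {\<alpha> \<in> goods n m k. \<omega> \<in> cell_event n m \<alpha>} \<le> fact m"
proof -
  let ?G = "{\<alpha> \<in> goods n m k. \<omega> \<in> cell_event n m \<alpha>}"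
  define A where "A = (\<lambda>z. grid n (z - corner g T)) ` (S \<omega> \<inter> {z. dominated (corner g T) z})"
  have im: "\<alpha> ` {..<m} = A" "inj_on \<alpha> {..<m}" if "\<alpha> \<in> ?G" for \<alpha>
    using that cell_event_count(3)[of \<omega> n m \<alpha> k] good_inj by (auto simp: goods_def A_def)
  show ?thesis
  proof (cases "?G = {}")
    case False
    then obtain \<alpha> where "\<alpha> \<in> ?G" by blast
    from im[OF this] have A: "finite A" "card A = m" using card_image by fastforce+
    have "card ?G \<le> card (permutations_of_set A)"
    proof (rule card_inj_on_le)
      show "inj_on (\<lambda>\<alpha>. map \<alpha> [0..<m]) ?G"
      proof (rule inj_onI)
        fix \<alpha> \<beta> assume ab: "\<alpha> \<in> ?G" "\<beta> \<in> ?G" "map \<alpha> [0..<m] = map \<beta> [0..<m]"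
        then have "\<alpha> p = \<beta> p" if "p < m" for p using that by (simp add: list_eq_iff_nth_eq)
        moreover have "\<alpha> \<in> {..<m} \<rightarrow>\<^sub>E {a. \<forall>i. a i \<in> {0..<int (n\<^sup>2)}}"
          "\<beta> \<in> {..<m} \<rightarrow>\<^sub>E {a. \<forall>i. a i \<in> {0..<int (n\<^sup>2)}}"
          using ab(1,2) unfolding goods_def by blast+
        ultimately show "\<alpha> = \<beta>" by (intro PiE_ext) auto
      qed
      show "(\<lambda>\<alpha>. map \<alpha> [0..<m]) ` ?G \<subseteq> permutations_of_set A"
        using im by (auto simp: permutations_of_set_def distinct_map atLeast0LessThan)
    qed simp
    also have "\<dots> = fact m" using A by simp
    finally show ?thesis .
  next
    case True
    then show ?thesis by (simp only: card.empty le0)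
  qed
qed

text \<open>The left side is the expected number of good cell events that occur; this number
  vanishes off the event on the right and is at most \<open>m!\<close> on it.\<close>

lemma sum_prob_cell_event:
  "(\<Sum>\<alpha>\<in>goods n m k. prob (cell_event n m \<alpha>)) \<le> fact m *
     prob {\<omega> \<in> space N. num_points (near_maxima \<omega>) = enat k \<and> num_points (S \<omega> \<inter> {z. dominated (corner g T) z}) = enat m}"
proof -
  let ?G = "{\<omega> \<in> space N. num_points (near_maxima \<omega>) = enat k \<and> num_points (S \<omega> \<inter> {z. dominated (corner g T) z}) = enat m}"
  have G: "?G \<in> sets N"
  proof -
    have "Measurable.pred N (\<lambda>\<omega>. num_points (near_maxima \<omega>) = enat k)"
      unfolding near_maxima_def by (rule measurable_maxima_eq) measurable
    moreover have "{z. dominated (corner g T) z} \<in> sets borel"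
      by (rule sets_Collect_borel) measurable
    note measurable_num_points[OF this]
    ultimately show ?thesis by measurable
  qed
  have "(\<Sum>\<alpha>\<in>goods n m k. prob (cell_event n m \<alpha>)) = (\<integral>\<omega>. (\<Sum>\<alpha>\<in>goods n m k. indicator (cell_event n m \<alpha>) \<omega>) \<partial>N)"
    using sets_cell_event by (subst Bochner_Integration.integral_sum) (auto simp: emeasure_eq_measure)
  also have "\<dots> \<le> (\<integral>\<omega>. fact m * indicator ?G \<omega> \<partial>N)"
  proof (rule integral_mono)
    fix \<omega> assume \<omega>: "\<omega> \<in> space N"
    have "(\<Sum>\<alpha>\<in>goods n m k. indicator (cell_event n m \<alpha>) \<omega> :: real) = real (card {\<alpha> \<in> goods n m k. \<omega> \<in> cell_event n m \<alpha>})"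
      using finite_goods by (simp add: indicator_def sum.If_cases Int_def)
    also have "\<dots> \<le> fact m * indicator ?G \<omega>"
    proof (cases "\<omega> \<in> ?G")
      case True
      then show ?thesis
        using of_nat_mono[OF card_goods_cell_event[of n m k \<omega>], where 'a = real] by (simp only: of_nat_fact indicator_simps(1) mult_1_right)
    next
      case False
      then have "{\<alpha> \<in> goods n m k. \<omega> \<in> cell_event n m \<alpha>} = {}"
        using cell_event_count(1,2) \<omega> by (auto simp: goods_def)
      then show ?thesis by (simp only: card.empty) simp
    qed
    finally show "(\<Sum>\<alpha>\<in>goods n m k. indicator (cell_event n m \<alpha>) \<omega> :: real) \<le> fact m * indicator ?G \<omega>" .
  qed (use sets_cell_event G in \<open>auto simp: emeasure_eq_measure\<close>)
  also have "\<dots> = fact m * prob ?G" using G by simp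
  finally show ?thesis .
qed

end

section \<open>The law of the number of nearby dominated maxima\<close>

lemma emeasure_expv_coord: "emeasure expv {w :: real ^ 'd::finite. w $ i = c} = 0"
proof -
  have "{w :: real ^ 'd. w $ i = c} = {w. \<forall>j. w $ j \<in> (if j = i then {c} else UNIV)}" by auto
  also have "emeasure expv \<dots> = (\<Prod>j\<in>UNIV. emeasure (density lborel (exponential_density 1)) (if j = i then {c} else UNIV))"
    by (rule emeasure_expv_box) auto
  also have "\<dots> = 0"
  proof (rule prod_zero)
    have "emeasure (density lborel (exponential_density 1)) {c} = 0"
      using nn_integral_null_set[of "{c}" lborel "\<lambda>x. ennreal (exponential_density 1 x)"]
      by (simp add: emeasure_density null_sets_def)
    then show "\<exists>j\<in>UNIV. emeasure (density lborel (exponential_density 1)) (if j = i then {c} else UNIV) = 0"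
      by (intro bexI[of _ i]) auto
  qed simp
  finally show ?thesis .
qed

lemma AE_expv_coord: "AE w in (expv :: (real ^ 'd::finite) measure). w $ i \<noteq> c"
  by (rule AE_I[of _ _ "{w. w $ i = c}"]) (auto simp: emeasure_expv_coord intro!: sets_Collect_borel)

lemma AE_expv_seq_component:
  assumes "AE w in (expv :: (real ^ 'd::finite) measure). P w" "p \<in> I" "finite I"
  shows "AE z in expv_seq I. P (z p)"
  using assms by (intro AE_PiM_component) (auto intro: expv.prob_space_axioms)

lemma AE_expv_seq_distinct:
  assumes pq: "p \<in> I" "q \<in> I" "p \<noteq> q" and I: "finite I"
  shows "AE z in (expv_seq I :: 'd::finite vecs measure). z p $ i \<noteq> z q $ i"
proof -
  have m: "(\<lambda>x. x p $ i - x q $ i) \<in> borel_measurable (expv_seq I :: 'd vecs measure)"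
    using pq by (intro borel_measurable_diff borel_measurable_nth measurable_expv_component)
  let ?f = "\<lambda>z :: 'd vecs. of_bool (z p $ i = z q $ i) :: ennreal"
  have f: "?f \<in> borel_measurable (expv_seq I)"
  proof -
    have "(\<lambda>t :: real. of_bool (t = 0) :: ennreal) \<in> borel_measurable borel" by measurable
    from measurable_compose[OF m this] show ?thesis by simp
  qed
  have ins: "I = insert q (I - {q})" using pq by auto
  have "(\<integral>\<^sup>+z. ?f z \<partial>expv_seq I) = (\<integral>\<^sup>+x. \<integral>\<^sup>+y. ?f (x(q := y)) \<partial>expv \<partial>expv_seq (I - {q}))"
    by (subst ins, rule expv_PiM.product_nn_integral_insert) (use I f ins in auto)
  also have "\<dots> = (\<integral>\<^sup>+x. 0 \<partial>(expv_seq (I - {q}) :: 'd vecs measure))"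
  proof (rule nn_integral_cong)
    fix x :: "'d vecs"
    have "(\<integral>\<^sup>+y. of_bool (y $ i = x p $ i) \<partial>(expv :: (real ^ 'd) measure)) = 0"
      by (subst nn_integral_of_bool) (auto simp: emeasure_expv_coord)
    then show "(\<integral>\<^sup>+y. ?f (x(q := y)) \<partial>expv) = 0"
      using pq by (simp add: eq_commute[of "x p $ i"])
  qed
  finally have "(\<integral>\<^sup>+z. ?f z \<partial>expv_seq I) = 0" by simp
  then have "AE z in expv_seq I. ?f z = 0"
    using nn_integral_0_iff_AE[OF f] by simp
  then show ?thesis by eventually_elim auto
qed

text \<open>Not a probability distribution in \<open>m\<close>: the exponent is the total mass above
  the corner, whereas the power is that of the full \<open>exp (d T - g)\<close>. The missing power
  of \<open>1 - exp (- d T)\<close> is the probability that no point dominates \<open>vec T\<close>,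
  and it is contained in \<open>low_prob\<close>.\<close>

definition poisson_weight :: "'d::finite itself \<Rightarrow> real \<Rightarrow> real \<Rightarrow> nat \<Rightarrow> real" where
  "poisson_weight _ T g m = exp (- (exp (real CARD('d) * T - g) * (1 - exp (- (real CARD('d) * T)))))
     * exp (real CARD('d) * T - g) ^ m / fact m"

lemma poisson_weight_nonneg: "0 \<le> poisson_weight TYPE('d::finite) T g m"
  by (simp add: poisson_weight_def)

text \<open>The differences \<open>p k - b k\<close> are nonnegative and their sum is at most
  \<open>1 - 1\<close>. This turns one-sided bounds on a distribution into equalities.\<close>

lemma ennreal_eq_if_suminf_eq_1:
  fixes b :: "nat \<Rightarrow> ennreal" and p :: "nat \<Rightarrow> real"
  assumes le: "\<And>k. b k \<le> ennreal (p k)" and b: "(\<Sum>k. b k) = 1"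
    and p: "\<And>k. 0 \<le> p k" "\<And>n. (\<Sum>k<n. p k) \<le> 1"
  shows "b k = ennreal (p k)"
proof -
  have sp: "(\<Sum>k. ennreal (p k)) \<le> 1"
    by (rule suminf_le_const) (use p in \<open>auto simp: sum_ennreal\<close>)
  then have fin: "(\<Sum>k. ennreal (p k)) < \<top>" by (rule le_less_trans) simp
  have "(\<integral>\<^sup>+k. ennreal (p k) - b k \<partial>count_space UNIV)
     = (\<integral>\<^sup>+k. ennreal (p k) \<partial>count_space UNIV) - (\<integral>\<^sup>+k. b k \<partial>count_space UNIV)"
    by (rule nn_integral_diff) (use le b in \<open>auto simp: nn_integral_count_space_nat\<close>)
  also have "\<dots> = 0"
    using sp fin b by (simp add: nn_integral_count_space_nat diff_eq_0_iff_ennreal)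
  finally have "ennreal (p k) - b k = 0"
    by (simp add: nn_integral_0_iff_AE AE_count_space)
  then show ?thesis using le[of k] by (simp add: diff_eq_0_iff_ennreal order_antisym)
qed

lemma suminf_of_bool_eq: "(\<Sum>k. of_bool (j = k) :: ennreal) = 1"
  using suminf_finite[of "{j}" "\<lambda>k. of_bool (j = k) :: ennreal"] by auto

lemma suminf_low_integral:
  "(\<Sum>k. low_prob TYPE('d::finite) T k m) = low_integral TYPE('d) T (\<lambda>_. 1) m"
proof -
  have "(\<Sum>k. low_prob TYPE('d) T k m)
    = (\<integral>\<^sup>+z. (\<Sum>k. of_bool (below T {..<m} z) * of_bool (num_low T {..<m} z = k)) \<partial>(expv_seq {..<m} :: 'd vecs measure))"
    unfolding low_integral_def
    using measurable_below_num_low[of "{..<m}" T]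
    by (subst nn_integral_suminf) (auto simp: finite_lessThan)
  also have "\<dots> = low_integral TYPE('d) T (\<lambda>_. 1) m"
    unfolding low_integral_def by (simp only: ennreal_suminf_cmult suminf_of_bool_eq)
  finally show ?thesis .
qed

text \<open>Summing over \<open>k\<close> first leaves \<open>r ^ m\<close>, and
  \<open>l * r\<close> is the mass above the corner, so the outer sum runs over a genuine Poisson
  distribution.\<close>

lemma suminf_poisson_low_integral:
  assumes "0 \<le> T"
  shows "(\<Sum>k. \<Sum>m. ennreal (poisson_weight TYPE('d::finite) T g m) * low_prob TYPE('d) T k m) = 1"
proof -
  let ?w = "\<lambda>m. ennreal (poisson_weight TYPE('d) T g m)"
  let ?l = "\<lambda>k m. low_prob TYPE('d) T k m"
  define r where "r = 1 - exp (- (real CARD('d) * T))"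
  define l where "l = exp (real CARD('d) * T - g)"
  have r: "0 \<le> r" using assms by (simp add: r_def)
  have "(\<Sum>k. \<Sum>m. ?w m * ?l k m) = (\<integral>\<^sup>+m. (\<Sum>k. ?w m * ?l k m) \<partial>count_space UNIV)"
    by (subst nn_integral_suminf) (auto simp: nn_integral_count_space_nat)
  also have "\<dots> = (\<Sum>m. ?w m * ennreal (r ^ m))"
    by (simp add: nn_integral_count_space_nat suminf_low_integral low_integral_const[OF assms] r_def ennreal_suminf_cmult)
  also have "\<dots> = (\<Sum>m. ennreal (exp (- (l * r)) * ((l * r) ^ m / fact m)))"
    by (subst ennreal_mult'[OF poisson_weight_nonneg, symmetric])
      (simp add: poisson_weight_def l_def r_def power_mult_distrib mult.assoc)
  also have "\<dots> = ennreal (exp (- (l * r)) * exp (l * r))"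
  proof (rule suminf_ennreal_eq)
    have "(\<lambda>m. (l * r) ^ m /\<^sub>R fact m) sums exp (l * r)" by (rule exp_converges)
    then have "(\<lambda>m. (l * r) ^ m / fact m) sums exp (l * r)" by (simp add: divide_inverse mult.commute)
    then show "(\<lambda>m. exp (- (l * r)) * ((l * r) ^ m / fact m)) sums (exp (- (l * r)) * exp (l * r))"
      by (rule sums_mult)
    show "0 \<le> exp (- (l * r)) * ((l * r) ^ m / fact m)" for m
      using r by (simp add: l_def)
  qed
  also have "\<dots> = 1" by (simp add: exp_add[symmetric])
  finally show ?thesis .
qed

context limit_process
begin

text \<open>Finitely many distinct reals have different floors once the mesh is fine enough, and
  \<open>n\<close> eventually exceeds every coordinate.\<close>

lemma eventually_cell:
  fixes z :: "'d vecs"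
  assumes z: "z \<in> extensional {..<m}" and pos: "\<And>p. p < m \<Longrightarrow> dominated 0 (z p)"
    and ne: "\<And>p q i. p < m \<Longrightarrow> q < m \<Longrightarrow> p \<noteq> q \<Longrightarrow> z p $ i \<noteq> z q $ i" "\<And>p i. p < m \<Longrightarrow> z p $ i \<noteq> T"
    and below: "below T {..<m} z" and low: "num_low T {..<m} z = k"
  shows "\<forall>\<^sub>F n in sequentially. z \<in> (\<Union>\<alpha>\<in>goods n m k. \<Pi>\<^sub>E p\<in>{..<m}. cell T n (\<alpha> p))"
proof -
  have "\<forall>\<^sub>F n in sequentially. \<forall>p\<in>{..<m}. \<forall>i\<in>UNIV. z p $ i < real n"
    by (intro eventually_ball_finite ballI eventually_compose_filterlim[OF eventually_gt_at_top filterlim_real_sequentially]) auto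
  moreover have "\<forall>\<^sub>F n in sequentially. \<forall>p\<in>{..<m}. \<forall>q\<in>{..<m} - {p}. \<forall>i\<in>UNIV. \<lfloor>real n * z p $ i\<rfloor> \<noteq> \<lfloor>real n * z q $ i\<rfloor>"
    using ne by (intro eventually_ball_finite ballI eventually_floor_neq) auto
  moreover have "\<forall>\<^sub>F n in sequentially. \<forall>p\<in>{..<m}. \<forall>i\<in>UNIV. \<lfloor>real n * z p $ i\<rfloor> \<noteq> \<lfloor>real n * T\<rfloor>"
    using ne by (intro eventually_ball_finite ballI eventually_floor_neq) auto
  ultimately show ?thesis
    using eventually_gt_at_top[of 0]
  proof eventually_elim
    case (elim n)
    let ?\<alpha> = "\<lambda>p\<in>{..<m}. grid n (z p)"
    have "grid n (z p) i \<in> {0..<int (n\<^sup>2)}" if "p < m" for p i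
    proof -
      have "0 < z p $ i" "z p $ i < real n" using pos[OF that] elim(1) that by (auto simp: dominated_def)
      then have "0 \<le> real n * z p $ i" "real n * z p $ i < real n * real n"
        using elim(4) by (auto intro: mult_nonneg_nonneg)
      then show ?thesis by (simp add: grid_def floor_less_iff power2_eq_square)
    qed
    then have "?\<alpha> \<in> {..<m} \<rightarrow>\<^sub>E {a. \<forall>i. a i \<in> {0..<int (n\<^sup>2)}}" by auto
    moreover have "good n m k ?\<alpha>"
    proof -
      have 1: "?\<alpha> p i \<noteq> ?\<alpha> q i" if "p < m" "q < m" "p \<noteq> q" for p q i
        using elim(2) that by (auto simp: grid_def)
      have 2: "?\<alpha> p i \<noteq> \<lfloor>real n * T\<rfloor>" if "p < m" for p i
        using elim(3) that by (auto simp: grid_def)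
      have "{p \<in> {..<m}. (\<forall>i. ?\<alpha> p i < \<lfloor>real n * T\<rfloor>) \<and> (\<forall>q\<in>{..<m}. \<not> (\<forall>i. ?\<alpha> p i < ?\<alpha> q i))}
        = {p \<in> {..<m}. dominated (z p) (vec T) \<and> (\<forall>q\<in>{..<m}. \<not> dominated (z p) (z q))}"
        by (rule good_pattern) (use 1 2 in auto)
      then show ?thesis using 1 2 low unfolding good_def num_low_def by simp
    qed
    ultimately have "?\<alpha> \<in> goods n m k" by (simp add: goods_def)
    moreover have "z \<in> (\<Pi>\<^sub>E p\<in>{..<m}. cell T n (?\<alpha> p))"
      using z pos below by (auto simp: PiE_iff cell_def below_def)
    ultimately show ?case by blast
  qed
qed

abbreviation (input) count_event :: "nat \<Rightarrow> nat \<Rightarrow> 'w set" where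
  "count_event k m \<equiv> {\<omega> \<in> space N. num_points (near_maxima \<omega>) = enat k \<and>
     num_points (S \<omega> \<inter> {z. dominated (corner g T) z}) = enat m}"

text \<open>Almost every configuration counted by \<open>low_prob\<close> eventually lies in a
  product of good cells. The measure of the union of these products is bounded, uniformly in the
  mesh, by comparison with the probabilities of the corresponding cell events.\<close>

lemma low_integral_le:
  "ennreal (poisson_weight TYPE('d) T g m) * low_prob TYPE('d) T k m
    \<le> ennreal (prob (count_event k m))"
proof -
  let ?l = "exp (real CARD('d) * T - g)"
  let ?e = "exp (- (?l * (1 - exp (- (real CARD('d) * T)))))"
  \<comment> \<open>Chosen so that \<open>poisson_weight\<close> times \<open>c\<close> is exactly
    the probability of \<open>count_event k m\<close>.\<close>
  define c where "c = fact m * prob (count_event k m) / (?e * ?l ^ m)"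
  have c0: "0 \<le> c" by (simp add: c_def)
  let ?V = "\<lambda>n. \<Union>\<alpha>\<in>goods n m k. \<Pi>\<^sub>E p\<in>{..<m}. cell T n (\<alpha> p)"
  let ?M = "expv_seq {..<m} :: 'd vecs measure"
  have cells: "(\<Pi>\<^sub>E p\<in>{..<m}. cell T n (\<alpha> p)) \<in> sets ?M" for n \<alpha>
    by (rule sets_PiM_I_finite) auto
  then have V: "?V n \<in> sets ?M" for n
    using finite_goods by (intro sets.finite_UN) auto
  have emV: "emeasure ?M (?V n) \<le> ennreal c" for n
  proof -
    have "emeasure ?M (?V n) \<le> (\<Sum>\<alpha>\<in>goods n m k. emeasure ?M (\<Pi>\<^sub>E p\<in>{..<m}. cell T n (\<alpha> p)))"
      using cells finite_goods by (intro emeasure_subadditive_finite) auto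
    also have "\<dots> = (\<Sum>\<alpha>\<in>goods n m k. ennreal (\<Prod>p<m. measure expv (cell T n (\<alpha> p))))"
      by (intro sum.cong refl) (simp add: expv_PiM.emeasure_PiM expv.emeasure_eq_measure prod_ennreal)
    also have "\<dots> = ennreal (\<Sum>\<alpha>\<in>goods n m k. \<Prod>p<m. measure expv (cell T n (\<alpha> p)))"
      by (rule sum_ennreal) (auto intro: prod_nonneg)
    also have "\<dots> \<le> ennreal c"
    proof (rule ennreal_leI)
      have "(\<Sum>\<alpha>\<in>goods n m k. ?e * ?l ^ m * (\<Prod>p<m. measure expv (cell T n (\<alpha> p))))
        = (\<Sum>\<alpha>\<in>goods n m k. prob (cell_event n m \<alpha>))"
        by (intro sum.cong refl prob_cell_event[symmetric]) (auto simp: goods_def intro: good_inj)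
      also have "\<dots> \<le> fact m * prob (count_event k m)" by (rule sum_prob_cell_event)
      also have "(\<Sum>\<alpha>\<in>goods n m k. ?e * ?l ^ m * (\<Prod>p<m. measure expv (cell T n (\<alpha> p))))
        = (\<Sum>\<alpha>\<in>goods n m k. \<Prod>p<m. measure expv (cell T n (\<alpha> p))) * (?e * ?l ^ m)"
        by (subst mult.commute) (rule sum_distrib_left[symmetric])
      finally have "(\<Sum>\<alpha>\<in>goods n m k. \<Prod>p<m. measure expv (cell T n (\<alpha> p))) * (?e * ?l ^ m) \<le> fact m * prob (count_event k m)" .
      then show "(\<Sum>\<alpha>\<in>goods n m k. \<Prod>p<m. measure expv (cell T n (\<alpha> p))) \<le> c"
        unfolding c_def by (subst pos_le_divide_eq) auto
    qed
    finally show ?thesis .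
  qed
  have fin: "finite {..<m}" by simp
  have ae: "AE z in ?M. (\<forall>p\<in>{..<m}. dominated 0 (z p)) \<and> (\<forall>p\<in>{..<m}. \<forall>q\<in>{..<m} - {p}. \<forall>i\<in>UNIV. z p $ i \<noteq> z q $ i)
     \<and> (\<forall>p\<in>{..<m}. \<forall>i\<in>UNIV. z p $ i \<noteq> T)"
    unfolding AE_conj_iff
    by (intro conjI AE_finite_allI fin finite finite_Diff AE_expv_seq_component[OF AE_expv_pos]
        AE_expv_seq_component[OF AE_expv_coord] AE_expv_seq_distinct) auto
  have "low_prob TYPE('d) T k m \<le> (\<integral>\<^sup>+z. liminf (\<lambda>n. indicator (?V n) z) \<partial>?M)"
    unfolding low_integral_def
  proof (rule nn_integral_mono_AE)
    show "AE z in ?M. of_bool (below T {..<m} z) * of_bool (num_low T {..<m} z = k) \<le> liminf (\<lambda>n. indicator (?V n) z :: ennreal)"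
      using ae AE_space[of ?M]
    proof eventually_elim
      case (elim z)
      show ?case
      proof (cases "below T {..<m} z \<and> num_low T {..<m} z = k")
        case True
        have "\<forall>\<^sub>F n in sequentially. z \<in> ?V n"
          by (rule eventually_cell) (use elim True in \<open>auto simp: space_PiM PiE_iff\<close>)
        then have "\<forall>\<^sub>F n in sequentially. 1 \<le> (indicator (?V n) z :: ennreal)"
          by eventually_elim (simp only: indicator_simps order_refl)
        then have "1 \<le> liminf (\<lambda>n. indicator (?V n) z :: ennreal)" by (rule Liminf_bounded)
        then show ?thesis using True by simp
      qed auto
    qed
  qed
  \<comment> \<open>The grids for successive \<open>n\<close> are not nested, so Fatou's lemma takes
    the place of monotone convergence.\<close>
  also have "\<dots> \<le> liminf (\<lambda>n. \<integral>\<^sup>+z. indicator (?V n) z \<partial>?M)"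
    using V by (intro nn_integral_liminf) auto
  also have "\<dots> \<le> limsup (\<lambda>n. \<integral>\<^sup>+z. indicator (?V n) z \<partial>?M)"
    by (rule Liminf_le_Limsup) simp
  also have "\<dots> \<le> ennreal c"
    by (rule Limsup_bounded) (use emV V in auto)
  finally have "ennreal (poisson_weight TYPE('d) T g m) * low_prob TYPE('d) T k m
      \<le> ennreal (poisson_weight TYPE('d) T g m) * ennreal c"
    by (rule mult_left_mono) simp
  also have "\<dots> = ennreal (poisson_weight TYPE('d) T g m * c)"
    by (rule ennreal_mult'[symmetric]) (rule poisson_weight_nonneg)
  also have "poisson_weight TYPE('d) T g m * c = prob (count_event k m)"
    by (simp add: poisson_weight_def c_def)
  finally show ?thesis .
qed

lemma measurable_near_maxima: "Measurable.pred N (\<lambda>\<omega>. num_points (near_maxima \<omega>) = enat k)"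
  unfolding near_maxima_def by (rule measurable_maxima_eq) measurable

text \<open>The events for different \<open>m\<close> are disjoint, so the lower bounds add up.
  Infinite counts could only make the total over \<open>k\<close> on the left smaller than one,
  whereas the total on the right is one; comparing the totals forces equality for each
  \<open>k\<close>.\<close>

lemma prob_near_maxima:
  "ennreal (prob {\<omega> \<in> space N. num_points (near_maxima \<omega>) = enat k})
    = (\<Sum>m. ennreal (poisson_weight TYPE('d) T g m) * low_prob TYPE('d) T k m)"
proof -
  let ?A = "\<lambda>k. {\<omega> \<in> space N. num_points (near_maxima \<omega>) = enat k}"
  let ?b = "\<lambda>k m. ennreal (poisson_weight TYPE('d) T g m) * low_prob TYPE('d) T k m"
  note [measurable] = measurable_near_maxima
  have q: "{z :: real ^ 'd. dominated (corner g T) z} \<in> sets borel"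
    by (rule sets_Collect_borel) measurable
  note [measurable] = measurable_num_points[OF q]
  have le: "(\<Sum>m. ?b k m) \<le> ennreal (prob (?A k))" for k
  proof (rule suminf_le_const)
    fix n
    have "(\<Sum>m<n. ?b k m)
      \<le> (\<Sum>m<n. ennreal (prob (count_event k m)))"
      by (intro sum_mono low_integral_le)
    also have "\<dots> = ennreal (\<Sum>m<n. prob (count_event k m))" by (rule sum_ennreal) simp
    also have "(\<Sum>m<n. prob (count_event k m)) = prob (\<Union>m<n. count_event k m)"
      by (rule finite_measure_finite_Union[symmetric]) (auto simp: disjoint_family_on_def)
    also have "ennreal \<dots> \<le> ennreal (prob (?A k))"
      by (intro ennreal_leI finite_measure_mono) auto
    finally show "(\<Sum>m<n. ?b k m) \<le> ennreal (prob (?A k))" .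
  qed simp
  have "(\<Sum>k<n. prob (?A k)) \<le> 1" for n
  proof -
    have "(\<Sum>k<n. prob (?A k)) = prob (\<Union>k<n. ?A k)"
      by (rule finite_measure_finite_Union[symmetric]) (auto simp: disjoint_family_on_def)
    then show ?thesis by simp
  qed
  then show ?thesis
    by (intro ennreal_eq_if_suminf_eq_1[OF le suminf_poisson_low_integral, symmetric]) (use T in auto)
qed

end

section \<open>Integration against the Gumbel density\<close>

lemma nn_integral_real_line_FTC:
  fixes F f :: "real \<Rightarrow> real"
  assumes deriv: "\<And>x. (F has_real_derivative f x) (at x)" and cont: "\<And>x. isCont f x"
    and nonneg: "\<And>x. 0 \<le> f x"
    and bot: "(F \<longlongrightarrow> a) at_bot" and top: "(F \<longlongrightarrow> b) at_top"
  shows "(\<integral>\<^sup>+x. ennreal (f x) \<partial>lborel) = ennreal (b - a)"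
proof -
  have e: "einterval (- \<infinity>) \<infinity> = (UNIV :: real set)" by (auto simp: einterval_def)
  note FTC = interval_integral_FTC_nonneg[of "- \<infinity>" \<infinity> F f a b]
  have A: "((F \<circ> real_of_ereal) \<longlongrightarrow> a) (at_right (- \<infinity>))" "((F \<circ> real_of_ereal) \<longlongrightarrow> b) (at_left \<infinity>)"
    using bot top by (simp_all add: ereal_tendsto_simps1)
  have "set_integrable lborel (einterval (- \<infinity>) \<infinity>) f" "(LBINT x=- \<infinity>..\<infinity>. f x) = b - a"
    using FTC A deriv cont nonneg by auto
  then have "integrable lborel f" "(\<integral>x. f x \<partial>lborel) = b - a"
    by (simp_all add: e set_integrable_def interval_lebesgue_integral_def set_lebesgue_integral_def)
  then show ?thesis using nonneg by (subst nn_integral_eq_integral) auto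
qed

text \<open>With \<open>l = exp (c - g)\<close> the Gumbel factor completes the exponent to
  \<open>- l\<close>, and the change of variable produces the density
  \<open>l ^ m / m! * exp (- l)\<close>, of total mass one.\<close>

lemma nn_integral_poisson_gumbel:
  "(\<integral>\<^sup>+g. ennreal (poisson_weight TYPE('d::finite) T g m) * ennreal (gumbel_density g) \<partial>lborel)
    = ennreal (exp (- (real CARD('d) * T)))"
proof -
  define c where "c = real CARD('d) * T"
  \<comment> \<open>The probability that a Poisson variable of mean \<open>l\<close> is at most
    \<open>m\<close>, a primitive of minus the Gamma density; it decreases from 1 at
    \<open>l = 0\<close> to 0 at infinity.\<close>
  define Q where "Q = (\<lambda>m l :: real. exp (- l) * (\<Sum>j\<le>m. l ^ j / fact j))"
  have dQ: "(Q m has_real_derivative - (l ^ m / fact m * exp (- l))) (at l)" for m l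
  proof (induction m)
    case 0
    show ?case unfolding Q_def by (rule derivative_eq_intros refl | simp)+
  next
    case (Suc m)
    have eq: "Q (Suc m) = (\<lambda>l. Q m l + exp (- l) * (l ^ Suc m / fact (Suc m)))"
      by (simp add: Q_def fun_eq_iff algebra_simps)
    have d: "((\<lambda>l. l ^ Suc m / fact (Suc m)) has_real_derivative l ^ m / fact m) (at l)"
      by (rule derivative_eq_intros refl | simp add: divide_simps)+
    have "((\<lambda>l. exp (- l)) has_real_derivative - exp (- l)) (at l)"
      by (rule derivative_eq_intros refl | simp)+
    from DERIV_add[OF Suc DERIV_mult[OF this d]] show ?case
      unfolding eq by (rule DERIV_cong) (simp add: algebra_simps del: fact_Suc)
  qed
  have "(\<integral>\<^sup>+g. ennreal (poisson_weight TYPE('d) T g m) * ennreal (gumbel_density g) \<partial>lborel)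
    = (\<integral>\<^sup>+g. ennreal (exp (- c) * (exp (c - g) ^ m / fact m * exp (- exp (c - g)) * exp (c - g))) \<partial>lborel)"
  proof (rule nn_integral_cong)
    fix g :: real
    have "exp (c - g) * exp (- c) = exp (- g)" by (simp add: exp_add[symmetric])
    then have e1: "exp (- (exp (c - g) * (1 - exp (- c)))) * exp (- exp (- g)) = exp (- exp (c - g))"
      by (simp add: exp_add[symmetric] right_diff_distrib)
    have e2: "exp (- g) = exp (- c) * exp (c - g)" by (simp add: exp_add[symmetric])
    have "poisson_weight TYPE('d) T g m * gumbel_density g
      = (exp (- (exp (c - g) * (1 - exp (- c)))) * exp (- exp (- g))) * (exp (c - g) ^ m / fact m) * exp (- g)"
      unfolding poisson_weight_def gumbel_density_def c_def[symmetric] by (simp add: mult_ac)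
    also have "\<dots> = exp (- c) * (exp (c - g) ^ m / fact m * exp (- exp (c - g)) * exp (c - g))"
      unfolding e1 by (subst e2) (simp only: mult_ac)
    finally have "poisson_weight TYPE('d) T g m * gumbel_density g
      = exp (- c) * (exp (c - g) ^ m / fact m * exp (- exp (c - g)) * exp (c - g))" .
    then show "ennreal (poisson_weight TYPE('d) T g m) * ennreal (gumbel_density g)
      = ennreal (exp (- c) * (exp (c - g) ^ m / fact m * exp (- exp (c - g)) * exp (c - g)))"
      by (simp add: ennreal_mult'[OF poisson_weight_nonneg, symmetric])
  qed
  also have "\<dots> = ennreal (exp (- c) * 1 - 0)"
  proof (rule nn_integral_real_line_FTC[where F = "\<lambda>g. exp (- c) * Q m (exp (c - g))"])
    fix g :: real
    have "((\<lambda>g. exp (c - g)) has_real_derivative - exp (c - g)) (at g)"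
      by (rule derivative_eq_intros refl | simp)+
    note DERIV_chain2[OF dQ this, of m]
    from DERIV_cmult[OF this, of "exp (- c)"]
    show "((\<lambda>g. exp (- c) * Q m (exp (c - g))) has_real_derivative
        exp (- c) * (exp (c - g) ^ m / fact m * exp (- exp (c - g)) * exp (c - g))) (at g)"
      by (rule DERIV_cong) simp
    show "isCont (\<lambda>g. exp (- c) * (exp (c - g) ^ m / fact m * exp (- exp (c - g)) * exp (c - g))) g"
      by (intro continuous_intros) auto
  next
    have "filterlim (\<lambda>g :: real. c - g) at_top at_bot"
      using filterlim_tendsto_add_at_top[OF tendsto_const filterlim_uminus_at_top_at_bot, of c] by simp
    then have "filterlim (\<lambda>g :: real. exp (c - g)) at_top at_bot"
      by (rule filterlim_compose[OF exp_at_top])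
    moreover have "(Q m \<longlongrightarrow> 0) at_top"
    proof -
      have "((\<lambda>l :: real. \<Sum>j\<le>m. l ^ j / exp l * inverse (fact j)) \<longlongrightarrow> (\<Sum>j\<le>m. 0)) at_top"
        by (intro tendsto_sum tendsto_mult_left_zero tendsto_power_div_exp_0)
      moreover have "Q m = (\<lambda>l. \<Sum>j\<le>m. l ^ j / exp l * inverse (fact j))"
        by (simp add: Q_def fun_eq_iff sum_distrib_left exp_minus divide_inverse mult_ac)
      ultimately show ?thesis by simp
    qed
    ultimately have "((\<lambda>g. Q m (exp (c - g))) \<longlongrightarrow> 0) at_bot"
      by (rule filterlim_compose[rotated])
    then show "((\<lambda>g. exp (- c) * Q m (exp (c - g))) \<longlongrightarrow> 0) at_bot"
      by (rule tendsto_mult_right_zero)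
  next
    have "filterlim (\<lambda>g :: real. c - g) at_bot at_top"
      unfolding filterlim_uminus_at_bot
      using filterlim_tendsto_add_at_top[OF tendsto_const filterlim_ident, of "- c"] by simp
    then have lim: "((\<lambda>g :: real. exp (c - g)) \<longlongrightarrow> 0) at_top"
      by (rule filterlim_compose[OF exp_at_bot])
    have "((\<lambda>g. Q m (exp (c - g))) \<longlongrightarrow> Q m 0) at_top"
      by (rule isCont_tendsto_compose[OF DERIV_isCont[OF dQ] lim])
    moreover have "Q m 0 = 1"
    proof -
      have "(\<Sum>j\<le>m. (0::real) ^ j / fact j) = (\<Sum>j\<in>{0}. 0 ^ j / fact j)"
        by (rule sum.mono_neutral_right) auto
      then show ?thesis by (simp add: Q_def)
    qed
    ultimately show "((\<lambda>g. exp (- c) * Q m (exp (c - g))) \<longlongrightarrow> exp (- c) * 1) at_top"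
      by (intro tendsto_mult tendsto_const) (simp only:)
  qed simp
  finally show ?thesis by (simp add: c_def)
qed

text \<open>At \<open>T = 0\<close> and \<open>m = 0\<close> the Poisson weight is identically
  1.\<close>

lemma nn_integral_gumbel_density: "(\<integral>\<^sup>+g. ennreal (gumbel_density g) \<partial>lborel) = 1"
  using nn_integral_poisson_gumbel[where 'd = 1 and T = 0 and m = 0] by (simp add: poisson_weight_def)

lemma gumbel_density_nonneg: "0 \<le> gumbel_density g"
  by (simp add: gumbel_density_def)

lemma borel_measurable_gumbel_density [measurable]: "gumbel_density \<in> borel_measurable borel"
  unfolding gumbel_density_def by measurable

lemma integrable_gumbel_density: "integrable lborel gumbel_density"
  by (rule integrableI_nonneg) (simp_all add: gumbel_density_nonneg nn_integral_gumbel_density)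

text \<open>The limit distribution of the number of killed records within distance \<open>T\<close> of the new record.\<close>

definition near_prob :: "'d::finite itself \<Rightarrow> real \<Rightarrow> nat \<Rightarrow> real" where
  "near_prob _ T k = exp (- (real CARD('d) * T)) *
     (\<Sum>m. enn2real (low_prob TYPE('d) T k m))"

text \<open>The geometric bound makes the values finite, so that passing to reals loses nothing, and
  it dominates all later sums over \<open>m\<close>.\<close>

lemma low_integral_of_bool_le:
  assumes "0 \<le> T"
  shows "low_prob TYPE('d::finite) T k m \<le> ennreal ((1 - exp (- (real CARD('d) * T))) ^ m)"
  unfolding low_integral_const[OF assms, symmetric] unfolding low_integral_def
  by (intro nn_integral_mono mult_left_mono) auto

lemma low_integral_of_bool_real:
  assumes "0 \<le> T"
  shows "ennreal (enn2real (low_prob TYPE('d::finite) T k m)) = low_prob TYPE('d) T k m"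
    and "enn2real (low_prob TYPE('d::finite) T k m) \<le> (1 - exp (- (real CARD('d) * T))) ^ m"
  using low_integral_of_bool_le[OF assms, where 'd = 'd, of k m] assms
  by (auto intro!: ennreal_enn2real enn2real_leI elim: le_less_trans)

lemma summable_low_integral:
  assumes "0 \<le> T"
  shows "summable (\<lambda>m. enn2real (low_prob TYPE('d::finite) T k m))"
proof (rule summable_comparison_test')
  show "summable (\<lambda>m. (1 - exp (- (real CARD('d) * T))) ^ m)"
    using assms by (intro summable_geometric) simp
  show "norm (enn2real (low_prob TYPE('d) T k m)) \<le> (1 - exp (- (real CARD('d) * T))) ^ m"
    if "0 \<le> m" for m
    using low_integral_of_bool_real(2)[OF assms] by simp
qed

text \<open>The processes for different \<open>g\<close> are arbitrarily chosen, so measurability in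
  \<open>g\<close> must come from the explicit formula for the probability.\<close>

lemma mixture_near_prob:
  fixes p :: "real \<Rightarrow> real"
  assumes T: "0 \<le> T" and p0: "\<And>g. 0 \<le> p g"
    and p: "\<And>g. ennreal (p g) = (\<Sum>m. ennreal (poisson_weight TYPE('d::finite) T g m) * low_prob TYPE('d) T k m)"
  shows "p \<in> borel_measurable borel"
    and "(\<integral>g. p g * gumbel_density g \<partial>lborel) = near_prob TYPE('d) T k"
proof -
  let ?l = "\<lambda>m. low_prob TYPE('d) T k m"
  have w [measurable]: "(\<lambda>g. poisson_weight TYPE('d) T g m) \<in> borel_measurable borel" for m
    unfolding poisson_weight_def by measurable
  have "(\<lambda>g. ennreal (p g)) \<in> borel_measurable borel" unfolding p by measurable
  then have "(\<lambda>g. enn2real (ennreal (p g))) \<in> borel_measurable borel" by measurable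
  then show m [measurable]: "p \<in> borel_measurable borel" using p0 by simp
  have "(\<integral>\<^sup>+g. ennreal (p g * gumbel_density g) \<partial>lborel)
    = (\<integral>\<^sup>+g. (\<Sum>m. ?l m * (ennreal (poisson_weight TYPE('d) T g m) * ennreal (gumbel_density g))) \<partial>lborel)"
  proof (rule nn_integral_cong)
    fix g
    have "ennreal (p g * gumbel_density g) = ennreal (p g) * ennreal (gumbel_density g)"
      by (rule ennreal_mult'[OF p0])
    also have "\<dots> = (\<Sum>m. ?l m * (ennreal (poisson_weight TYPE('d) T g m) * ennreal (gumbel_density g)))"
      unfolding p ennreal_suminf_multc[symmetric] by (simp only: mult_ac)
    finally show "ennreal (p g * gumbel_density g)
      = (\<Sum>m. ?l m * (ennreal (poisson_weight TYPE('d) T g m) * ennreal (gumbel_density g)))" .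
  qed
  also have "\<dots> = (\<Sum>m. \<integral>\<^sup>+g. ?l m * (ennreal (poisson_weight TYPE('d) T g m) * ennreal (gumbel_density g)) \<partial>lborel)"
    by (rule nn_integral_suminf) measurable
  also have "\<dots> = (\<Sum>m. ?l m * ennreal (exp (- (real CARD('d) * T))))"
    by (subst nn_integral_cmult) (simp_all add: nn_integral_poisson_gumbel)
  also have "\<dots> = (\<Sum>m. ennreal (exp (- (real CARD('d) * T)) * enn2real (?l m)))"
    by (simp add: ennreal_mult' low_integral_of_bool_real[OF T] mult.commute)
  also have "\<dots> = ennreal (near_prob TYPE('d) T k)"
    unfolding near_prob_def
    using summable_low_integral[OF T, where 'd = 'd, of k]
    by (intro suminf_ennreal_eq) (auto intro: sums_mult summable_sums)
  finally have "(\<integral>\<^sup>+g. ennreal (p g * gumbel_density g) \<partial>lborel) = ennreal (near_prob TYPE('d) T k)" .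
  moreover have "0 \<le> near_prob TYPE('d) T k"
    unfolding near_prob_def by (intro mult_nonneg_nonneg suminf_nonneg summable_low_integral T) auto
  ultimately show "(\<integral>g. p g * gumbel_density g \<partial>lborel) = near_prob TYPE('d) T k"
    by (intro integral_eq_nn_integral[THEN trans]) (auto simp: p0 gumbel_density_nonneg)
qed

text \<open>Each ratio tends to 1 and is bounded by 1, so the terms are dominated by
  \<open>r ^ m\<close> and Tannery's theorem exchanges limit and sum.\<close>

lemma tendsto_mixed_binom_sum:
  assumes l: "\<And>m. 0 \<le> l m" "\<And>m. l m \<le> r ^ m" and r: "0 \<le> r" "r < 1"
  shows "(\<lambda>N. (\<Sum>m\<le>N. mixed_binom k N m * l m) / mixed_binom k N 0) \<longlonglongrightarrow> (\<Sum>m. l m)"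
proof -
  let ?a = "\<lambda>m N. mixed_binom k N m / mixed_binom k N 0 * l m"
  have lim: "?a m \<longlonglongrightarrow> 1 * l m" for m
    by (intro tendsto_mult tendsto_mixed_binom_ratio tendsto_const)
  have bound: "norm (?a m N) \<le> r ^ m" for m N
  proof -
    have "mixed_binom k N m / mixed_binom k N 0 \<le> 1"
      using mixed_binom_antimono_0[of k N m] mixed_binom_0_pos[of k N] by simp
    then have "?a m N \<le> 1 * l m" by (rule mult_right_mono[OF _ l(1)])
    moreover have "0 \<le> ?a m N" by (intro mult_nonneg_nonneg divide_nonneg_nonneg mixed_binom_nonneg l(1))
    ultimately show ?thesis using l(2)[of m] by simp
  qed
  have "eventually (\<lambda>N. summable (\<lambda>m. norm (?a m N))) sequentially \<and> summable (\<lambda>m. norm (1 * l m)) \<and>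
      (\<lambda>N. \<Sum>m. ?a m N) \<longlonglongrightarrow> (\<Sum>m. 1 * l m)"
  proof (rule tannerys_theorem[OF lim])
    show "summable (\<lambda>m. r ^ m)" using r by (intro summable_geometric) simp
    show "\<forall>\<^sub>F (m, N) in sequentially \<times>\<^sub>F sequentially. norm (?a m N) \<le> r ^ m"
      using bound by (intro always_eventually) auto
  qed simp
  then have "(\<lambda>N. \<Sum>m. ?a m N) \<longlonglongrightarrow> (\<Sum>m. 1 * l m)" by blast
  moreover have "(\<Sum>m. ?a m N) = (\<Sum>m\<le>N. mixed_binom k N m * l m) / mixed_binom k N 0" for N
  proof -
    have "(\<Sum>m. ?a m N) = (\<Sum>m\<le>N. ?a m N)"
      by (rule suminf_finite) (auto simp: mixed_binom_eq_0)
    then show ?thesis by (simp add: sum_divide_distrib)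
  qed
  ultimately show ?thesis by simp
qed

section \<open>Exact probabilities for a sample of fixed size\<close>

context
  fixes n :: nat
  assumes n: "1 \<le> n"
begin

lemma prob_sets_record:
  "measure (expv_seq {1..n} :: 'd::finite vecs measure) {x \<in> space (expv_seq {1..n}). sets_record x n}
    = mixed_binom (CARD('d) - 1) (n - 1) 0"
proof -
  have "emeasure (expv_seq {1..n} :: 'd vecs measure) {x \<in> space (expv_seq {1..n}). sets_record x n}
      = ennreal (mixed_binom (CARD('d) - 1) (n - 1) 0)"
    using nn_integral_sets_record[OF n, where 'd = 'd]
    by (simp only: nn_integral_of_bool[OF measurable_sets_record[OF n]])
  then show ?thesis unfolding measure_def by (simp only: enn2real_ennreal mixed_binom_nonneg)
qed

lemma prob_near_killed:
  assumes T: "0 \<le> T"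
  shows "measure (expv_seq {1..n} :: 'd::finite vecs measure)
      {x \<in> space (expv_seq {1..n}). sets_record x n \<and> dominated (vec T) (x n) \<and> card (near_killed T x n) = k}
    = exp (- (real CARD('d) * T)) *
       (\<Sum>m\<le>n - 1. mixed_binom (CARD('d) - 1) (n - 1) m * enn2real (low_prob TYPE('d) T k m))"
    (is "measure ?M ?A = ?r")
proof -
  note [measurable] = measurable_sets_record[OF n] measurable_card_near_killed[OF n] component_n[OF n]
  have "emeasure ?M ?A = (\<integral>\<^sup>+x. of_bool (sets_record x n \<and> dominated (vec T) (x n)) * of_bool (card (near_killed T x n) = k) \<partial>?M)"
  proof -
    have m: "Measurable.pred ?M (\<lambda>x. sets_record x n \<and> dominated (vec T) (x n) \<and> card (near_killed T x n) = k)"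
      by measurable
    show ?thesis
      unfolding nn_integral_of_bool[OF m, symmetric] by (intro nn_integral_cong) auto
  qed
  also have "\<dots> = ennreal (exp (- (real CARD('d) * T))) *
       (\<Sum>m\<le>n - 1. ennreal (mixed_binom (CARD('d) - 1) (n - 1) m) * low_prob TYPE('d) T k m)"
    by (rule nn_integral_near_killed[OF n T])
  also have "\<dots> = ennreal (exp (- (real CARD('d) * T))) *
       (\<Sum>m\<le>n - 1. ennreal (mixed_binom (CARD('d) - 1) (n - 1) m * enn2real (low_prob TYPE('d) T k m)))"
    by (simp add: ennreal_mult'[OF mixed_binom_nonneg] low_integral_of_bool_real(1)[OF T])
  also have "\<dots> = ennreal ?r"
    by (subst sum_ennreal) (auto simp: ennreal_mult' mixed_binom_nonneg intro!: mult_nonneg_nonneg)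
  finally show ?thesis
    unfolding measure_def by (simp add: mixed_binom_nonneg sum_nonneg)
qed

lemma prob_record_far:
  assumes T: "0 \<le> T"
  shows "measure (expv_seq {1..n} :: 'd::finite vecs measure)
      {x \<in> space (expv_seq {1..n}). sets_record x n \<and> dominated (vec T) (x n)}
    = exp (- (real CARD('d) * T)) *
       (\<Sum>m\<le>n - 1. mixed_binom (CARD('d) - 1) (n - 1) m * (1 - exp (- (real CARD('d) * T))) ^ m)"
    (is "measure ?M ?A = ?r")
proof -
  note [measurable] = measurable_sets_record[OF n] component_n[OF n]
  have q: "0 \<le> 1 - exp (- (real CARD('d) * T))" using T by simp
  have "emeasure ?M ?A = (\<integral>\<^sup>+x. of_bool (sets_record x n \<and> dominated (vec T) (x n)) * 1 \<partial>?M)"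
  proof -
    have m: "Measurable.pred ?M (\<lambda>x. sets_record x n \<and> dominated (vec T) (x n))"
      by measurable
    show ?thesis
      unfolding nn_integral_of_bool[OF m, symmetric] by (intro nn_integral_cong) auto
  qed
  also have "\<dots> = ennreal (exp (- (real CARD('d) * T))) *
       (\<Sum>m\<le>n - 1. ennreal (mixed_binom (CARD('d) - 1) (n - 1) m) * low_integral TYPE('d) T (\<lambda>_. 1) m)"
    by (rule nn_integral_near_killed[OF n T])
  also have "\<dots> = ennreal (exp (- (real CARD('d) * T))) *
       (\<Sum>m\<le>n - 1. ennreal (mixed_binom (CARD('d) - 1) (n - 1) m * (1 - exp (- (real CARD('d) * T))) ^ m))"
    by (simp add: ennreal_mult'[OF mixed_binom_nonneg] low_integral_const[OF T])
  also have "\<dots> = ennreal ?r"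
    using q by (subst sum_ennreal) (auto simp: ennreal_mult' mixed_binom_nonneg intro!: mult_nonneg_nonneg)
  finally show ?thesis
    unfolding measure_def using q by (simp add: mixed_binom_nonneg sum_nonneg)
qed

lemma prob_mem_killed:
  assumes j: "j \<in> {1..<n}" and B: "B \<in> sets borel"
  shows "measure (expv_seq {1..n} :: 'd::finite vecs measure)
      {x \<in> space (expv_seq {1..n}). j \<in> killed x n \<and> x n - x j \<in> B}
    = mixed_binom (CARD('d) - 1) (n - 1) 1 / real (n - 1) * measure expv B"
    (is "measure ?M ?A = ?r")
proof -
  note [measurable] = measurable_mem_killed[OF n j] component_n[OF n] component_less[OF n j] B
  have "emeasure ?M ?A = (\<integral>\<^sup>+x. of_bool (j \<in> killed x n) * indicator B (x n - x j) \<partial>?M)"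
  proof -
    have m: "Measurable.pred ?M (\<lambda>x. j \<in> killed x n \<and> x n - x j \<in> B)"
      by measurable
    show ?thesis
      unfolding nn_integral_of_bool[OF m, symmetric]
      by (intro nn_integral_cong) (auto split: split_indicator)
  qed
  also have "\<dots> = ennreal (mixed_binom (CARD('d) - 1) (n - 1) 1 / real (n - 1)) * emeasure expv B"
    by (subst nn_integral_mem_killed[OF n j]) auto
  also have "\<dots> = ennreal ?r"
    unfolding expv.emeasure_eq_measure by (rule ennreal_mult'[symmetric]) (simp add: mixed_binom_nonneg)
  finally show ?thesis
    unfolding measure_def[of ?M] by (simp add: mixed_binom_nonneg)
qed

lemma prob_far_killed_le:
  assumes B: "B \<in> sets borel"
  shows "(\<Sum>j\<in>{1..<n}. measure (expv_seq {1..n} :: 'd::finite vecs measure)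
      {x \<in> space (expv_seq {1..n}). j \<in> killed x n \<and> x n - x j \<in> B})
    \<le> mixed_binom (CARD('d) - 1) (n - 1) 0 * measure expv B"
proof -
  have "(\<Sum>j\<in>{1..<n}. measure (expv_seq {1..n} :: 'd vecs measure)
      {x \<in> space (expv_seq {1..n}). j \<in> killed x n \<and> x n - x j \<in> B})
    = (\<Sum>j\<in>{1..<n}. mixed_binom (CARD('d) - 1) (n - 1) 1 / real (n - 1) * measure expv B)"
    by (intro sum.cong refl prob_mem_killed B)
  also have "\<dots> = real (n - 1) * (mixed_binom (CARD('d) - 1) (n - 1) 1 / real (n - 1) * measure expv B)"
    by simp
  also have "\<dots> \<le> mixed_binom (CARD('d) - 1) (n - 1) 1 * measure expv B"
    \<comment> \<open>For \<open>n = 1\<close> the quotient by \<open>real 0\<close> is 0 and the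
      sum is empty.\<close>
    by (cases "n - 1 = 0") (auto simp: mixed_binom_nonneg)
  also have "\<dots> \<le> mixed_binom (CARD('d) - 1) (n - 1) 0 * measure expv B"
    by (intro mult_right_mono mixed_binom_antimono_0) simp
  finally show ?thesis .
qed

end

section \<open>Convergence\<close>

definition far :: "real \<Rightarrow> (real ^ 'd::finite) set" where
  "far T = {z. \<not> dominated z (vec T)}"

lemma sets_far: "far T \<in> sets borel"
  unfolding far_def by (intro sets_Collect_borel pred_intros_logic) measurable

lemma tendsto_prob_far: "(\<lambda>t. measure expv (far (real (Suc t)) :: (real ^ 'd::finite) set)) \<longlonglongrightarrow> 0"
proof -
  let ?A = "\<lambda>t. far (real (Suc t)) :: (real ^ 'd) set"
  have "(\<lambda>t. expv.prob (?A t)) \<longlonglongrightarrow> expv.prob (\<Inter>t. ?A t)"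
  proof (rule expv.finite_Lim_measure_decseq)
    show "range ?A \<subseteq> sets expv" using sets_far by auto
    show "decseq ?A" by (auto simp: decseq_def far_def dominated_def intro: less_le_trans)
  qed
  moreover have "(\<Inter>t. ?A t) = {}"
  proof (rule ccontr)
    assume "(\<Inter>t. ?A t) \<noteq> {}"
    then obtain z :: "real ^ 'd" where z: "\<And>t. z \<in> ?A t" by blast
    obtain t where t: "Max (range (($) z)) < real t" using reals_Archimedean2 by blast
    have "z $ i < real (Suc t)" for i
    proof -
      have "real t < real (Suc t)" by simp
      moreover have "z $ i \<le> Max (range (($) z))" by simp
      ultimately show ?thesis using t by linarith
    qed
    then show False using z[of t] by (simp add: far_def dominated_def)
  qed
  ultimately show ?thesis by simp
qed

section \<open>Comparison of all killed records with the nearby ones\<close>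

context
  fixes n :: nat
  assumes n: "1 \<le> n"
begin

abbreviation (input) event :: "('d::finite vecs \<Rightarrow> bool) \<Rightarrow> ('d vecs) set" where
  "event P \<equiv> {x \<in> space (expv_seq {1..n}). P x}"

lemma sets_event_record:
  defines "M \<equiv> expv_seq {1..n} :: 'd::finite vecs measure"
  shows "event (\<lambda>x. sets_record x n) \<in> sets M" (is ?A)
    and "event (\<lambda>x. sets_record x n \<and> card (killed x n) = k) \<in> sets M" (is ?B)
    and "event (\<lambda>x. sets_record x n \<and> k \<le> card (killed x n)) \<in> sets M" (is ?C)
    and "event (\<lambda>x. sets_record x n \<and> dominated (vec T) (x n)) \<in> sets M" (is ?D)
    and "event (\<lambda>x. sets_record x n \<and> dominated (vec T) (x n) \<and> card (near_killed T x n) = k) \<in> sets M" (is ?E)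
proof -
  note [measurable] = measurable_sets_record[OF n] measurable_card_near_killed[OF n]
    measurable_card_killed[OF n] component_n[OF n]
  show ?A ?B ?C ?D ?E
    unfolding M_def by measurable
qed

lemma sets_event_killed:
  assumes j: "j \<in> {1..<n}" and [measurable]: "B \<in> sets borel"
  shows "event (\<lambda>x. j \<in> killed x n \<and> x n - x j \<in> B) \<in> sets (expv_seq {1..n} :: 'd::finite vecs measure)"
proof -
  note [measurable] = measurable_mem_killed[OF n j] component_n[OF n] component_less[OF n j]
  show ?thesis by measurable
qed

text \<open>The two counts can disagree only if the new record fails to dominate
  \<open>vec T\<close> or some killed record is at a \<open>far\<close> difference from it. The
  bound is proportional to \<open>c\<close> apart from the first deficit, so it survives division by
  the probability of a record.\<close>

lemma prob_killed_approx:
  fixes T :: real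
  defines "M \<equiv> expv_seq {1..n} :: 'd::finite vecs measure"
  defines "c \<equiv> mixed_binom (CARD('d) - 1) (n - 1) 0"
  shows "\<bar>measure M (event (\<lambda>x. sets_record x n \<and> card (killed x n) = k))
     - measure M (event (\<lambda>x. sets_record x n \<and> dominated (vec T) (x n) \<and> card (near_killed T x n) = k))\<bar>
    \<le> (c - measure M (event (\<lambda>x. sets_record x n \<and> dominated (vec T) (x n)))) + c * measure expv (far T :: (real ^ 'd) set)"
proof -
  interpret M: prob_space M unfolding M_def by (intro prob_space_PiM expv.prob_space_axioms)
  let ?A = "event (\<lambda>x :: 'd vecs. sets_record x n \<and> card (killed x n) = k)"
  let ?B = "event (\<lambda>x :: 'd vecs. sets_record x n \<and> dominated (vec T) (x n) \<and> card (near_killed T x n) = k)"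
  let ?R = "event (\<lambda>x :: 'd vecs. sets_record x n)"
  let ?F = "event (\<lambda>x :: 'd vecs. sets_record x n \<and> dominated (vec T) (x n))"
  let ?C = "\<lambda>j. event (\<lambda>x :: 'd vecs. j \<in> killed x n \<and> x n - x j \<in> far T)"
  have s [measurable]: "?A \<in> sets M" "?B \<in> sets M" "?R \<in> sets M" "?F \<in> sets M" "j \<in> {1..<n} \<Longrightarrow> ?C j \<in> sets M" for j
    unfolding M_def by (intro sets_event_record sets_event_killed sets_far; assumption?)+
  have UC: "(\<Union>j\<in>{1..<n}. ?C j) \<in> sets M" by (intro sets.finite_UN s) auto
  have C: "M.prob (\<Union>j\<in>{1..<n}. ?C j) \<le> c * measure expv (far T :: (real ^ 'd) set)"
  proof -
    have "M.prob (\<Union>j\<in>{1..<n}. ?C j) \<le> (\<Sum>j\<in>{1..<n}. M.prob (?C j))"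
      by (rule M.finite_measure_subadditive_finite) (use s(5) in auto)
    also have "\<dots> \<le> c * measure expv (far T :: (real ^ 'd) set)"
      unfolding M_def c_def by (rule prob_far_killed_le[OF n sets_far])
    finally show ?thesis .
  qed
  have near: "near_killed T x n = killed x n" if "x \<in> space M" "x \<notin> (\<Union>j\<in>{1..<n}. ?C j)" for x
  proof -
    have "dominated (x n - vec T) (x j)" if j: "j \<in> killed x n" for j
    proof -
      have "j \<in> {1..<n}" using j by (simp add: killed_def)
      then have "x n - x j \<notin> far T" using that \<open>x \<notin> _\<close> j \<open>x \<in> space M\<close> unfolding M_def by blast
      then show ?thesis by (auto simp: far_def dominated_def algebra_simps)
    qed
    then show ?thesis by (auto simp: near_killed_def)
  qed
  have "?A \<subseteq> ?B \<union> ((?R - ?F) \<union> (\<Union>j\<in>{1..<n}. ?C j))"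
  proof
    fix x assume x: "x \<in> ?A"
    then have "x \<in> space M" by (simp add: M_def)
    from near[OF this] x show "x \<in> ?B \<union> ((?R - ?F) \<union> (\<Union>j\<in>{1..<n}. ?C j))"
      by (cases "x \<in> (\<Union>j\<in>{1..<n}. ?C j)") auto
  qed
  then have "M.prob ?A \<le> M.prob (?B \<union> ((?R - ?F) \<union> (\<Union>j\<in>{1..<n}. ?C j)))"
    by (intro M.finite_measure_mono sets.Un sets.Diff s UC)
  also have "\<dots> \<le> M.prob ?B + M.prob ((?R - ?F) \<union> (\<Union>j\<in>{1..<n}. ?C j))"
    by (intro measure_Un_le sets.Un sets.Diff s UC)
  also have "M.prob ((?R - ?F) \<union> (\<Union>j\<in>{1..<n}. ?C j)) \<le> M.prob (?R - ?F) + M.prob (\<Union>j\<in>{1..<n}. ?C j)"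
    by (intro measure_Un_le sets.Un sets.Diff s UC)
  also have "M.prob (?R - ?F) = M.prob ?R - M.prob ?F"
    by (rule M.finite_measure_Diff) (use s in auto)
  also have "M.prob ?R = c"
    unfolding M_def c_def by (rule prob_sets_record[OF n])
  finally have 1: "M.prob ?A \<le> M.prob ?B + (c - M.prob ?F + M.prob (\<Union>j\<in>{1..<n}. ?C j))" by simp
  have "?B \<subseteq> ?A \<union> (\<Union>j\<in>{1..<n}. ?C j)"
  proof
    fix x assume x: "x \<in> ?B"
    then have "x \<in> space M" by (simp add: M_def)
    from near[OF this] x show "x \<in> ?A \<union> (\<Union>j\<in>{1..<n}. ?C j)"
      by (cases "x \<in> (\<Union>j\<in>{1..<n}. ?C j)") auto
  qed
  then have "M.prob ?B \<le> M.prob (?A \<union> (\<Union>j\<in>{1..<n}. ?C j))"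
    by (intro M.finite_measure_mono sets.Un s UC)
  also have "\<dots> \<le> M.prob ?A + M.prob (\<Union>j\<in>{1..<n}. ?C j)"
    by (intro measure_Un_le s UC)
  finally have 2: "M.prob ?B \<le> M.prob ?A + M.prob (\<Union>j\<in>{1..<n}. ?C j)" .
  \<comment> \<open>This makes the first error term nonnegative, so the estimate in the other
    direction, where it does not occur, obeys the same bound.\<close>
  have "M.prob ?F \<le> M.prob ?R" by (rule M.finite_measure_mono) (use s in auto)
  then have 3: "M.prob ?F \<le> c" using \<open>M.prob ?R = c\<close> by simp
  show ?thesis using 1 2 3 C by linarith
qed

text \<open>Markov's inequality; the mean number of killed records is at most the probability of a record.\<close>

lemma sum_prob_killed_ge:
  fixes L :: nat
  assumes L: "0 < L"
  shows "mixed_binom (CARD('d) - 1) (n - 1) 0 * (1 - 1 / real L)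
    \<le> (\<Sum>k<L. measure (expv_seq {1..n} :: 'd::finite vecs measure)
        (event (\<lambda>x. sets_record x n \<and> card (killed x n) = k)))"
proof -
  define M where "M = (expv_seq {1..n} :: 'd vecs measure)"
  define c where "c = mixed_binom (CARD('d) - 1) (n - 1) 0"
  interpret M: prob_space M unfolding M_def by (intro prob_space_PiM expv.prob_space_axioms)
  let ?A = "\<lambda>k. event (\<lambda>x :: 'd vecs. sets_record x n \<and> card (killed x n) = k)"
  let ?R = "event (\<lambda>x :: 'd vecs. sets_record x n)"
  let ?H = "event (\<lambda>x :: 'd vecs. sets_record x n \<and> L \<le> card (killed x n))"
  let ?C = "\<lambda>j. event (\<lambda>x :: 'd vecs. j \<in> killed x n \<and> x n - x j \<in> UNIV)"
  have s: "?A k \<in> sets M" "?R \<in> sets M" "?H \<in> sets M" "j \<in> {1..<n} \<Longrightarrow> ?C j \<in> sets M" for j k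
    unfolding M_def by (intro sets_event_record sets_event_killed; simp?)+
  have "real L * M.prob ?H = (\<integral>x. real L * indicator ?H x \<partial>M)" using s by simp
  also have "\<dots> \<le> (\<integral>x. (\<Sum>j\<in>{1..<n}. indicator (?C j) x) \<partial>M)"
  proof (rule integral_mono)
    fix x assume x: "x \<in> space M"
    have "(\<Sum>j\<in>{1..<n}. indicator (?C j) x :: real) = (\<Sum>j\<in>{1..<n}. if j \<in> killed x n then 1 else 0)"
      using x by (intro sum.cong) (auto simp: M_def)
    also have "\<dots> = real (card (killed x n))"
      by (subst sum.inter_filter[symmetric]) (auto simp: killed_def intro!: arg_cong[where f = card])
    finally show "real L * indicator ?H x \<le> (\<Sum>j\<in>{1..<n}. indicator (?C j) x :: real)"
      by (auto split: split_indicator)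
  qed (use s in \<open>auto simp: M.emeasure_eq_measure\<close>)
  also have "\<dots> = (\<Sum>j\<in>{1..<n}. M.prob (?C j))"
    using s by (subst Bochner_Integration.integral_sum) (auto simp: M.emeasure_eq_measure)
  also have "\<dots> \<le> c * measure expv (UNIV :: (real ^ 'd) set)"
    unfolding M_def c_def by (rule prob_far_killed_le[OF n]) simp
  also have "\<dots> = c" using expv.prob_space[where 'd = 'd] by simp
  finally have H: "M.prob ?H \<le> c / real L" using L by (simp add: field_simps)
  have "?R \<subseteq> (\<Union>k<L. ?A k) \<union> ?H" by force
  then have "M.prob ?R \<le> M.prob ((\<Union>k<L. ?A k) \<union> ?H)"
    by (intro M.finite_measure_mono sets.Un sets.finite_UN s) auto
  also have "\<dots> \<le> M.prob (\<Union>k<L. ?A k) + M.prob ?H"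
    by (intro measure_Un_le sets.finite_UN s) auto
  also have "M.prob (\<Union>k<L. ?A k) \<le> (\<Sum>k<L. M.prob (?A k))"
    by (rule M.finite_measure_subadditive_finite) (use s in auto)
  also have "M.prob ?R = c"
    unfolding M_def c_def by (rule prob_sets_record[OF n])
  finally have "c - c / real L \<le> (\<Sum>k<L. M.prob (?A k))" using H by linarith
  then have "c * (1 - 1 / real L) \<le> (\<Sum>k<L. M.prob (?A k))" by (simp add: right_diff_distrib)
  then show ?thesis unfolding M_def c_def .
qed

lemma sum_prob_killed_le:
  "(\<Sum>k<L. measure (expv_seq {1..n} :: 'd::finite vecs measure)
        (event (\<lambda>x. sets_record x n \<and> card (killed x n) = k)))
    \<le> mixed_binom (CARD('d) - 1) (n - 1) 0"
proof -
  define M where "M = (expv_seq {1..n} :: 'd vecs measure)"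
  interpret M: prob_space M unfolding M_def by (intro prob_space_PiM expv.prob_space_axioms)
  let ?A = "\<lambda>k. event (\<lambda>x :: 'd vecs. sets_record x n \<and> card (killed x n) = k)"
  have s: "?A k \<in> sets M" "event (\<lambda>x :: 'd vecs. sets_record x n) \<in> sets M" for k
    unfolding M_def by (rule sets_event_record)+
  have "(\<Sum>k<L. M.prob (?A k)) = M.prob (\<Union>k<L. ?A k)"
    by (rule M.finite_measure_finite_Union[symmetric]) (use s in \<open>auto simp: disjoint_family_on_def\<close>)
  also have "\<dots> \<le> M.prob (event (\<lambda>x :: 'd vecs. sets_record x n))"
    by (intro M.finite_measure_mono s) auto
  also have "\<dots> = mixed_binom (CARD('d) - 1) (n - 1) 0"
    unfolding M_def by (rule prob_sets_record[OF n])
  finally show ?thesis unfolding M_def .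
qed

end

text \<open>\<open>T\<close> is chosen before \<open>n\<close>: the mean number of far kills is
  small relative to the record probability uniformly in \<open>n\<close>, and only then are the
  limits for this fixed \<open>T\<close> taken.\<close>

lemma tendsto_prob_killed:
  fixes p :: real
  assumes near: "(\<lambda>t. near_prob TYPE('d::finite) (real (Suc t)) k) \<longlonglongrightarrow> p"
  shows "(\<lambda>n. measure (expv_seq {1..n} :: 'd vecs measure)
        {x \<in> space (expv_seq {1..n}). sets_record x n \<and> card (killed x n) = k}
      / mixed_binom (CARD('d) - 1) (n - 1) 0) \<longlonglongrightarrow> p"
proof (rule tendstoI)
  fix e :: real assume e: "0 < e"
  define c where "c = (\<lambda>n. mixed_binom (CARD('d) - 1) (n - 1) 0)"
  have c0: "0 < c n" for n by (simp add: c_def mixed_binom_0_pos)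
  let ?M = "\<lambda>n. expv_seq {1..n} :: 'd vecs measure"
  let ?u = "\<lambda>n. measure (?M n) {x \<in> space (expv_seq {1..n}). sets_record x n \<and> card (killed x n) = k} / c n"
  \<comment> \<open>Four errors share \<open>e\<close>: far kills, the distance of
    \<open>near_prob\<close> to \<open>p\<close>, convergence of the restricted probability, and
    records that do not dominate \<open>vec T\<close>.\<close>
  have "\<forall>\<^sub>F t in sequentially. measure expv (far (real (Suc t)) :: (real ^ 'd) set) < e / 4
      \<and> dist (near_prob TYPE('d) (real (Suc t)) k) p < e / 4"
    using order_tendstoD(2)[OF tendsto_prob_far[where 'd = 'd], of "e / 4"] tendstoD[OF near, of "e / 4"] e
    by (intro eventually_conj) auto
  then obtain t where t: "measure expv (far (real (Suc t)) :: (real ^ 'd) set) < e / 4"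
    "dist (near_prob TYPE('d) (real (Suc t)) k) p < e / 4"
    by (auto simp: eventually_sequentially)
  define T where "T = real (Suc t)"
  have T: "0 \<le> T" by (simp add: T_def)
  define r where "r = 1 - exp (- (real CARD('d) * T))"
  have r: "0 \<le> r" "r < 1" using T by (auto simp: r_def)
  let ?v = "\<lambda>n. measure (?M n) {x \<in> space (expv_seq {1..n}). sets_record x n \<and> dominated (vec T) (x n) \<and> card (near_killed T x n) = k} / c n"
  let ?w = "\<lambda>n. measure (?M n) {x \<in> space (expv_seq {1..n}). sets_record x n \<and> dominated (vec T) (x n)} / c n"
  let ?l = "\<lambda>m. enn2real (low_prob TYPE('d) T k m)"
  let ?s = "\<lambda>l N. exp (- (real CARD('d) * T)) * ((\<Sum>m\<le>N. mixed_binom (CARD('d) - 1) N m * l m) / mixed_binom (CARD('d) - 1) N 0)"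
  have v: "?v \<longlonglongrightarrow> near_prob TYPE('d) T k"
  proof (rule LIMSEQ_offset[of _ 1])
    have "(\<lambda>N. ?s ?l N)
        \<longlonglongrightarrow> near_prob TYPE('d) T k"
      unfolding near_prob_def
      by (intro tendsto_mult tendsto_const tendsto_mixed_binom_sum[of _ r])
        (use low_integral_of_bool_real(2)[OF T, where 'd = 'd] r in \<open>auto simp: r_def\<close>)
    moreover have "?v (N + 1) = ?s ?l N" for N
      by (subst prob_near_killed[OF _ T]) (simp_all add: c_def)
    ultimately show "(\<lambda>N. ?v (N + 1)) \<longlonglongrightarrow> near_prob TYPE('d) T k" by (simp only:)
  qed
  have w: "?w \<longlonglongrightarrow> 1"
  proof (rule LIMSEQ_offset[of _ 1])
    have "(\<lambda>N. ?s ((^) r) N)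
        \<longlonglongrightarrow> exp (- (real CARD('d) * T)) * (\<Sum>m. r ^ m)"
      by (intro tendsto_mult tendsto_const tendsto_mixed_binom_sum[of _ r]) (use r in auto)
    \<comment> \<open>Since \<open>1 - r = exp (- d T)\<close>, the geometric series cancels the
      prefactor: given a record, the new point dominates \<open>vec T\<close> with probability
      tending to 1.\<close>
    moreover have "exp (- (real CARD('d) * T)) * (\<Sum>m. r ^ m) = 1"
      using r by (subst suminf_geometric) (auto simp: r_def)
    moreover have "?w (N + 1) = ?s ((^) r) N" for N
      by (subst prob_record_far[OF _ T]) (simp_all add: c_def r_def)
    ultimately show "(\<lambda>N. ?w (N + 1)) \<longlonglongrightarrow> 1" by (simp only:)
  qed
  have "e / 4 > 0" "1 - e / 4 < 1" using e by auto
  from tendstoD[OF v this(1)] order_tendstoD(1)[OF w this(2)] eventually_ge_at_top[of 1]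
  have "\<forall>\<^sub>F n in sequentially. dist (?u n) p < e"
  proof eventually_elim
    case (elim n)
    let ?A = "measure (?M n) {x \<in> space (expv_seq {1..n}). sets_record x n \<and> card (killed x n) = k}"
    let ?B = "measure (?M n) {x \<in> space (expv_seq {1..n}). sets_record x n \<and> dominated (vec T) (x n) \<and> card (near_killed T x n) = k}"
    let ?F = "measure (?M n) {x \<in> space (expv_seq {1..n}). sets_record x n \<and> dominated (vec T) (x n)}"
    let ?d = "measure expv (far T :: (real ^ 'd) set)"
    have "\<bar>?A - ?B\<bar> \<le> (c n - ?F) + c n * ?d"
      unfolding c_def by (rule prob_killed_approx[OF elim(3)])
    then have "\<bar>?A - ?B\<bar> / c n \<le> ((c n - ?F) + c n * ?d) / c n"
      using c0[of n] by (intro divide_right_mono) auto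
    also have "((c n - ?F) + c n * ?d) / c n = 1 - ?w n + ?d"
      using c0[of n] by (simp add: add_divide_distrib diff_divide_distrib)
    also have "\<bar>?A - ?B\<bar> / c n = \<bar>?u n - ?v n\<bar>"
      using c0[of n] by (simp add: diff_divide_distrib[symmetric] abs_divide)
    finally show ?case
      using elim(1,2) t unfolding T_def[symmetric] dist_real_def by linarith
  qed
  then show "\<forall>\<^sub>F n in sequentially. dist (measure (?M n) {x \<in> space (expv_seq {1..n}). sets_record x n \<and> card (killed x n) = k}
      / mixed_binom (CARD('d) - 1) (n - 1) 0) p < e"
    by (simp only: c_def)
qed

section \<open>Transfer to the given vectors and Poisson processes\<close>

lemma distr_eq_expv_seq:
  fixes X :: "nat \<Rightarrow> 'a \<Rightarrow> real ^ 'd::finite"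
  assumes "prob_space M"
    and X: "prob_space.indep_vars M (\<lambda>_. borel) X {1..}"
    and coords: "\<And>i. 1 \<le> i \<Longrightarrow> prob_space.indep_vars M (\<lambda>_. borel) (\<lambda>j \<omega>. X i \<omega> $ j) UNIV"
    and expo: "\<And>i j. 1 \<le> i \<Longrightarrow> distributed M lborel (\<lambda>\<omega>. X i \<omega> $ j) (exponential_density 1)"
    and n: "1 \<le> n"
  shows "distr M (expv_seq {1..n}) (\<lambda>\<omega>. \<lambda>i\<in>{1..n}. X i \<omega>) = expv_seq {1..n}"
proof -
  interpret prob_space M by fact
  have rv: "X i \<in> borel_measurable M" if "1 \<le> i" for i
    using X that unfolding indep_vars_def by auto
  have "indep_vars (\<lambda>_. borel) X {1..n}"
    by (rule indep_vars_subset[OF X]) auto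
  then have "distr M (PiM {1..n} (\<lambda>_. borel)) (\<lambda>\<omega>. \<lambda>i\<in>{1..n}. X i \<omega>) = PiM {1..n} (\<lambda>i. distr M borel (X i))"
    using n rv by (subst (asm) indep_vars_iff_distr_eq_PiM') auto
  also have "\<dots> = expv_seq {1..n}"
    by (intro PiM_cong refl distr_eq_expv[OF \<open>prob_space M\<close> coords expo rv]) auto
  also have "distr M (PiM {1..n} (\<lambda>_. borel)) (\<lambda>\<omega>. \<lambda>i\<in>{1..n}. X i \<omega>)
      = distr M (expv_seq {1..n}) (\<lambda>\<omega>. \<lambda>i\<in>{1..n}. X i \<omega>)"
    by (intro distr_cong refl sets_PiM_cong) simp
  finally show ?thesis .
qed

text \<open>For fixed \<open>g\<close> the corner recedes to minus infinity along the diagonal, so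
  the restricted counts exhaust the full one; dominated convergence with the Gumbel density carries
  this through the mixture. Levels \<open>Suc t\<close> are positive, as
  \<open>limit_process\<close> demands.\<close>

lemma mixture_dominated_maxima:
  fixes N :: "real \<Rightarrow> 'b measure" and S :: "real \<Rightarrow> 'b \<Rightarrow> (real ^ 'd::finite) set"
  assumes N: "\<And>g. poisson_point_process (N g) (limit_intensity g) (S g)"
  defines "q \<equiv> \<lambda>k g. measure (N g) {\<omega> \<in> space (N g). dominated_maxima g (S g \<omega>) = enat k}"
  shows "integrable lborel (\<lambda>g. q k g * gumbel_density g)"
    and "(\<lambda>t. near_prob TYPE('d) (real (Suc t)) k) \<longlonglongrightarrow> (\<integral>g. q k g * gumbel_density g \<partial>lborel)"
proof -
  have pp: "point_process (N g) (limit_intensity g) (S g)" for g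
    using N[of g] by (intro point_process.intro point_process_axioms.intro) (auto simp: poisson_point_process_def)
  have lp: "limit_process (N g) g (S g) (real (Suc t))" for g t
    by (intro limit_process.intro pp limit_process_axioms.intro) simp
  let ?near = "\<lambda>t g \<omega>. {y \<in> maxima (S g \<omega>). dominated (corner g (real (Suc t))) y \<and> dominated y (diag_point g)}"
  let ?p = "\<lambda>t g. measure (N g) {\<omega> \<in> space (N g). num_points (?near t g \<omega>) = enat k}"
  have lim: "(\<lambda>t. ?p t g) \<longlonglongrightarrow> q k g" for g
  proof -
    interpret point_process "N g" "limit_intensity g" "S g" by (rule pp)
    have "(\<lambda>t. ?p t g) \<longlonglongrightarrow> prob {\<omega> \<in> space (N g). num_points {y \<in> maxima (S g \<omega>).
        \<exists>t. dominated (corner g (real (Suc t))) y \<and> dominated y (diag_point g)} = enat k}"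
    proof (rule tendsto_maxima_eq)
      show "Measurable.pred borel (\<lambda>y. dominated (corner g (real (Suc t))) y \<and> dominated y (diag_point g))" for t
        by measurable
      fix s t :: nat and y :: "real ^ 'd"
      assume "s \<le> t" "dominated (corner g (real (Suc s))) y \<and> dominated y (diag_point g)"
      then show "dominated (corner g (real (Suc t))) y \<and> dominated y (diag_point g)"
        by (auto simp: dominated_def corner_def elim!: le_less_trans[rotated] allE)
    qed
    \<comment> \<open>Any \<open>t\<close> beyond the largest coordinate gap between
      \<open>y\<close> and \<open>diag_point g\<close> puts \<open>y\<close> above the
      corner.\<close>
    moreover have "(\<exists>t. dominated (corner g (real (Suc t))) y \<and> dominated y (diag_point g)) \<longleftrightarrow> dominated y (diag_point g)"
      for y :: "real ^ 'd"
    proof -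
      obtain t where t: "Max (range (\<lambda>i. diag_point g $ i - y $ i)) < real t" using reals_Archimedean2 by blast
      have "diag_point g $ i - real (Suc t) < y $ i" for i
      proof -
        have "diag_point g $ i - y $ i \<le> Max (range (\<lambda>i. diag_point g $ i - y $ i))" by simp
        moreover have "real t < real (Suc t)" by simp
        ultimately show ?thesis using t by linarith
      qed
      then have "dominated (corner g (real (Suc t))) y" by (simp add: dominated_def corner_def)
      then show ?thesis by blast
    qed
    ultimately show ?thesis by (simp add: q_def dominated_maxima_def)
  qed
  have p: "ennreal (?p t g) = (\<Sum>m. ennreal (poisson_weight TYPE('d) (real (Suc t)) g m) *
      low_prob TYPE('d) (real (Suc t)) k m)" for t g
    using limit_process.prob_near_maxima[OF lp, of g t k] by (simp only: limit_process.near_maxima_def[OF lp])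
  note mix = mixture_near_prob[where p = "?p t" for t, OF _ _ p]
  have meas: "?p t \<in> borel_measurable borel" for t by (rule mix(1)) auto
  have qm: "(\<lambda>g. q k g) \<in> borel_measurable borel"
    by (rule borel_measurable_LIMSEQ_real[OF lim meas])
  have le1: "?p t g \<le> 1" "q k g \<le> 1" for t g
    using pp[of g] unfolding point_process_def q_def by (auto intro: prob_space.prob_le_1)
  show "integrable lborel (\<lambda>g. q k g * gumbel_density g)"
    using qm le1 by (intro Bochner_Integration.integrable_bound[OF integrable_gumbel_density])
      (auto simp: q_def gumbel_density_nonneg abs_mult intro!: mult_left_le_one_le)
  have "(\<lambda>t. \<integral>g. ?p t g * gumbel_density g \<partial>lborel) \<longlonglongrightarrow> (\<integral>g. q k g * gumbel_density g \<partial>lborel)"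
  proof (rule integral_dominated_convergence[where w = gumbel_density])
    show "AE g in lborel. (\<lambda>t. ?p t g * gumbel_density g) \<longlonglongrightarrow> q k g * gumbel_density g"
      by (intro AE_I2 tendsto_mult lim tendsto_const)
    show "AE g in lborel. norm (?p t g * gumbel_density g) \<le> gumbel_density g" for t
      using le1 by (intro AE_I2) (auto simp: gumbel_density_nonneg abs_mult intro!: mult_left_le_one_le)
  qed (use qm meas in \<open>auto simp: integrable_gumbel_density\<close>)
  moreover have "(\<integral>g. ?p t g * gumbel_density g \<partial>lborel) = near_prob TYPE('d) (real (Suc t)) k" for t
    by (rule mix(2)) auto
  ultimately show "(\<lambda>t. near_prob TYPE('d) (real (Suc t)) k) \<longlonglongrightarrow> (\<integral>g. q k g * gumbel_density g \<partial>lborel)"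
    by (simp only:)
qed

theorem theorem1p3:
  fixes M :: "'a measure" and X :: "nat \<Rightarrow> 'a \<Rightarrow> real ^ 'd::finite"
    and N :: "real \<Rightarrow> 'b measure" and S :: "real \<Rightarrow> 'b \<Rightarrow> (real ^ 'd) set"
  assumes "prob_space M"
    and "prob_space.indep_vars M (\<lambda>_. borel) X {1..}"
    and "\<And>i. 1 \<le> i \<Longrightarrow> prob_space.indep_vars M (\<lambda>_. borel) (\<lambda>j \<omega>. X i \<omega> $ j) UNIV"
    and "\<And>i j. 1 \<le> i \<Longrightarrow> distributed M lborel (\<lambda>\<omega>. X i \<omega> $ j) (exponential_density 1)"
    and "\<And>g. poisson_point_process (N g) (limit_intensity g) (S g)"
  defines "K \<equiv> \<lambda>n \<omega>. records_killed (\<lambda>i. X i \<omega>) n"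
  shows "\<exists>\<K> :: nat pmf.
    (\<forall>k. has_bochner_integral lborel
           (\<lambda>g. measure (N g) {\<omega> \<in> space (N g). dominated_maxima g (S g \<omega>) = enat k}
                  * gumbel_density g)
           (pmf \<K> k)) \<and>
    weak_conv_m
      (\<lambda>n. distr (uniform_measure M {\<omega> \<in> space M. 0 \<le> K n \<omega>}) borel (\<lambda>\<omega>. real_of_int (K n \<omega>)))
      (distr (measure_pmf \<K>) borel real)"
proof -
  interpret prob_space M by fact
  let ?q = "\<lambda>k g. measure (N g) {\<omega> \<in> space (N g). dominated_maxima g (S g \<omega>) = enat k}"
  define p where "p = (\<lambda>k. \<integral>g. ?q k g * gumbel_density g \<partial>lborel)"
  note mix = mixture_dominated_maxima[where S = S and N = N, OF assms(5)]
  let ?M = "\<lambda>n. expv_seq {1..n} :: 'd vecs measure"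
  let ?r = "\<lambda>n k. measure (?M n) {x \<in> space (?M n). sets_record x n \<and> card (killed x n) = k}"
  let ?c = "\<lambda>n. mixed_binom (CARD('d) - 1) (n - 1) 0"
  have lim: "(\<lambda>n. ?r n k / ?c n) \<longlonglongrightarrow> p k" for k
    unfolding p_def by (intro tendsto_prob_killed mix)
  have law: "distr M (?M n) (\<lambda>\<omega>. \<lambda>i\<in>{1..n}. X i \<omega>) = ?M n" if "1 \<le> n" for n
    by (rule distr_eq_expv_seq[OF assms(1-4) that])
  have rv: "X i \<in> borel_measurable M" if "1 \<le> i" for i
    using assms(2) that unfolding indep_vars_def by auto
  have p0: "0 \<le> p k" for k
    unfolding p_def by (intro integral_nonneg_AE AE_I2) (auto simp: gumbel_density_nonneg)
  have sum_le: "(\<Sum>k<L. p k) \<le> 1" for L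
  proof (rule tendsto_upperbound[OF tendsto_sum[OF lim]])
    show "\<forall>\<^sub>F n in sequentially. (\<Sum>k<L. ?r n k / ?c n) \<le> 1"
      using eventually_ge_at_top[of 1]
    proof eventually_elim
      case (elim n)
      from sum_prob_killed_le[OF elim, where 'd = 'd and L = L] show ?case
        using mixed_binom_0_pos[of "CARD('d) - 1" "n - 1"]
        by (simp only: sum_divide_distrib[symmetric] pos_divide_le_eq mult_1_left)
    qed
  qed simp
  have sum_ge: "1 - 1 / real L \<le> (\<Sum>k<L. p k)" if L: "0 < L" for L
  proof (rule tendsto_lowerbound[OF tendsto_sum[OF lim]])
    show "\<forall>\<^sub>F n in sequentially. 1 - 1 / real L \<le> (\<Sum>k<L. ?r n k / ?c n)"
      using eventually_ge_at_top[of 1]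
    proof eventually_elim
      case (elim n)
      from sum_prob_killed_ge[OF elim L, where 'd = 'd] show ?case
        using mixed_binom_0_pos[of "CARD('d) - 1" "n - 1"]
        by (simp only: sum_divide_distrib[symmetric] pos_le_divide_eq) (simp only: mult.commute)
    qed
  qed simp
  \<comment> \<open>No mass escapes to infinity: given a record, the mean number of kills is at most
    1 for all \<open>n\<close>, so Markov's inequality gives tightness, which passes to the
    limit.\<close>
  have "p sums 1"
    unfolding sums_def
  proof (rule tendsto_sandwich[OF _ _ _ tendsto_const])
    show "\<forall>\<^sub>F L in sequentially. 1 - 1 / real L \<le> (\<Sum>k<L. p k)"
      using eventually_gt_at_top[of 0] by eventually_elim (rule sum_ge)
    show "\<forall>\<^sub>F L in sequentially. (\<Sum>k<L. p k) \<le> 1" using sum_le by simp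
    show "(\<lambda>L. 1 - 1 / real L) \<longlonglongrightarrow> 1"
      using tendsto_diff[OF tendsto_const lim_1_over_n, of 1] by simp
  qed
  then have "(\<Sum>k. ennreal (p k)) = ennreal 1"
    by (rule suminf_ennreal_eq[OF p0])
  then have "(\<integral>\<^sup>+k. ennreal (p k) \<partial>count_space UNIV) = 1"
    by (simp only: nn_integral_count_space_nat ennreal_1)
  then have pmf: "pmf (embed_pmf p) k = p k" for k
    by (rule pmf_embed_pmf[OF p0])
  have bochner: "has_bochner_integral lborel (\<lambda>g. ?q k g * gumbel_density g) (pmf (embed_pmf p) k)" for k
    unfolding pmf unfolding p_def by (rule has_bochner_integral_integrable[OF mix(1)])
  \<comment> \<open>Conditionally the counts are natural numbers, so each distribution function is a
    finite sum of point probabilities and converges at every \<open>x\<close>, including the jumps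
    of the limit.\<close>
  have cdf_lim: "(\<lambda>n. cdf (distr (uniform_measure M {\<omega> \<in> space M. 0 \<le> K n \<omega>}) borel (\<lambda>\<omega>. real_of_int (K n \<omega>))) x)
    \<longlonglongrightarrow> cdf (distr (measure_pmf (embed_pmf p)) borel real) x" for x
  proof -
    \<comment> \<open>\<open>L\<close> counts the natural numbers up to \<open>x\<close>; for
      negative \<open>x\<close> the conversion \<open>nat\<close> returns 0 and the sum is
      empty.\<close>
    define L where "L = nat (\<lfloor>x\<rfloor> + 1)"
    have L: "real k \<le> x \<longleftrightarrow> k < L" for k unfolding L_def by linarith
    have "cdf (distr (measure_pmf (embed_pmf p)) borel real) x = measure (measure_pmf (embed_pmf p)) {..<L}"
      unfolding cdf_def by (subst measure_distr) (auto simp: L intro!: arg_cong2[where f = measure])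
    also have "\<dots> = (\<Sum>k<L. p k)"
      by (simp add: measure_measure_pmf_finite pmf)
    finally have rhs: "cdf (distr (measure_pmf (embed_pmf p)) borel real) x = (\<Sum>k<L. p k)" .
    have lhs: "cdf (distr (uniform_measure M {\<omega> \<in> space M. 0 \<le> K n \<omega>}) borel (\<lambda>\<omega>. real_of_int (K n \<omega>))) x
       = (\<Sum>k<L. ?r n k / ?c n)" if n: "1 \<le> n" for n
    proof -
      \<comment> \<open>\<open>K n\<close> depends on the vectors 1 to \<open>n\<close> only; the
        restriction places them in the finite product space whose law is known.\<close>
      let ?Y = "\<lambda>\<omega>. \<lambda>i\<in>{1..n}. X i \<omega>"
      have Y [measurable]: "?Y \<in> measurable M (?M n)"
        by (intro measurable_restrict) (use rv in \<open>auto simp: measurable_cong_sets[OF refl sets_expv]\<close>)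
      have rec: "sets_record (?Y \<omega>) n \<longleftrightarrow> sets_record (\<lambda>i. X i \<omega>) n" for \<omega>
        using n by (auto simp: sets_record_iff)
      have kil: "killed (?Y \<omega>) n = killed (\<lambda>i. X i \<omega>) n" for \<omega>
        using n by (auto simp: killed_def)
      note [measurable] = measurable_sets_record[OF n] measurable_card_killed[OF n]
      have K: "K n \<omega> = (if sets_record (?Y \<omega>) n then int (card (killed (?Y \<omega>) n)) else - 1)" for \<omega>
        unfolding K_def records_killed_eq[OF n] by (simp only: rec kil)
      have Km: "K n \<in> measurable M (count_space UNIV)"
      proof -
        have g: "(\<lambda>x. if sets_record x n then int (card (killed x n)) else - 1) \<in> measurable (?M n) (count_space UNIV)"
          by measurable
        show ?thesis unfolding K[abs_def] by (rule measurable_compose[OF Y g])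
      qed
      note [measurable] = Km
      let ?U = "{\<omega> \<in> space M. 0 \<le> K n \<omega>}"
      have tr: "prob {\<omega> \<in> space M. P (?Y \<omega>)} = measure (?M n) {x \<in> space (?M n). P x}"
        if "{x \<in> space (?M n). P x} \<in> sets (?M n)" for P
      proof -
        have "measure (?M n) {x \<in> space (?M n). P x} = prob (?Y -` {x \<in> space (?M n). P x} \<inter> space M)"
          by (subst law[OF n, symmetric], rule measure_distr[OF Y]) (use that in simp)
        also have "?Y -` {x \<in> space (?M n). P x} \<inter> space M = {\<omega> \<in> space M. P (?Y \<omega>)}"
          using measurable_space[OF Y] by auto
        finally show ?thesis ..
      qed
      \<comment> \<open>The only negative value of \<open>K n\<close> is -1, so the conditioning
        event is the record event.\<close>
      have U: "prob ?U = ?c n"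
      proof -
        have "?U = {\<omega> \<in> space M. sets_record (?Y \<omega>) n}" by (auto simp: K)
        then show ?thesis
          using tr[OF sets_event_record(1)[OF n]] prob_sets_record[OF n, where 'd = 'd] by (simp only:)
      qed
      have "cdf (distr (uniform_measure M ?U) borel (\<lambda>\<omega>. real_of_int (K n \<omega>))) x
        = measure (uniform_measure M ?U) {\<omega> \<in> space M. real_of_int (K n \<omega>) \<le> x}"
        unfolding cdf_def by (subst measure_distr) (auto intro!: arg_cong2[where f = measure])
      also have "\<dots> = prob (?U \<inter> {\<omega> \<in> space M. real_of_int (K n \<omega>) \<le> x}) / prob ?U"
      proof (rule measure_uniform_measure)
        show "emeasure M ?U \<noteq> 0"
          using U mixed_binom_0_pos[of "CARD('d) - 1" "n - 1"] by (simp add: emeasure_eq_measure)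
      qed (auto simp: emeasure_eq_measure)
      also have "?U \<inter> {\<omega> \<in> space M. real_of_int (K n \<omega>) \<le> x}
        = (\<Union>k<L. {\<omega> \<in> space M. sets_record (?Y \<omega>) n \<and> card (killed (?Y \<omega>) n) = k})"
        by (auto simp: K L)
      also have "prob \<dots> = (\<Sum>k<L. prob {\<omega> \<in> space M. sets_record (?Y \<omega>) n \<and> card (killed (?Y \<omega>) n) = k})"
      proof (rule finite_measure_finite_Union)
        show "(\<lambda>k. {\<omega> \<in> space M. sets_record (?Y \<omega>) n \<and> card (killed (?Y \<omega>) n) = k}) ` {..<L} \<subseteq> events"
        proof (rule image_subsetI)
          fix k
          have "Measurable.pred (?M n) (\<lambda>x. sets_record x n \<and> card (killed x n) = k)" by measurable
          from measurable_compose[OF Y this]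
          show "{\<omega> \<in> space M. sets_record (?Y \<omega>) n \<and> card (killed (?Y \<omega>) n) = k} \<in> events"
            by (simp add: pred_def)
        qed
      qed (auto simp: disjoint_family_on_def)
      also have "\<dots> = (\<Sum>k<L. ?r n k)"
        by (intro sum.cong refl tr sets_event_record(2)[OF n])
      finally show ?thesis unfolding U by (simp only: sum_divide_distrib)
    qed
    have "\<forall>\<^sub>F n in sequentially. (\<Sum>k<L. ?r n k / ?c n) =
        cdf (distr (uniform_measure M {\<omega> \<in> space M. 0 \<le> K n \<omega>}) borel (\<lambda>\<omega>. real_of_int (K n \<omega>))) x"
      using eventually_ge_at_top[of 1] by eventually_elim (rule lhs[symmetric])
    from Lim_transform_eventually[OF tendsto_sum[OF lim] this] show ?thesis unfolding rhs .
  qed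
  show ?thesis
    using bochner cdf_lim unfolding weak_conv_m_def weak_conv_def by blast
qed

end
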